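(* Let $K$ be an algebraically closed field and let $\Lambda=\Gamma^*(n)$ with $n\geq 1$. Then $\dim_K\mathrm{HH}^2(\Lambda)=2$.
   Context: Paths in quivers are written from left to right. For $n\geq1$, $\Gamma^*(n)=K\mathcal Q(n)/I(n)$, where $\mathcal Q(n)$ is the quiver with vertices $1,\dots,n,n+1,n+2$ and arrows $\beta_j:j\to j+1$ for $1\leq j\leq n-1$, $\beta_n:n\to1$, $\alpha_1:1\to n+1$, $\alpha_2:n+1\to1$, $\gamma_1:1\to n+2$, $\gamma_2:n+2\to 1$, and $I(n)$ is the ideal generated by the relations: (i) $\alpha_1\alpha_2=(\beta_1\beta_2\cdots\beta_n)^2=\gamma_1\gamma_2$; (ii) $\beta_n\alpha_1=0$, $\beta_n\gamma_1=0$, $\alpha_2\beta_1=0$, $\gamma_2\beta_1=0$, $\alpha_2\alpha_1=0$, $\gamma_2\gamma_1=0$; (iii) for all $j\in\{2,\dots,n\}$, $\beta_j\beta_{j+1}\cdots\beta_n\,\beta_1\cdots\beta_n\,\beta_1\cdots\beta_{j-1}\beta_j=0$. $\mathrm{HH}^2(\Lambda)$ is the second Hochschild cohomology group of $\Lambda$ over $K$ with coefficients in $\Lambda$, i.e. $\mathrm{Ext}^2$ of $\Lambda$ with itself as a $\Lambda,\Lambda$-bimodule. *)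

theory Defs
  imports
    "HOL-Algebra.Algebraic_Closure"
    "HOL-Algebra.QuotRing"
    "Graph_Theory.Arc_Walk"
    "Jordan_Normal_Form.Missing_VectorSpace"
begin

text \<open>
  Quivers are the \<^typ>\<open>('v, 'e) pre_digraph\<close>s of the graph library (loops and parallel
  arrows allowed), arrows going from \<^const>\<open>tail\<close> to \<^const>\<open>head\<close>.  A \<open>K\<close>-algebra is a
  \<^typ>\<open>('k, 'a) module\<close> record over the ring record \<open>K\<close>, whose ring part need not be commutative.
\<close>


section \<open>Path algebras\<close>

text \<open>
  A path is a pair of its start vertex and its list of arrows, read from left to right;
  \<open>(v, [])\<close> is the trivial path at \<open>v\<close>.
\<close>

definition quiver_paths :: "('v, 'e) pre_digraph \<Rightarrow> ('v \<times> 'e list) set" where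
  "quiver_paths Q = {(u, es). \<exists>v. pre_digraph.awalk Q u es v}"

text \<open>
  Elements are finitely supported \<open>K\<close>-valued functions on paths.  The coefficient of a product at
  a path sums over all factorisations of that path into an initial and a terminal part, so that
  the product of two paths \<open>p\<close> and \<open>q\<close> is \<open>p\<close> followed by \<open>q\<close>, or zero if \<open>q\<close> does not start where
  \<open>p\<close> ends.  The unit is the sum of the trivial paths, which makes sense only for finitely many
  vertices.
\<close>

definition path_algebra ::
  "('k, 'b) ring_scheme \<Rightarrow> ('v, 'e) pre_digraph \<Rightarrow> ('k, 'v \<times> 'e list \<Rightarrow> 'k) module" where
  "path_algebra K Q =
    \<lparr>carrier = {f \<in> quiver_paths Q \<rightarrow>\<^sub>E carrier K. finite {p \<in> quiver_paths Q. f p \<noteq> \<zero>\<^bsub>K\<^esub>}},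
     monoid.mult = (\<lambda>f g. \<lambda>(u, es) \<in> quiver_paths Q.
       \<Oplus>\<^bsub>K\<^esub> i \<in> {..length es}.
         f (u, take i es) \<otimes>\<^bsub>K\<^esub> g (last (pre_digraph.awalk_verts Q u (take i es)), drop i es)),
     one = (\<lambda>(u, es) \<in> quiver_paths Q. if es = [] then \<one>\<^bsub>K\<^esub> else \<zero>\<^bsub>K\<^esub>),
     zero = (\<lambda>p \<in> quiver_paths Q. \<zero>\<^bsub>K\<^esub>),
     add = (\<lambda>f g. \<lambda>p \<in> quiver_paths Q. f p \<oplus>\<^bsub>K\<^esub> g p),
     smult = (\<lambda>c f. \<lambda>p \<in> quiver_paths Q. c \<otimes>\<^bsub>K\<^esub> f p)\<rparr>"

definition path_elem ::
  "('k, 'b) ring_scheme \<Rightarrow> ('v, 'e) pre_digraph \<Rightarrow> 'v \<times> 'e list \<Rightarrow> 'v \<times> 'e list \<Rightarrow> 'k" where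
  "path_elem K Q p = (\<lambda>q \<in> quiver_paths Q. if q = p then \<one>\<^bsub>K\<^esub> else \<zero>\<^bsub>K\<^esub>)"


section \<open>Quotients with scalar action\<close>

text \<open>
  The library's quotient \<^const>\<open>FactRing\<close> together with the induced scalar action.  It is used for an
  algebra modulo an ideal, and for a module modulo a submodule; in the latter case the
  multiplication of the record is irrelevant.
\<close>

definition quotient_module ::
  "('k, 'a, 'm) module_scheme \<Rightarrow> 'a set \<Rightarrow> ('k, 'a set) module" where
  "quotient_module M N =
    ring.extend (M Quot N) (module.fields (\<lambda>c C. \<Union>x\<in>C. N +>\<^bsub>M\<^esub> (c \<odot>\<^bsub>M\<^esub> x)))"


section \<open>The algebras \<open>\<Gamma>\<^sup>*(n)\<close>\<close>

datatype arrow = Beta nat | Alpha1 | Alpha2 | Gamma1 | Gamma2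

fun arrow_source :: "nat \<Rightarrow> arrow \<Rightarrow> nat" where
  "arrow_source n (Beta j) = j"
| "arrow_source n Alpha1 = 1"
| "arrow_source n Alpha2 = n + 1"
| "arrow_source n Gamma1 = 1"
| "arrow_source n Gamma2 = n + 2"

fun arrow_target :: "nat \<Rightarrow> arrow \<Rightarrow> nat" where
  "arrow_target n (Beta j) = (if j = n then 1 else j + 1)"
| "arrow_target n Alpha1 = n + 1"
| "arrow_target n Alpha2 = 1"
| "arrow_target n Gamma1 = n + 2"
| "arrow_target n Gamma2 = 1"

definition quiver_Q :: "nat \<Rightarrow> (nat, arrow) pre_digraph" where
  "quiver_Q n =
    \<lparr>verts = {1..n + 2},
     arcs = Beta ` {1..n} \<union> {Alpha1, Alpha2, Gamma1, Gamma2},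
     tail = arrow_source n,
     head = arrow_target n\<rparr>"

definition arrow_word :: "('k, 'b) ring_scheme \<Rightarrow> nat \<Rightarrow> arrow list \<Rightarrow> nat \<times> arrow list \<Rightarrow> 'k" where
  "arrow_word K n es = path_elem K (quiver_Q n) (arrow_source n (hd es), es)"

text \<open>\<open>betas i j\<close> is \<open>\<beta>\<^sub>i \<dots> \<beta>\<^sub>j\<close>, empty if \<open>j < i\<close>.\<close>

definition betas :: "nat \<Rightarrow> nat \<Rightarrow> arrow list" where
  "betas i j = map Beta [i..<Suc j]"

definition relations_I :: "('k, 'b) ring_scheme \<Rightarrow> nat \<Rightarrow> (nat \<times> arrow list \<Rightarrow> 'k) set" where
  "relations_I K n =
    (let KQ = path_algebra K (quiver_Q n); w = arrow_word K n in
      {w [Alpha1, Alpha2] \<ominus>\<^bsub>KQ\<^esub> w (betas 1 n @ betas 1 n),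
       w (betas 1 n @ betas 1 n) \<ominus>\<^bsub>KQ\<^esub> w [Gamma1, Gamma2]}
      \<union> {w [Beta n, Alpha1], w [Beta n, Gamma1], w [Alpha2, Beta 1], w [Gamma2, Beta 1],
         w [Alpha2, Alpha1], w [Gamma2, Gamma1]}
      \<union> {w (betas j n @ betas 1 n @ betas 1 (j - 1) @ [Beta j]) | j. j \<in> {2..n}})"

definition Gamma_star ::
  "('k, 'b) ring_scheme \<Rightarrow> nat \<Rightarrow> ('k, (nat \<times> arrow list \<Rightarrow> 'k) set) module" where
  "Gamma_star K n =
    (let KQ = path_algebra K (quiver_Q n) in
      quotient_module KQ (genideal KQ (relations_I K n)))"


section \<open>Hochschild cohomology\<close>

text \<open>
  \<open>HH\<^sup>m(A)\<close> for a \<open>K\<close>-algebra \<open>A\<close> is the cohomology of Hochschild's cochain complex with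
  coefficients in the bimodule \<open>A\<close>, i.e. of \<open>Hom(B\<^sub>m, A)\<close> (bimodule maps) for the bar resolution
  \<open>B\<^sub>m = A\<^bsup>\<otimes>(m+2)\<^esup>\<close> of \<open>A\<close>, a projective bimodule resolution when \<open>K\<close> is a field; bimodule maps
  \<open>B\<^sub>m \<rightarrow> A\<close> are the same thing as \<open>K\<close>-multilinear maps in \<open>m\<close> arguments.
\<close>

definition tuples :: "('a, 'm) partial_object_scheme \<Rightarrow> nat \<Rightarrow> 'a list set" where
  "tuples A m = {xs. set xs \<subseteq> carrier A \<and> length xs = m}"

definition multilinear ::
  "('k, 'b) ring_scheme \<Rightarrow> ('k, 'a, 'm) module_scheme \<Rightarrow> nat \<Rightarrow> ('a list \<Rightarrow> 'a) \<Rightarrow> bool" where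
  "multilinear K A m f \<longleftrightarrow>
    (\<forall>xs \<in> tuples A m. \<forall>i < m. \<forall>x \<in> carrier A. \<forall>y \<in> carrier A. \<forall>c \<in> carrier K.
      f (xs[i := x \<oplus>\<^bsub>A\<^esub> y]) = f (xs[i := x]) \<oplus>\<^bsub>A\<^esub> f (xs[i := y]) \<and>
      f (xs[i := c \<odot>\<^bsub>A\<^esub> x]) = c \<odot>\<^bsub>A\<^esub> f (xs[i := x]))"

text \<open>Only the module structure of the cochains is used; \<open>mult\<close> and \<open>one\<close> are dummies.\<close>

definition hochschild_cochains ::
  "('k, 'b) ring_scheme \<Rightarrow> ('k, 'a, 'm) module_scheme \<Rightarrow> nat \<Rightarrow> ('k, 'a list \<Rightarrow> 'a) module" where
  "hochschild_cochains K A m =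
    \<lparr>carrier = {f \<in> tuples A m \<rightarrow>\<^sub>E carrier A. multilinear K A m f},
     monoid.mult = (\<lambda>f g. \<lambda>xs \<in> tuples A m. \<zero>\<^bsub>A\<^esub>),
     one = (\<lambda>xs \<in> tuples A m. \<zero>\<^bsub>A\<^esub>),
     zero = (\<lambda>xs \<in> tuples A m. \<zero>\<^bsub>A\<^esub>),
     add = (\<lambda>f g. \<lambda>xs \<in> tuples A m. f xs \<oplus>\<^bsub>A\<^esub> g xs),
     smult = (\<lambda>c f. \<lambda>xs \<in> tuples A m. c \<odot>\<^bsub>A\<^esub> f xs)\<rparr>"

text \<open>
  \<open>(\<delta>f)(x\<^sub>1,\<dots>,x\<^sub>m\<^sub>+\<^sub>1) = x\<^sub>1 f(x\<^sub>2,\<dots>,x\<^sub>m\<^sub>+\<^sub>1)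
     + \<Sum>i=1..m. (-1)^i f(x\<^sub>1,\<dots>,x\<^sub>i x\<^sub>i\<^sub>+\<^sub>1,\<dots>,x\<^sub>m\<^sub>+\<^sub>1)
     + (-1)^(m+1) f(x\<^sub>1,\<dots>,x\<^sub>m) x\<^sub>m\<^sub>+\<^sub>1\<close>; list indices start at \<open>0\<close>, so that \<open>x\<^sub>i = xs ! (i - 1)\<close>.
\<close>

definition hochschild_coboundary ::
  "('k, 'a, 'm) module_scheme \<Rightarrow> nat \<Rightarrow> ('a list \<Rightarrow> 'a) \<Rightarrow> 'a list \<Rightarrow> 'a" where
  "hochschild_coboundary A m f =
    (\<lambda>xs \<in> tuples A (Suc m).
      hd xs \<otimes>\<^bsub>A\<^esub> f (tl xs)
      \<oplus>\<^bsub>A\<^esub> (\<Oplus>\<^bsub>A\<^esub> i \<in> {1..m}.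
          add_pow A ((- 1) ^ i :: int)
            (f (take (i - 1) xs @ [xs ! (i - 1) \<otimes>\<^bsub>A\<^esub> xs ! i] @ drop (i + 1) xs)))
      \<oplus>\<^bsub>A\<^esub> add_pow A ((- 1) ^ (m + 1) :: int) (f (butlast xs) \<otimes>\<^bsub>A\<^esub> last xs))"

definition hochschild_cocycles ::
  "('k, 'b) ring_scheme \<Rightarrow> ('k, 'a, 'm) module_scheme \<Rightarrow> nat \<Rightarrow> ('a list \<Rightarrow> 'a) set" where
  "hochschild_cocycles K A m =
    {f \<in> carrier (hochschild_cochains K A m).
      hochschild_coboundary A m f = \<zero>\<^bsub>hochschild_cochains K A (Suc m)\<^esub>}"

fun hochschild_coboundaries ::
  "('k, 'b) ring_scheme \<Rightarrow> ('k, 'a, 'm) module_scheme \<Rightarrow> nat \<Rightarrow> ('a list \<Rightarrow> 'a) set" where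
  "hochschild_coboundaries K A 0 = {\<zero>\<^bsub>hochschild_cochains K A 0\<^esub>}"
| "hochschild_coboundaries K A (Suc m) =
    hochschild_coboundary A m ` carrier (hochschild_cochains K A m)"

definition HH ::
  "('k, 'b) ring_scheme \<Rightarrow> ('k, 'a, 'm) module_scheme \<Rightarrow> nat \<Rightarrow> ('k, ('a list \<Rightarrow> 'a) set) module" where
  "HH K A m =
    quotient_module
      (hochschild_cochains K A m \<lparr>carrier := hochschild_cocycles K A m\<rparr>)
      (hochschild_coboundaries K A m)"

end

(*
  Subtracting coboundaries, a 2-cocycle f of Gamma^*(n) can be made to vanish when one argument is a
  vertex, and further to vanish on (p, a) whenever the path p followed by the arrow a is again a
  normal form; the cochain needed for this is defined by recursion along normal forms.  What remains
  are the values on the relations.  Comparing overlaps of relations by means of the cocycle identity,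
  all of them are determined by the coefficients of e_1, c = beta_1 ... beta_n and c^2 in
  f(alpha_1, alpha_2), and that of c^2 in f(gamma_1, gamma_2); for n = 1 there is in addition
  f(beta_1, alpha_1), a multiple of alpha_1.  The coefficients of c^2 and the extra one for n = 1 are
  removed by coboundaries, and the other two are realised by the deformations
  alpha_1 alpha_2 = gamma_1 gamma_2 = c^2 + t and alpha_1 alpha_2 = gamma_1 gamma_2 = c^2 + t c, whose
  cocycles are independent modulo coboundaries.

  The normal forms are linearly independent in the path algebra modulo I(n) because the functionals
  reading off the coefficient of a normal form (for c^2: the sum of the coefficients of c^2,
  alpha_1 alpha_2 and gamma_1 gamma_2) have an ideal containing the relations as common kernel.
*)

theory Submission
  imports Defs "HOL-Number_Theory.Cong"
begin

section \<open>Quotient modules\<close>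

text \<open>The cohomology is computed in the locale \<open>gamma_star_basis\<close>, which knows
  the algebra only through a table where two normal forms multiply to zero or to a normal form; the
  path algebra serves to supply such a basis. No resolution smaller than the bar complex is built: a
  cocycle is corrected until it has to vanish.

  The minus signs in the deformed table come from alpha_2 beta_1 = 0: together with alpha_1 alpha_2
  = c^2 + t it gives c^2 beta_1 = - t beta_1. Likewise alpha_1 alpha_2 alpha_1 = t alpha_1 forces
  alpha_2 alpha_1 = t e_(n+1). With tc in place of t such products stay zero, because c alpha_1 = 0.

  A cochain g changes the coefficient of c in f(alpha_1, alpha_2) only through the coefficient of c
  in g(c^2). If g leaves the values at (c, alpha_1) and (c, c) alone, then g(c) has no e_1-term,
  hence g(c^2) = c g(c) + g(c) c has no c-term. This obstructs removing that coefficient, in every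
  characteristic, although g(c^2) looks like it carries a factor 2.\<close>

locale module_quotient = module K M for K :: "('k, 'b) ring_scheme" and M :: "('k, 'a, 'm) module_scheme" (structure) +
  fixes N
  assumes subgroup_N: "subgroup N (add_monoid M)"
    and smult_N: "\<lbrakk>c \<in> carrier K; x \<in> N\<rbrakk> \<Longrightarrow> c \<odot> x \<in> N"
begin

sublocale N: abelian_subgroup N M
  by (rule abelian_subgroupI3) (use subgroup_N M.abelian_group_axioms in \<open>auto simp: additive_subgroup_def\<close>)

lemma quotient_simps:
  "carrier (quotient_module M N) = a_rcosets N"
  "\<zero>\<^bsub>quotient_module M N\<^esub> = N"
  "add (quotient_module M N) = set_add M"
  by (simp_all add: quotient_module_def FactRing_def ring.extend_def ring.fields_def module.fields_def monoid.defs ring.defs)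

lemma coset_eq_iff:
  assumes "x \<in> carrier M" "y \<in> carrier M"
  shows "N +> x = N +> y \<longleftrightarrow> x \<ominus> y \<in> N"
proof -
  have "N +> x = N +> y \<longleftrightarrow> x \<in> N +> y"
    using assms N.a_repr_independence' N.a_repr_independenceD by metis
  then show ?thesis using N.a_rcos_module[of y x] assms by (simp add: a_minus_def)
qed

lemma coset_eq_self_iff: "x \<in> carrier M \<Longrightarrow> N +> x = N \<longleftrightarrow> x \<in> N"
  using N.a_rcos_const N.a_rcos_self by auto

lemma quotient_carrierE:
  assumes "C \<in> carrier (quotient_module M N)"
  obtains x where "x \<in> carrier M" "C = N +> x"
  using assms by (auto simp: quotient_simps A_RCOSETS_defs a_r_coset_def)

lemma coset_closed: "x \<in> carrier M \<Longrightarrow> N +> x \<in> carrier (quotient_module M N)"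
  using N.a_subset by (simp add: quotient_simps M.a_rcosetsI)

lemma quotient_add:
  assumes "x \<in> carrier M" "y \<in> carrier M"
  shows "(N +> x) \<oplus>\<^bsub>quotient_module M N\<^esub> (N +> y) = N +> (x \<oplus> y)"
  using assms by (simp add: quotient_simps N.a_rcos_sum)

text \<open>The defining union runs over all representatives of the coset; by \<open>smult_N\<close>
  they all yield the same coset, so the union collapses.\<close>

lemma quotient_smult:
  assumes c: "c \<in> carrier K" and x: "x \<in> carrier M"
  shows "c \<odot>\<^bsub>quotient_module M N\<^esub> (N +> x) = N +> (c \<odot> x)"
proof -
  have "N +> (c \<odot> y) = N +> (c \<odot> x)" if y: "y \<in> N +> x" for y
  proof -
    have yc: "y \<in> carrier M" using x y by (rule N.a_elemrcos_carrier)
    have "y \<oplus> \<ominus> x \<in> N" using N.a_rcos_module_imp[OF x y] .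
    then have "c \<odot> (y \<oplus> \<ominus> x) \<in> N" using c smult_N by blast
    then show ?thesis
      using c x yc by (simp add: coset_eq_iff smult_r_distr smult_r_minus a_minus_def)
  qed
  moreover have "x \<in> N +> x" using x by (rule N.a_rcos_self)
  ultimately have "(\<Union>y\<in>N +> x. N +> (c \<odot> y)) = N +> (c \<odot> x)" by blast
  then show ?thesis
    by (simp add: quotient_module_def FactRing_def ring.extend_def ring.fields_def module.fields_def monoid.defs ring.defs)
qed

lemma module_quotient_module: "module K (quotient_module M N)"
proof (rule moduleI)
  show "cring K" by (rule R.cring_axioms)
  show "abelian_group (quotient_module M N)"
  proof (rule abelian_groupI)
    fix C assume C: "C \<in> carrier (quotient_module M N)"
    obtain x where x: "x \<in> carrier M" "C = N +> x" using C by (rule quotient_carrierE)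
    have "(N +> (\<ominus> x)) \<oplus>\<^bsub>quotient_module M N\<^esub> C = \<zero>\<^bsub>quotient_module M N\<^esub>"
      using x by (simp add: quotient_add M.l_neg) (simp add: quotient_simps coset_eq_self_iff)
    then show "\<exists>D\<in>carrier (quotient_module M N). D \<oplus>\<^bsub>quotient_module M N\<^esub> C = \<zero>\<^bsub>quotient_module M N\<^esub>"
      using x coset_closed M.a_inv_closed by blast
    show "\<zero>\<^bsub>quotient_module M N\<^esub> \<oplus>\<^bsub>quotient_module M N\<^esub> C = C"
      using C by (simp add: quotient_simps N.rcosets_add_eq)
  qed (auto elim!: quotient_carrierE simp: quotient_add coset_closed M.a_ac,
      metis M.zero_closed coset_closed quotient_simps(2) coset_eq_self_iff N.zero_closed)
qed (auto elim!: quotient_carrierE simp: quotient_add quotient_smult coset_closed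
    smult_l_distr smult_r_distr smult_assoc1)

text \<open>The classes of \<open>u\<close> and \<open>v\<close> form a basis. Spanning and
  independence are phrased modulo \<open>N\<close> inside \<open>M\<close>, so that the criterion
  can be applied by computing with elements instead of cosets.\<close>

lemma vectorspace_quotient_dim_two:
  assumes K: "field K" and u: "u \<in> carrier M" and v: "v \<in> carrier M"
    and span: "\<And>x. x \<in> carrier M \<Longrightarrow>
      \<exists>a\<in>carrier K. \<exists>b\<in>carrier K. \<exists>y\<in>N. x = a \<odot> u \<oplus> b \<odot> v \<oplus> y"
    and indep: "\<And>a b. \<lbrakk>a \<in> carrier K; b \<in> carrier K; a \<odot> u \<oplus> b \<odot> v \<in> N\<rbrakk>
      \<Longrightarrow> a = \<zero>\<^bsub>K\<^esub> \<and> b = \<zero>\<^bsub>K\<^esub>"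
  shows "vectorspace K (quotient_module M N) \<and> vectorspace.fin_dim K (quotient_module M N)
    \<and> vectorspace.dim K (quotient_module M N) = 2"
proof -
  let ?Q = "quotient_module M N"
  interpret K: field K by (rule K)
  interpret Q: module K ?Q by (rule module_quotient_module)
  interpret Q: vectorspace K ?Q by unfold_locales
  define U V where "U = N +> u" and "V = N +> v"
  have UV: "U \<in> carrier ?Q" "V \<in> carrier ?Q" using u v by (simp_all add: U_def V_def coset_closed)
  have comb: "a \<odot>\<^bsub>?Q\<^esub> U \<oplus>\<^bsub>?Q\<^esub> b \<odot>\<^bsub>?Q\<^esub> V = N +> (a \<odot> u \<oplus> b \<odot> v)"
    if "a \<in> carrier K" "b \<in> carrier K" for a b
    using that u v by (simp add: U_def V_def quotient_smult quotient_add)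
  have ind: "a = \<zero>\<^bsub>K\<^esub> \<and> b = \<zero>\<^bsub>K\<^esub>"
    if "a \<in> carrier K" "b \<in> carrier K" "a \<odot>\<^bsub>?Q\<^esub> U \<oplus>\<^bsub>?Q\<^esub> b \<odot>\<^bsub>?Q\<^esub> V = \<zero>\<^bsub>?Q\<^esub>" for a b
  proof (rule indep[OF that(1,2)])
    have "N +> (a \<odot> u \<oplus> b \<odot> v) = N"
      using that(3) by (simp only: comb[OF that(1,2)] quotient_simps(2))
    then show "a \<odot> u \<oplus> b \<odot> v \<in> N"
      using that(1,2) u v by (simp add: coset_eq_self_iff)
  qed
  \<comment> \<open>A basis is a set, so the two classes have to be distinct to count as two; a
    coincidence would contradict independence with coefficients 1 and -1.\<close>
  have "U \<noteq> V"
  proof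
    assume "U = V"
    then have "\<one>\<^bsub>K\<^esub> \<odot>\<^bsub>?Q\<^esub> U \<oplus>\<^bsub>?Q\<^esub> (\<ominus>\<^bsub>K\<^esub> \<one>\<^bsub>K\<^esub>) \<odot>\<^bsub>?Q\<^esub> V = \<zero>\<^bsub>?Q\<^esub>"
      using UV by (simp add: Q.smult_l_minus Q.r_neg)
    then show False using ind[of "\<one>\<^bsub>K\<^esub>" "\<ominus>\<^bsub>K\<^esub> \<one>\<^bsub>K\<^esub>"] by simp
  qed
  have lc: "Q.lincomb a {U, V} = a U \<odot>\<^bsub>?Q\<^esub> U \<oplus>\<^bsub>?Q\<^esub> a V \<odot>\<^bsub>?Q\<^esub> V" if "a \<in> {U, V} \<rightarrow> carrier K" for a
    using UV \<open>U \<noteq> V\<close> that by (simp add: Q.lincomb_def Q.M.finsum_insert Pi_def)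
  have "Q.gen_set {U, V}"
  proof -
    have "C \<in> Q.span {U, V}" if C: "C \<in> carrier ?Q" for C
    proof -
      obtain x where x: "x \<in> carrier M" "C = N +> x" using C by (rule quotient_carrierE)
      from span[OF x(1)] obtain a b y where ab: "a \<in> carrier K" "b \<in> carrier K" and y: "y \<in> N"
        and xe: "x = a \<odot> u \<oplus> b \<odot> v \<oplus> y" by blast
      let ?w = "a \<odot> u \<oplus> b \<odot> v"
      have w: "?w \<in> carrier M" and yc: "y \<in> carrier M" using ab u v y by auto
      have "x \<ominus> ?w = y"
        using w yc by (simp add: xe a_minus_def M.a_ac M.r_neg)
      then have "N +> x = N +> ?w" using coset_eq_iff x(1) w y by simp
      then have "C = Q.lincomb (\<lambda>Z. if Z = U then a else b) {U, V}"
        using ab \<open>U \<noteq> V\<close> x by (simp add: lc comb)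
      then show ?thesis using Q.finite_span[of "{U, V}"] UV ab by auto
    qed
    moreover have "Q.span {U, V} \<subseteq> carrier ?Q" using Q.span_is_subset2[of "{U, V}"] UV by auto
    ultimately show ?thesis by blast
  qed
  moreover have "Q.lin_indpt {U, V}"
  proof (rule Q.finite_lin_indpt2)
    fix a assume a: "a \<in> {U, V} \<rightarrow> carrier K" "Q.lincomb a {U, V} = \<zero>\<^bsub>?Q\<^esub>"
    then show "\<forall>Z\<in>{U, V}. a Z = \<zero>\<^bsub>K\<^esub>" using ind[of "a U" "a V"] lc[OF a(1)] by fastforce
  qed (use UV in simp_all)
  ultimately have basis: "Q.basis {U, V}" unfolding Q.basis_def using UV by blast
  have "Q.fin_dim" unfolding Q.fin_dim_def
    using \<open>Q.gen_set {U, V}\<close> UV by (intro exI[of _ "{U, V}"]) blast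
  moreover have "Q.dim = 2" using Q.dim_basis[OF _ basis] \<open>U \<noteq> V\<close> by simp
  ultimately show ?thesis using Q.vectorspace_axioms by blast
qed

end

section \<open>Binary Hochschild cochains\<close>

lemma (in abelian_monoid) finsum_eq_single:
  assumes "finite V" "w \<in> V" "f w \<in> carrier G" "\<And>v. v \<in> V \<Longrightarrow> v \<noteq> w \<Longrightarrow> f v = \<zero>"
  shows "(\<Oplus>v\<in>V. f v) = f w"
proof -
  have "(\<Oplus>v\<in>V. f v) = (\<Oplus>v\<in>V. if w = v then f v else \<zero>)"
    by (rule finsum_cong') (use assms in auto)
  also have "\<dots> = f w"
  proof (rule finsum_singleton)
    show "f \<in> V \<rightarrow> carrier G" using assms(3,4) by (intro Pi_I) (metis zero_closed)
  qed (use assms in auto)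
  finally show ?thesis .
qed

lemma (in abelian_group) add4:
  assumes "a \<in> carrier G" "b \<in> carrier G" "c \<in> carrier G" "d \<in> carrier G"
  shows "(a \<oplus> b) \<oplus> (c \<oplus> d) = (a \<oplus> c) \<oplus> (b \<oplus> d)"
  using assms by (simp add: a_ac)

text \<open>The cancellation behind the vanishing of the squared coboundary: \<open>q\<close> stands
  for x g(yz) and \<open>u\<close> for g(xy) z, each occurring with both signs.\<close>

lemma (in ring) coboundary_cancel:
  assumes "p \<in> carrier R" "q \<in> carrier R" "r \<in> carrier R" "s \<in> carrier R" "t \<in> carrier R" "u \<in> carrier R"
  shows "(p \<ominus> q \<oplus> r) \<oplus> (q \<ominus> s \<oplus> t) = (p \<ominus> s \<oplus> u) \<oplus> (r \<ominus> u \<oplus> t)"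
proof -
  have "(p \<ominus> q \<oplus> r) \<oplus> (q \<ominus> s \<oplus> t) = (p \<ominus> s \<oplus> (r \<oplus> t)) \<oplus> (q \<ominus> q)"
    using assms unfolding a_minus_def by (simp only: a_ac add.m_closed a_inv_closed)
  moreover have "(p \<ominus> s \<oplus> u) \<oplus> (r \<ominus> u \<oplus> t) = (p \<ominus> s \<oplus> (r \<oplus> t)) \<oplus> (u \<ominus> u)"
    using assms unfolding a_minus_def by (simp only: a_ac add.m_closed a_inv_closed)
  ultimately show ?thesis using assms by (simp add: a_minus_def r_neg)
qed

section \<open>Linear maps, cocycles and coboundaries of a possibly noncommutative algebra\<close>

locale k_algebra = K: field K + A: ring A + M: module K A
  for K :: "('k, 'b) ring_scheme" and A :: "('k, 'a, 'm) module_scheme" (structure) +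
  assumes smult_mult_left: "\<lbrakk>c \<in> carrier K; x \<in> carrier A; y \<in> carrier A\<rbrakk> \<Longrightarrow> (c \<odot> x) \<otimes> y = c \<odot> (x \<otimes> y)"
    and smult_mult_right: "\<lbrakk>c \<in> carrier K; x \<in> carrier A; y \<in> carrier A\<rbrakk> \<Longrightarrow> x \<otimes> (c \<odot> y) = c \<odot> (x \<otimes> y)"
begin

definition lin :: "('a \<Rightarrow> 'a) \<Rightarrow> bool" where
  "lin g \<longleftrightarrow> g \<in> carrier A \<rightarrow> carrier A
    \<and> (\<forall>x\<in>carrier A. \<forall>y\<in>carrier A. g (x \<oplus> y) = g x \<oplus> g y)
    \<and> (\<forall>c\<in>carrier K. \<forall>x\<in>carrier A. g (c \<odot> x) = c \<odot> g x)"

definition bilin :: "('a \<Rightarrow> 'a \<Rightarrow> 'a) \<Rightarrow> bool" where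
  "bilin F \<longleftrightarrow> (\<forall>x\<in>carrier A. lin (F x)) \<and> (\<forall>y\<in>carrier A. lin (\<lambda>x. F x y))"

text \<open>The vanishing of the Hochschild coboundary, with its two negative terms moved to the
  other side to avoid subtraction.\<close>

definition cocycle :: "('a \<Rightarrow> 'a \<Rightarrow> 'a) \<Rightarrow> bool" where
  "cocycle F \<longleftrightarrow> bilin F \<and> (\<forall>x\<in>carrier A. \<forall>y\<in>carrier A. \<forall>z\<in>carrier A.
     x \<otimes> F y z \<oplus> F x (y \<otimes> z) = F (x \<otimes> y) z \<oplus> F x y \<otimes> z)"

definition cobd :: "('a \<Rightarrow> 'a) \<Rightarrow> 'a \<Rightarrow> 'a \<Rightarrow> 'a" where
  "cobd g x y = x \<otimes> g y \<ominus> g (x \<otimes> y) \<oplus> g x \<otimes> y"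

lemma linI:
  assumes "\<And>x. x \<in> carrier A \<Longrightarrow> g x \<in> carrier A"
    and "\<And>x y. \<lbrakk>x \<in> carrier A; y \<in> carrier A\<rbrakk> \<Longrightarrow> g (x \<oplus> y) = g x \<oplus> g y"
    and "\<And>c x. \<lbrakk>c \<in> carrier K; x \<in> carrier A\<rbrakk> \<Longrightarrow> g (c \<odot> x) = c \<odot> g x"
  shows "lin g"
  using assms by (auto simp: lin_def)

lemma lin_closed: "lin g \<Longrightarrow> x \<in> carrier A \<Longrightarrow> g x \<in> carrier A"
  and lin_add: "lin g \<Longrightarrow> x \<in> carrier A \<Longrightarrow> y \<in> carrier A \<Longrightarrow> g (x \<oplus> y) = g x \<oplus> g y"
  and lin_smult: "lin g \<Longrightarrow> c \<in> carrier K \<Longrightarrow> x \<in> carrier A \<Longrightarrow> g (c \<odot> x) = c \<odot> g x"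
  by (auto simp: lin_def)

lemma lin_zero: "lin g \<Longrightarrow> g \<zero> = \<zero>"
  using lin_smult[of g "\<zero>\<^bsub>K\<^esub>" "\<zero>"] lin_closed[of g "\<zero>"] by simp

lemma lin_plus: "lin g \<Longrightarrow> lin h \<Longrightarrow> lin (\<lambda>x. g x \<oplus> h x)"
  by (rule linI) (simp_all add: lin_closed lin_add lin_smult A.add4 M.smult_r_distr)

lemma lin_uminus: "lin g \<Longrightarrow> lin (\<lambda>x. \<ominus> g x)"
  by (rule linI) (simp_all add: lin_closed lin_add lin_smult A.minus_add M.smult_r_minus)

lemma lin_scale: "lin g \<Longrightarrow> c \<in> carrier K \<Longrightarrow> lin (\<lambda>x. c \<odot> g x)"
  by (rule linI) (simp_all add: lin_closed lin_add lin_smult M.smult_r_distr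
      M.smult_assoc1[symmetric] K.m_comm)

lemma lin_mult_left: "lin g \<Longrightarrow> a \<in> carrier A \<Longrightarrow> lin (\<lambda>x. a \<otimes> g x)"
  by (rule linI) (simp_all add: lin_closed lin_add lin_smult A.r_distr smult_mult_right)

lemma lin_mult_right: "lin g \<Longrightarrow> a \<in> carrier A \<Longrightarrow> lin (\<lambda>x. g x \<otimes> a)"
  by (rule linI) (simp_all add: lin_closed lin_add lin_smult A.l_distr smult_mult_left)

lemma lin_comp: "lin g \<Longrightarrow> lin h \<Longrightarrow> lin (\<lambda>x. g (h x))"
  by (rule linI) (simp_all add: lin_closed lin_add lin_smult)

lemma lin_id: "lin (\<lambda>x. x)"
  by (rule linI) simp_all

lemma lin_const_zero: "lin (\<lambda>x. \<zero>)"
  by (rule linI) simp_all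

lemma bilinD: "bilin F \<Longrightarrow> x \<in> carrier A \<Longrightarrow> lin (F x)"
   "bilin F \<Longrightarrow> y \<in> carrier A \<Longrightarrow> lin (\<lambda>x. F x y)"
  by (auto simp: bilin_def)

lemma bilin_closed: "bilin F \<Longrightarrow> x \<in> carrier A \<Longrightarrow> y \<in> carrier A \<Longrightarrow> F x y \<in> carrier A"
  using bilinD lin_closed by blast

lemma bilin_zero: "bilin F \<Longrightarrow> x \<in> carrier A \<Longrightarrow> F x \<zero> = \<zero>"
   "bilin F \<Longrightarrow> y \<in> carrier A \<Longrightarrow> F \<zero> y = \<zero>"
  using bilinD lin_zero by blast+

lemma cocycle_bilin: "cocycle F \<Longrightarrow> bilin F"
  and cocycleD: "cocycle F \<Longrightarrow> x \<in> carrier A \<Longrightarrow> y \<in> carrier A \<Longrightarrow> z \<in> carrier A \<Longrightarrow>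
     x \<otimes> F y z \<oplus> F x (y \<otimes> z) = F (x \<otimes> y) z \<oplus> F x y \<otimes> z"
  by (auto simp: cocycle_def)

lemma bilin_plus: "bilin F \<Longrightarrow> bilin G \<Longrightarrow> bilin (\<lambda>x y. F x y \<oplus> G x y)"
  by (simp add: bilin_def lin_plus)

lemma bilin_uminus: "bilin F \<Longrightarrow> bilin (\<lambda>x y. \<ominus> F x y)"
  by (simp add: bilin_def lin_uminus)

lemma bilin_scale: "bilin F \<Longrightarrow> c \<in> carrier K \<Longrightarrow> bilin (\<lambda>x y. c \<odot> F x y)"
  by (simp add: bilin_def lin_scale)

lemma cocycle_plus:
  assumes F: "cocycle F" and G: "cocycle G"
  shows "cocycle (\<lambda>x y. F x y \<oplus> G x y)"
proof -
  note [simp] = bilin_closed[OF cocycle_bilin[OF F]] bilin_closed[OF cocycle_bilin[OF G]]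
  show ?thesis
    unfolding cocycle_def
  proof (intro conjI ballI bilin_plus cocycle_bilin F G)
    fix x y z assume [simp]: "x \<in> carrier A" "y \<in> carrier A" "z \<in> carrier A"
    show "x \<otimes> (F y z \<oplus> G y z) \<oplus> (F x (y \<otimes> z) \<oplus> G x (y \<otimes> z)) =
        F (x \<otimes> y) z \<oplus> G (x \<otimes> y) z \<oplus> (F x y \<oplus> G x y) \<otimes> z"
      by (simp add: A.r_distr A.l_distr A.add4[of _ "x \<otimes> G y z"] A.add4[of _ "G (x \<otimes> y) z"]
          cocycleD[OF F] cocycleD[OF G])
  qed
qed

lemma cocycle_uminus:
  assumes F: "cocycle F"
  shows "cocycle (\<lambda>x y. \<ominus> F x y)"
proof -
  note [simp] = bilin_closed[OF cocycle_bilin[OF F]]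
  show ?thesis
    unfolding cocycle_def
  proof (intro conjI ballI bilin_uminus cocycle_bilin F)
    fix x y z assume [simp]: "x \<in> carrier A" "y \<in> carrier A" "z \<in> carrier A"
    show "x \<otimes> (\<ominus> F y z) \<oplus> (\<ominus> F x (y \<otimes> z)) = (\<ominus> F (x \<otimes> y) z) \<oplus> (\<ominus> F x y) \<otimes> z"
      by (simp add: A.r_minus A.l_minus cocycleD[OF F] flip: A.minus_add)
  qed
qed

lemma cocycle_scale:
  assumes F: "cocycle F" and c: "c \<in> carrier K"
  shows "cocycle (\<lambda>x y. c \<odot> F x y)"
proof -
  note [simp] = bilin_closed[OF cocycle_bilin[OF F]] c
  show ?thesis
    unfolding cocycle_def
  proof (intro conjI ballI bilin_scale cocycle_bilin F c)
    fix x y z assume [simp]: "x \<in> carrier A" "y \<in> carrier A" "z \<in> carrier A"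
    show "x \<otimes> (c \<odot> F y z) \<oplus> c \<odot> F x (y \<otimes> z) = c \<odot> F (x \<otimes> y) z \<oplus> (c \<odot> F x y) \<otimes> z"
      by (simp add: smult_mult_right smult_mult_left M.smult_r_distr[symmetric] cocycleD[OF F])
  qed
qed

lemma bilin_cobd:
  assumes g: "lin g"
  shows "bilin (cobd g)"
  unfolding bilin_def cobd_def a_minus_def
  by (intro conjI ballI lin_plus lin_uminus lin_mult_left lin_mult_right g lin_comp[OF g] lin_id
      lin_closed[OF g])

lemma cocycle_cobd:
  assumes g: "lin g"
  shows "cocycle (cobd g)"
  unfolding cocycle_def
proof (intro conjI ballI bilin_cobd g)
  fix x y z assume [simp]: "x \<in> carrier A" "y \<in> carrier A" "z \<in> carrier A"
  note [simp] = lin_closed[OF g]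
  have "x \<otimes> cobd g y z \<oplus> cobd g x (y \<otimes> z) =
      (x \<otimes> (y \<otimes> g z) \<ominus> x \<otimes> g (y \<otimes> z) \<oplus> x \<otimes> (g y \<otimes> z))
      \<oplus> (x \<otimes> g (y \<otimes> z) \<ominus> g (x \<otimes> (y \<otimes> z)) \<oplus> g x \<otimes> (y \<otimes> z))"
    by (simp add: cobd_def a_minus_def A.r_distr A.r_minus)
  also have "\<dots> = (x \<otimes> (y \<otimes> g z) \<ominus> g (x \<otimes> (y \<otimes> z)) \<oplus> g (x \<otimes> y) \<otimes> z)
      \<oplus> (x \<otimes> (g y \<otimes> z) \<ominus> g (x \<otimes> y) \<otimes> z \<oplus> g x \<otimes> (y \<otimes> z))"
    by (rule A.coboundary_cancel) simp_all
  also have "\<dots> = cobd g (x \<otimes> y) z \<oplus> cobd g x y \<otimes> z"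
    by (simp add: cobd_def a_minus_def A.l_distr A.l_minus A.m_assoc)
  finally show "x \<otimes> cobd g y z \<oplus> cobd g x (y \<otimes> z) = cobd g (x \<otimes> y) z \<oplus> cobd g x y \<otimes> z" .
qed

lemma cobd_plus:
  assumes "lin g" "lin h" "x \<in> carrier A" "y \<in> carrier A"
  shows "cobd (\<lambda>x. g x \<oplus> h x) x y = cobd g x y \<oplus> cobd h x y"
  using assms lin_closed[OF assms(1)] lin_closed[OF assms(2)]
  by (simp add: cobd_def a_minus_def A.l_distr A.r_distr A.minus_add A.a_ac)

lemma cobd_uminus:
  assumes "lin g" "x \<in> carrier A" "y \<in> carrier A"
  shows "cobd (\<lambda>x. \<ominus> g x) x y = \<ominus> cobd g x y"
  using assms lin_closed[OF assms(1)]
  by (simp add: cobd_def a_minus_def A.l_minus A.r_minus A.minus_add)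

lemma cobd_scale:
  assumes "lin g" "c \<in> carrier K" "x \<in> carrier A" "y \<in> carrier A"
  shows "cobd (\<lambda>x. c \<odot> g x) x y = c \<odot> cobd g x y"
  using assms lin_closed[OF assms(1)]
  by (simp add: cobd_def a_minus_def smult_mult_left smult_mult_right M.smult_r_distr M.smult_r_minus)

section \<open>Cochains on lists versus functions of one or two arguments\<close>

definition bin_cochain :: "('a \<Rightarrow> 'a \<Rightarrow> 'a) \<Rightarrow> 'a list \<Rightarrow> 'a" where
  "bin_cochain F = (\<lambda>xs \<in> tuples A 2. F (xs ! 0) (xs ! 1))"

abbreviation uncochain :: "('a list \<Rightarrow> 'a) \<Rightarrow> 'a \<Rightarrow> 'a \<Rightarrow> 'a" where
  "uncochain f \<equiv> (\<lambda>x y. f [x, y])"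

lemma tuples_1E: "xs \<in> tuples A (Suc 0) \<Longrightarrow> (\<And>x. xs = [x] \<Longrightarrow> x \<in> carrier A \<Longrightarrow> P) \<Longrightarrow> P"
  by (auto simp: tuples_def length_Suc_conv)

lemma tuples_2E: "xs \<in> tuples A 2 \<Longrightarrow>
    (\<And>x y. xs = [x, y] \<Longrightarrow> x \<in> carrier A \<Longrightarrow> y \<in> carrier A \<Longrightarrow> P) \<Longrightarrow> P"
  by (auto simp: tuples_def length_Suc_conv numeral_2_eq_2)

lemma tuples_3E: "xs \<in> tuples A 3 \<Longrightarrow>
    (\<And>x y z. xs = [x, y, z] \<Longrightarrow> x \<in> carrier A \<Longrightarrow> y \<in> carrier A \<Longrightarrow> z \<in> carrier A \<Longrightarrow> P) \<Longrightarrow> P"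
  by (auto simp: tuples_def length_Suc_conv numeral_3_eq_3)

lemma tuples_1I: "x \<in> carrier A \<Longrightarrow> [x] \<in> tuples A (Suc 0)"
  and tuples_2I: "x \<in> carrier A \<Longrightarrow> y \<in> carrier A \<Longrightarrow> [x, y] \<in> tuples A 2"
  and tuples_3I: "x \<in> carrier A \<Longrightarrow> y \<in> carrier A \<Longrightarrow> z \<in> carrier A \<Longrightarrow> [x, y, z] \<in> tuples A 3"
  by (auto simp: tuples_def)

lemma bin_cochain_apply: "x \<in> carrier A \<Longrightarrow> y \<in> carrier A \<Longrightarrow> bin_cochain F [x, y] = F x y"
  by (simp add: bin_cochain_def tuples_2I)

text \<open>Linearity and the cocycle identity constrain values on the carrier only; restricting to
  the tuples turns agreement there into equality of cochains.\<close>

lemma bin_cochain_cong: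
  assumes "\<And>x y. x \<in> carrier A \<Longrightarrow> y \<in> carrier A \<Longrightarrow> F x y = G x y"
  shows "bin_cochain F = bin_cochain G"
  unfolding bin_cochain_def by (rule restrict_ext) (auto elim!: tuples_2E simp: assms)

lemma extensional_eq_bin_cochain:
  "f \<in> extensional (tuples A 2) \<Longrightarrow> f = bin_cochain (uncochain f)"
  by (rule extensionalityI[of _ "tuples A 2"]) (auto simp: bin_cochain_def tuples_2I elim!: tuples_2E)

lemma bilin_cong:
  assumes "\<And>x y. x \<in> carrier A \<Longrightarrow> y \<in> carrier A \<Longrightarrow> F x y = G x y"
  shows "bilin F = bilin G"
  using assms by (simp add: bilin_def lin_def Pi_def)

lemma cocycle_cong:
  assumes "\<And>x y. x \<in> carrier A \<Longrightarrow> y \<in> carrier A \<Longrightarrow> F x y = G x y"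
  shows "cocycle F = cocycle G"
  using bilin_cong[of F G] bilin_closed[of F] assms by (simp add: cocycle_def)

lemma cochains_1_iff:
  "f \<in> carrier (hochschild_cochains K A 1) \<longleftrightarrow>
    f \<in> extensional (tuples A 1) \<and> lin (\<lambda>x. f [x])"
proof -
  have "multilinear K A 1 f \<longleftrightarrow>
      (\<forall>x\<in>carrier A. \<forall>y\<in>carrier A. \<forall>c\<in>carrier K.
        f [x \<oplus> y] = f [x] \<oplus> f [y] \<and> f [c \<odot> x] = c \<odot> f [x])"
    unfolding multilinear_def
    by (auto elim!: tuples_1E dest!: bspec[OF _ tuples_1I[OF A.zero_closed]])
  moreover have "f \<in> tuples A 1 \<rightarrow> carrier A \<longleftrightarrow> (\<lambda>x. f [x]) \<in> carrier A \<rightarrow> carrier A"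
    by (auto simp: Pi_def tuples_1I elim!: tuples_1E)
  \<comment> \<open>\<open>multilinear\<close> states additivity under the quantifier over scalars,
    so some scalar must exist before additivity can be extracted.\<close>
  moreover have "\<exists>c. c \<in> carrier K" by blast
  ultimately show ?thesis
    unfolding hochschild_cochains_def lin_def PiE_def by simp blast
qed

lemma cochains_2_iff:
  "f \<in> carrier (hochschild_cochains K A 2) \<longleftrightarrow>
    f \<in> extensional (tuples A 2) \<and> bilin (uncochain f)"
proof -
  have "multilinear K A 2 f \<longleftrightarrow>
      (\<forall>w\<in>carrier A. \<forall>x\<in>carrier A. \<forall>y\<in>carrier A. \<forall>c\<in>carrier K.
        f [x \<oplus> y, w] = f [x, w] \<oplus> f [y, w] \<and> f [c \<odot> x, w] = c \<odot> f [x, w] \<and>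
        f [w, x \<oplus> y] = f [w, x] \<oplus> f [w, y] \<and> f [w, c \<odot> x] = c \<odot> f [w, x])" (is "?L \<longleftrightarrow> ?R")
  proof
    assume L: ?L
    show ?R
    proof (intro ballI)
      fix w x y c assume *: "w \<in> carrier A" "x \<in> carrier A" "y \<in> carrier A" "c \<in> carrier K"
      \<comment> \<open>Updating position 0 or 1 of this one tuple gives both kinds of pairs in the
        claim.\<close>
      have w: "[w, w] \<in> tuples A 2" using * by (simp add: tuples_2I)
      have "(0::nat) < 2" "(1::nat) < 2" by simp_all
      with L[unfolded multilinear_def, rule_format, OF w _ *(2,3,4)]
      show "f [x \<oplus> y, w] = f [x, w] \<oplus> f [y, w] \<and> f [c \<odot> x, w] = c \<odot> f [x, w] \<and>
        f [w, x \<oplus> y] = f [w, x] \<oplus> f [w, y] \<and> f [w, c \<odot> x] = c \<odot> f [w, x]"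
        by fastforce
    qed
  next
    assume R: ?R
    show ?L
      unfolding multilinear_def
    proof (intro ballI allI impI)
      fix xs i x y c assume *: "xs \<in> tuples A 2" "i < (2::nat)" "x \<in> carrier A" "y \<in> carrier A" "c \<in> carrier K"
      obtain u v where uv: "xs = [u, v]" "u \<in> carrier A" "v \<in> carrier A" using *(1) by (rule tuples_2E)
      have "i = 0 \<or> i = 1" using *(2) by auto
      then show "f (xs[i := x \<oplus> y]) = f (xs[i := x]) \<oplus> f (xs[i := y]) \<and>
          f (xs[i := c \<odot> x]) = c \<odot> f (xs[i := x])"
        using R uv * by auto
    qed
  qed
  moreover have "f \<in> tuples A 2 \<rightarrow> carrier A \<longleftrightarrow> (\<forall>x\<in>carrier A. \<forall>y\<in>carrier A. f [x, y] \<in> carrier A)"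
    by (auto simp: Pi_def tuples_2I elim!: tuples_2E)
  moreover have "\<exists>c. c \<in> carrier K" by blast
  ultimately show ?thesis
    unfolding hochschild_cochains_def bilin_def lin_def PiE_def Pi_def by simp blast
qed

lemma coboundary_1:
  assumes "f \<in> carrier (hochschild_cochains K A 1)"
  shows "hochschild_coboundary A 1 f = bin_cochain (cobd (\<lambda>x. f [x]))"
proof (rule extensionalityI[of _ "tuples A 2"])
  note [simp] = lin_closed[OF conjunct2[OF iffD1[OF cochains_1_iff assms]]]
  fix xs assume "xs \<in> tuples A 2"
  then show "hochschild_coboundary A 1 f xs = bin_cochain (cobd (\<lambda>x. f [x])) xs"
    by (elim tuples_2E)
      (simp add: hochschild_coboundary_def bin_cochain_apply tuples_2I cobd_def a_minus_def
        A.add.int_pow_neg numeral_2_eq_2[symmetric])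
qed (auto simp: hochschild_coboundary_def bin_cochain_def numeral_2_eq_2)

lemma coboundary_2_zero_iff:
  assumes f: "f \<in> carrier (hochschild_cochains K A 2)"
  shows "hochschild_coboundary A 2 f = \<zero>\<^bsub>hochschild_cochains K A (Suc 2)\<^esub> \<longleftrightarrow> cocycle (uncochain f)"
proof -
  note bl = conjunct2[OF iffD1[OF cochains_2_iff f]]
  note cl[simp] = bilin_closed[OF bl]
  have 12: "{Suc 0..2} = {Suc 0, 2}" by auto
  have eq: "hochschild_coboundary A 2 f [x, y, z] =
      x \<otimes> f [y, z] \<oplus> (\<ominus> f [x \<otimes> y, z] \<oplus> f [x, y \<otimes> z]) \<oplus> (\<ominus> (f [x, y] \<otimes> z))"
    if [simp]: "x \<in> carrier A" "y \<in> carrier A" "z \<in> carrier A" for x y z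
    by (simp add: hochschild_coboundary_def tuples_3I numeral_3_eq_3[symmetric] 12
        A.finsum_insert A.add.int_pow_neg A.add.int_pow_mult)
  have rearr: "p \<oplus> (\<ominus> q \<oplus> r) \<oplus> (\<ominus> s) = \<zero> \<longleftrightarrow> p \<oplus> r = q \<oplus> s"
    if [simp]: "p \<in> carrier A" "q \<in> carrier A" "r \<in> carrier A" "s \<in> carrier A" for p q r s
  proof -
    have "p \<oplus> (\<ominus> q \<oplus> r) \<oplus> (\<ominus> s) = (p \<oplus> r) \<ominus> (q \<oplus> s)"
      by (simp add: a_minus_def A.minus_add A.a_ac)
    then show ?thesis by (simp add: A.r_right_minus_eq)
  qed
  have "hochschild_coboundary A 2 f = \<zero>\<^bsub>hochschild_cochains K A (Suc 2)\<^esub> \<longleftrightarrow>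
      (\<forall>xs\<in>tuples A 3. hochschild_coboundary A 2 f xs = \<zero>)"
  proof
    assume "hochschild_coboundary A 2 f = \<zero>\<^bsub>hochschild_cochains K A (Suc 2)\<^esub>"
    then show "\<forall>xs\<in>tuples A 3. hochschild_coboundary A 2 f xs = \<zero>"
      by (simp add: hochschild_cochains_def numeral_3_eq_3 numeral_2_eq_2)
  next
    assume "\<forall>xs\<in>tuples A 3. hochschild_coboundary A 2 f xs = \<zero>"
    then show "hochschild_coboundary A 2 f = \<zero>\<^bsub>hochschild_cochains K A (Suc 2)\<^esub>"
      by (intro extensionalityI[of _ "tuples A 3"])
        (auto simp: hochschild_cochains_def hochschild_coboundary_def numeral_3_eq_3 numeral_2_eq_2)
  qed
  also have "\<dots> \<longleftrightarrow> (\<forall>x\<in>carrier A. \<forall>y\<in>carrier A. \<forall>z\<in>carrier A.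
      hochschild_coboundary A 2 f [x, y, z] = \<zero>)"
    by (auto simp: tuples_3I elim!: tuples_3E)
  also have "\<dots> \<longleftrightarrow> cocycle (uncochain f)"
    using bl by (simp add: cocycle_def eq rearr)
  finally show ?thesis .
qed

lemma cocycles_iff:
  "f \<in> hochschild_cocycles K A 2 \<longleftrightarrow> f \<in> extensional (tuples A 2) \<and> cocycle (uncochain f)"
  unfolding hochschild_cocycles_def mem_Collect_eq
  using coboundary_2_zero_iff cochains_2_iff cocycle_bilin by blast

lemma bin_cochain_cocycle: "cocycle F \<Longrightarrow> bin_cochain F \<in> hochschild_cocycles K A 2"
  unfolding cocycles_iff using cocycle_cong[of "uncochain (bin_cochain F)" F]
  by (simp add: bin_cochain_apply) (simp add: bin_cochain_def)

lemma coboundaries_eq: "hochschild_coboundaries K A 2 = {bin_cochain (cobd g) | g. lin g}"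
proof -
  have "hochschild_coboundaries K A 2 = hochschild_coboundary A 1 ` carrier (hochschild_cochains K A 1)"
    by (simp add: numeral_2_eq_2)
  also have "\<dots> = {bin_cochain (cobd g) | g. lin g}"
  proof (intro equalityI subsetI)
    fix f assume "f \<in> {bin_cochain (cobd g) | g. lin g}"
    then obtain g where g: "f = bin_cochain (cobd g)" "lin g" by blast
    define h where "h = (\<lambda>xs\<in>tuples A 1. g (hd xs))"
    have hg: "h [x] = g x" if "x \<in> carrier A" for x using that by (simp add: h_def tuples_1I)
    then have "lin (\<lambda>x. h [x])" using g(2) by (simp add: lin_def Pi_def)
    then have h: "h \<in> carrier (hochschild_cochains K A 1)"
      unfolding cochains_1_iff by (simp add: h_def)
    have "hochschild_coboundary A 1 h = f"
      unfolding coboundary_1[OF h] g(1) by (rule bin_cochain_cong) (simp add: cobd_def hg)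
    then show "f \<in> hochschild_coboundary A 1 ` carrier (hochschild_cochains K A 1)" using h by blast
  qed (use coboundary_1 cochains_1_iff in blast)
  finally show ?thesis .
qed

section \<open>The module of 2-cocycles and its quotient by the coboundaries\<close>

abbreviation cocycle_module :: "('k, 'a list \<Rightarrow> 'a) module" where
  "cocycle_module \<equiv> hochschild_cochains K A 2\<lparr>carrier := hochschild_cocycles K A 2\<rparr>"

lemma cocycle_module_simps:
  "carrier cocycle_module = hochschild_cocycles K A 2"
  "\<zero>\<^bsub>cocycle_module\<^esub> = bin_cochain (\<lambda>x y. \<zero>)"
  "f \<oplus>\<^bsub>cocycle_module\<^esub> g = (\<lambda>xs\<in>tuples A 2. f xs \<oplus> g xs)"
  "c \<odot>\<^bsub>cocycle_module\<^esub> f = (\<lambda>xs\<in>tuples A 2. c \<odot> f xs)"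
  by (simp_all add: hochschild_cochains_def bin_cochain_def)

lemma bin_cochain_add:
  "bin_cochain F \<oplus>\<^bsub>cocycle_module\<^esub> bin_cochain G = bin_cochain (\<lambda>x y. F x y \<oplus> G x y)"
  unfolding cocycle_module_simps by (auto simp: bin_cochain_def intro!: restrict_ext)

lemma bin_cochain_smult:
  "c \<odot>\<^bsub>cocycle_module\<^esub> bin_cochain F = bin_cochain (\<lambda>x y. c \<odot> F x y)"
  unfolding cocycle_module_simps by (auto simp: bin_cochain_def intro!: restrict_ext)

lemma cocycle_module_elemE:
  assumes "f \<in> carrier cocycle_module"
  obtains F where "cocycle F" "f = bin_cochain F"
  using assms extensional_eq_bin_cochain unfolding cocycle_module_simps cocycles_iff by blast

lemma cocycle_zero: "cocycle (\<lambda>x y. \<zero>)"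
  by (auto simp: cocycle_def bilin_def lin_const_zero)

lemma cocycle_closed: "cocycle F \<Longrightarrow> x \<in> carrier A \<Longrightarrow> y \<in> carrier A \<Longrightarrow> F x y \<in> carrier A"
  using cocycle_bilin bilin_closed by blast

lemma bin_cochain_closed: "cocycle F \<Longrightarrow> bin_cochain F \<in> carrier cocycle_module"
  by (simp add: bin_cochain_cocycle)

text \<open>Every element is \<open>bin_cochain F\<close> for a cocycle \<open>F\<close>, so each
  axiom reduces to an identity between values in \<open>A\<close>.\<close>

lemma module_cocycle_module: "module K cocycle_module"
proof (rule moduleI)
  show "cring K" by (rule K.cring_axioms)
  show "abelian_group cocycle_module"
  proof (rule abelian_groupI)
    show "\<zero>\<^bsub>cocycle_module\<^esub> \<in> carrier cocycle_module"
      unfolding cocycle_module_simps(2) by (rule bin_cochain_closed[OF cocycle_zero])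
  next
    fix f assume "f \<in> carrier cocycle_module"
    then obtain F where F: "cocycle F" "f = bin_cochain F" by (rule cocycle_module_elemE)
    show "\<zero>\<^bsub>cocycle_module\<^esub> \<oplus>\<^bsub>cocycle_module\<^esub> f = f"
      unfolding cocycle_module_simps(2) F bin_cochain_add
      by (rule bin_cochain_cong) (simp add: cocycle_closed F)
    have "bin_cochain (\<lambda>x y. \<ominus> F x y) \<oplus>\<^bsub>cocycle_module\<^esub> f = \<zero>\<^bsub>cocycle_module\<^esub>"
      unfolding cocycle_module_simps(2) F bin_cochain_add
      by (rule bin_cochain_cong) (simp add: cocycle_closed F A.l_neg)
    then show "\<exists>g\<in>carrier cocycle_module. g \<oplus>\<^bsub>cocycle_module\<^esub> f = \<zero>\<^bsub>cocycle_module\<^esub>"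
      using bin_cochain_closed[OF cocycle_uminus[OF F(1)]] by blast
  next
    fix f g assume "f \<in> carrier cocycle_module" "g \<in> carrier cocycle_module"
    then obtain F G where F: "cocycle F" "f = bin_cochain F" and G: "cocycle G" "g = bin_cochain G"
      by (metis cocycle_module_elemE)
    show "f \<oplus>\<^bsub>cocycle_module\<^esub> g \<in> carrier cocycle_module"
      unfolding F G bin_cochain_add by (intro bin_cochain_closed cocycle_plus F G)
    show "f \<oplus>\<^bsub>cocycle_module\<^esub> g = g \<oplus>\<^bsub>cocycle_module\<^esub> f"
      unfolding F G bin_cochain_add
      by (rule bin_cochain_cong) (simp add: cocycle_closed F G A.a_comm)
    fix h assume "h \<in> carrier cocycle_module"
    then obtain H where H: "cocycle H" "h = bin_cochain H" by (rule cocycle_module_elemE)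
    show "f \<oplus>\<^bsub>cocycle_module\<^esub> g \<oplus>\<^bsub>cocycle_module\<^esub> h = f \<oplus>\<^bsub>cocycle_module\<^esub> (g \<oplus>\<^bsub>cocycle_module\<^esub> h)"
      unfolding F G H bin_cochain_add
      by (rule bin_cochain_cong) (simp add: cocycle_closed F G H A.a_assoc)
  qed
next
  fix c f assume c: "c \<in> carrier K" and "f \<in> carrier cocycle_module"
  then obtain F where F: "cocycle F" "f = bin_cochain F" by (metis cocycle_module_elemE)
  show "c \<odot>\<^bsub>cocycle_module\<^esub> f \<in> carrier cocycle_module"
    unfolding F bin_cochain_smult by (intro bin_cochain_closed cocycle_scale F c)
  {
    fix d assume d: "d \<in> carrier K"
    show "(c \<oplus>\<^bsub>K\<^esub> d) \<odot>\<^bsub>cocycle_module\<^esub> f = c \<odot>\<^bsub>cocycle_module\<^esub> f \<oplus>\<^bsub>cocycle_module\<^esub> d \<odot>\<^bsub>cocycle_module\<^esub> f"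
      unfolding F bin_cochain_smult bin_cochain_add
      by (rule bin_cochain_cong) (simp add: cocycle_closed F c d M.smult_l_distr)
    show "(c \<otimes>\<^bsub>K\<^esub> d) \<odot>\<^bsub>cocycle_module\<^esub> f = c \<odot>\<^bsub>cocycle_module\<^esub> (d \<odot>\<^bsub>cocycle_module\<^esub> f)"
      unfolding F bin_cochain_smult
      by (rule bin_cochain_cong) (simp add: cocycle_closed F c d M.smult_assoc1)
  next
    fix g assume "g \<in> carrier cocycle_module"
    then obtain G where G: "cocycle G" "g = bin_cochain G" by (rule cocycle_module_elemE)
    show "c \<odot>\<^bsub>cocycle_module\<^esub> (f \<oplus>\<^bsub>cocycle_module\<^esub> g) =
        c \<odot>\<^bsub>cocycle_module\<^esub> f \<oplus>\<^bsub>cocycle_module\<^esub> c \<odot>\<^bsub>cocycle_module\<^esub> g"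
      unfolding F G bin_cochain_smult bin_cochain_add
      by (rule bin_cochain_cong) (simp add: cocycle_closed F G c M.smult_r_distr)
  }
next
  fix f assume "f \<in> carrier cocycle_module"
  then obtain F where F: "cocycle F" "f = bin_cochain F" by (rule cocycle_module_elemE)
  show "\<one>\<^bsub>K\<^esub> \<odot>\<^bsub>cocycle_module\<^esub> f = f"
    unfolding F bin_cochain_smult by (rule bin_cochain_cong) (simp add: cocycle_closed F)
qed

lemma cobd_zero: "x \<in> carrier A \<Longrightarrow> y \<in> carrier A \<Longrightarrow> cobd (\<lambda>x. \<zero>) x y = \<zero>"
  by (simp add: cobd_def a_minus_def)

lemma coboundaries_iff:
  "f \<in> hochschild_coboundaries K A 2 \<longleftrightarrow> (\<exists>g. lin g \<and> f = bin_cochain (cobd g))"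
  unfolding coboundaries_eq by blast

text \<open>\<open>cobd\<close> is linear in its cochain, so sums, negatives and multiples of
  coboundaries come from those of the cochains.\<close>

lemma module_quotient_coboundaries:
  "module_quotient K cocycle_module (hochschild_coboundaries K A 2)"
proof -
  interpret Z: module K cocycle_module by (rule module_cocycle_module)
  note B = coboundaries_iff
  show ?thesis
  proof
    show "hochschild_coboundaries K A 2 \<subseteq> carrier (add_monoid cocycle_module)"
      using B cocycle_cobd bin_cochain_cocycle by auto
    show "\<one>\<^bsub>add_monoid cocycle_module\<^esub> \<in> hochschild_coboundaries K A 2"
    proof -
      have "\<zero>\<^bsub>cocycle_module\<^esub> = bin_cochain (cobd (\<lambda>x. \<zero>))"
        unfolding cocycle_module_simps(2) by (rule bin_cochain_cong) (simp add: cobd_zero)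
      then show ?thesis using B lin_const_zero by (metis monoid.select_convs(2))
    qed
    fix f assume "f \<in> hochschild_coboundaries K A 2"
    then obtain g where g: "lin g" "f = bin_cochain (cobd g)" using B by blast
    have fc: "f \<in> carrier cocycle_module" using g bin_cochain_closed[OF cocycle_cobd] by simp
    have "bin_cochain (cobd (\<lambda>x. \<ominus> g x)) \<oplus>\<^bsub>cocycle_module\<^esub> f = \<zero>\<^bsub>cocycle_module\<^esub>"
      unfolding g cocycle_module_simps(2) bin_cochain_add
      by (rule bin_cochain_cong) (simp add: cobd_uminus g cocycle_closed[OF cocycle_cobd] A.l_neg)
    then have "\<ominus>\<^bsub>cocycle_module\<^esub> f = bin_cochain (cobd (\<lambda>x. \<ominus> g x))"
      using Z.M.minus_equality[OF _ fc bin_cochain_closed[OF cocycle_cobd[OF lin_uminus[OF g(1)]]]]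
      by blast
    then show "inv\<^bsub>add_monoid cocycle_module\<^esub> f \<in> hochschild_coboundaries K A 2"
      unfolding a_inv_def[symmetric] using B lin_uminus g by blast
    {
      fix f' assume "f' \<in> hochschild_coboundaries K A 2"
      then obtain g' where g': "lin g'" "f' = bin_cochain (cobd g')" using B by blast
      have "f \<oplus>\<^bsub>cocycle_module\<^esub> f' = bin_cochain (cobd (\<lambda>x. g x \<oplus> g' x))"
        unfolding g g' bin_cochain_add by (rule bin_cochain_cong) (simp add: cobd_plus g g')
      then show "f \<otimes>\<^bsub>add_monoid cocycle_module\<^esub> f' \<in> hochschild_coboundaries K A 2"
        using B lin_plus g g' by (metis monoid.select_convs(1))
    next
      fix c assume c: "c \<in> carrier K"
      have "c \<odot>\<^bsub>cocycle_module\<^esub> f = bin_cochain (cobd (\<lambda>x. c \<odot> g x))"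
        unfolding g bin_cochain_smult by (rule bin_cochain_cong) (simp add: cobd_scale g c)
      then show "c \<odot>\<^bsub>cocycle_module\<^esub> f \<in> hochschild_coboundaries K A 2"
        using B lin_scale g c by metis
    }
  qed
qed

text \<open>The form in which the dimension is proved: two curried cocycles that span all cocycles
  up to coboundaries and are independent modulo coboundaries.\<close>

theorem HH2_dim_two:
  assumes f0: "cocycle f0" and f1: "cocycle f1"
    and span: "\<And>F. cocycle F \<Longrightarrow> \<exists>a\<in>carrier K. \<exists>b\<in>carrier K. \<exists>g. lin g \<and>
      (\<forall>x\<in>carrier A. \<forall>y\<in>carrier A. F x y = a \<odot> f0 x y \<oplus> b \<odot> f1 x y \<oplus> cobd g x y)"
    and indep: "\<And>a b g. \<lbrakk>a \<in> carrier K; b \<in> carrier K; lin g;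
      \<And>x y. x \<in> carrier A \<Longrightarrow> y \<in> carrier A \<Longrightarrow> a \<odot> f0 x y \<oplus> b \<odot> f1 x y = cobd g x y\<rbrakk>
      \<Longrightarrow> a = \<zero>\<^bsub>K\<^esub> \<and> b = \<zero>\<^bsub>K\<^esub>"
  shows "vectorspace K (HH K A 2) \<and> vectorspace.fin_dim K (HH K A 2) \<and> vectorspace.dim K (HH K A 2) = 2"
proof -
  interpret Q: module_quotient K cocycle_module "hochschild_coboundaries K A 2"
    by (rule module_quotient_coboundaries)
  have HH: "HH K A 2 = quotient_module cocycle_module (hochschild_coboundaries K A 2)"
    by (simp add: HH_def)
  show ?thesis
    unfolding HH
  proof (rule Q.vectorspace_quotient_dim_two)
    show "field K" by (rule K.field_axioms)
    show "bin_cochain f0 \<in> carrier cocycle_module" "bin_cochain f1 \<in> carrier cocycle_module"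
      by (intro bin_cochain_closed f0 f1)+
  next
    fix f assume "f \<in> carrier cocycle_module"
    then obtain F where F: "cocycle F" "f = bin_cochain F" by (rule cocycle_module_elemE)
    obtain a b g where ab: "a \<in> carrier K" "b \<in> carrier K" "lin g"
        "\<And>x y. x \<in> carrier A \<Longrightarrow> y \<in> carrier A \<Longrightarrow> F x y = a \<odot> f0 x y \<oplus> b \<odot> f1 x y \<oplus> cobd g x y"
      using span[OF F(1)] by blast
    have "f = a \<odot>\<^bsub>cocycle_module\<^esub> bin_cochain f0 \<oplus>\<^bsub>cocycle_module\<^esub> b \<odot>\<^bsub>cocycle_module\<^esub> bin_cochain f1
        \<oplus>\<^bsub>cocycle_module\<^esub> bin_cochain (cobd g)"
      unfolding F bin_cochain_smult bin_cochain_add by (rule bin_cochain_cong) (rule ab(4))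
    then show "\<exists>a\<in>carrier K. \<exists>b\<in>carrier K. \<exists>h\<in>hochschild_coboundaries K A 2.
        f = a \<odot>\<^bsub>cocycle_module\<^esub> bin_cochain f0 \<oplus>\<^bsub>cocycle_module\<^esub> b \<odot>\<^bsub>cocycle_module\<^esub> bin_cochain f1
        \<oplus>\<^bsub>cocycle_module\<^esub> h"
      using ab(1-3) unfolding coboundaries_eq by blast
  next
    fix a b assume ab: "a \<in> carrier K" "b \<in> carrier K"
      and "a \<odot>\<^bsub>cocycle_module\<^esub> bin_cochain f0 \<oplus>\<^bsub>cocycle_module\<^esub> b \<odot>\<^bsub>cocycle_module\<^esub> bin_cochain f1
        \<in> hochschild_coboundaries K A 2"
    then have "\<exists>g. lin g \<and> bin_cochain (\<lambda>x y. a \<odot> f0 x y \<oplus> b \<odot> f1 x y) = bin_cochain (cobd g)"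
      by (simp only: bin_cochain_smult bin_cochain_add coboundaries_iff)
    then obtain g where g: "lin g"
        and eq: "bin_cochain (\<lambda>x y. a \<odot> f0 x y \<oplus> b \<odot> f1 x y) = bin_cochain (cobd g)"
      by (elim exE conjE)
    show "a = \<zero>\<^bsub>K\<^esub> \<and> b = \<zero>\<^bsub>K\<^esub>"
    proof (rule indep[OF ab g])
      fix x y assume "x \<in> carrier A" "y \<in> carrier A"
      then show "a \<odot> f0 x y \<oplus> b \<odot> f1 x y = cobd g x y"
        using fun_cong[OF eq, of "[x, y]"] by (simp only: bin_cochain_apply)
    qed
  qed
qed

end

section \<open>Algebras with the normal form basis of \<open>\<Gamma>\<^sup>*(n)\<close>\<close>

text \<open>
  \<open>BP i L\<close> is the path of length \<open>L\<close> consisting of arrows \<open>\<beta>\<^sub>j\<close> that starts at vertex \<open>i + 1\<close>, so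
  that \<open>i + L\<close> can be reduced modulo \<open>n\<close>; \<open>EA\<close> and \<open>EG\<close> are the trivial paths at \<open>n + 1\<close> and \<open>n + 2\<close>.
  The other constructors list the arrows \<open>\<alpha>\<^sub>1, \<alpha>\<^sub>2, \<gamma>\<^sub>1, \<gamma>\<^sub>2\<close> of the path.
\<close>

datatype bas = BP nat nat | EA | EG | A1 | A2 | G1 | G2 | A2G1 | G2A1

definition bas_set :: "nat \<Rightarrow> bas set" where
  "bas_set n = case_prod BP ` ({..<n} \<times> {..2 * n}) \<union> {EA, EG, A1, A2, G1, G2, A2G1, G2A1}"

definition idem_set :: "nat \<Rightarrow> bas set" where
  "idem_set n = (\<lambda>i. BP i 0) ` {..<n} \<union> {EA, EG}"

text \<open>Each relation kills a path or equates two paths, so a product of normal forms is zero,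
  written \<open>None\<close>, or again a normal form. The test \<open>i < n\<close> confines
  successful products of beta-paths to genuine basis elements.\<close>

primrec bas_mult :: "nat \<Rightarrow> bas \<Rightarrow> bas \<Rightarrow> bas option" where
  "bas_mult n (BP i L) t = (case t of
        BP j M \<Rightarrow> if i < n \<and> j = (i + L) mod n \<and> L + M \<le> 2 * n then Some (BP i (L + M)) else None
      | A1 \<Rightarrow> if i = 0 \<and> L = 0 then Some A1 else None
      | G1 \<Rightarrow> if i = 0 \<and> L = 0 then Some G1 else None
      | _ \<Rightarrow> None)"
| "bas_mult n EA t = (case t of
        EA \<Rightarrow> Some EA | A2 \<Rightarrow> Some A2 | A2G1 \<Rightarrow> Some A2G1
      | _ \<Rightarrow> None)"
| "bas_mult n EG t = (case t of
        EG \<Rightarrow> Some EG | G2 \<Rightarrow> Some G2 | G2A1 \<Rightarrow> Some G2A1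
      | _ \<Rightarrow> None)"
| "bas_mult n A1 t = (case t of
        EA \<Rightarrow> Some A1 | A2 \<Rightarrow> Some (BP 0 (2 * n))
      | _ \<Rightarrow> None)"
| "bas_mult n A2 t = (case t of
        BP j M \<Rightarrow> if j = 0 \<and> M = 0 then Some A2 else None | G1 \<Rightarrow> Some A2G1
      | _ \<Rightarrow> None)"
| "bas_mult n G1 t = (case t of
        EG \<Rightarrow> Some G1 | G2 \<Rightarrow> Some (BP 0 (2 * n))
      | _ \<Rightarrow> None)"
| "bas_mult n G2 t = (case t of
        BP j M \<Rightarrow> if j = 0 \<and> M = 0 then Some G2 else None | A1 \<Rightarrow> Some G2A1
      | _ \<Rightarrow> None)"
| "bas_mult n A2G1 t = (case t of
        EG \<Rightarrow> Some A2G1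
      | _ \<Rightarrow> None)"
| "bas_mult n G2A1 t = (case t of
        EA \<Rightarrow> Some G2A1
      | _ \<Rightarrow> None)"

lemma finite_bas_set [simp]: "finite (bas_set n)"
  by (simp add: bas_set_def)

lemma bas_set_simps [simp]:
  "BP i L \<in> bas_set n \<longleftrightarrow> i < n \<and> L \<le> 2 * n"
  "EA \<in> bas_set n" "EG \<in> bas_set n" "A1 \<in> bas_set n" "A2 \<in> bas_set n" "G1 \<in> bas_set n"
  "G2 \<in> bas_set n" "A2G1 \<in> bas_set n" "G2A1 \<in> bas_set n"
  by (auto simp: bas_set_def)

lemma finite_idem_set [simp]: "finite (idem_set n)"
  by (simp add: idem_set_def)

lemma idem_set_simps [simp]:
  "BP i L \<in> idem_set n \<longleftrightarrow> i < n \<and> L = 0"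
  "EA \<in> idem_set n" "EG \<in> idem_set n" "A1 \<notin> idem_set n" "A2 \<notin> idem_set n" "G1 \<notin> idem_set n"
  "G2 \<notin> idem_set n" "A2G1 \<notin> idem_set n" "G2A1 \<notin> idem_set n"
  by (auto simp: idem_set_def)

lemma idem_bas: "v \<in> idem_set n \<Longrightarrow> v \<in> bas_set n"
  by (auto simp: idem_set_def)

text \<open>A vertex is encoded by its trivial path, so that source and target can themselves be
  multiplied with normal forms.\<close>

definition src :: "bas \<Rightarrow> bas" where
  "src s = (case s of BP i L \<Rightarrow> BP i 0 | EA \<Rightarrow> EA | A2 \<Rightarrow> EA | A2G1 \<Rightarrow> EA | EG \<Rightarrow> EG | G2 \<Rightarrow> EG
     | G2A1 \<Rightarrow> EG | _ \<Rightarrow> BP 0 0)"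

definition tgt :: "nat \<Rightarrow> bas \<Rightarrow> bas" where
  "tgt n s = (case s of BP i L \<Rightarrow> BP ((i + L) mod n) 0 | EA \<Rightarrow> EA | A1 \<Rightarrow> EA | G2A1 \<Rightarrow> EA | EG \<Rightarrow> EG
     | G1 \<Rightarrow> EG | A2G1 \<Rightarrow> EG | _ \<Rightarrow> BP 0 0)"

text \<open>As \<open>b\<close> vanishes off \<open>bas_set n\<close>, the multiplication rule needs no side conditions.\<close>

locale gamma_star_basis = k_algebra K A
  for K :: "('k, 'b) ring_scheme" and A :: "('k, 'a, 'm) module_scheme" (structure) +
  fixes n :: nat and b :: "bas \<Rightarrow> 'a" and co :: "bas \<Rightarrow> 'a \<Rightarrow> 'k"
  assumes n_pos: "n \<ge> 1"
    and b_closed [simp]: "b s \<in> carrier A"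
    and b_outside: "s \<notin> bas_set n \<Longrightarrow> b s = \<zero>"
    and b_mult: "b s \<otimes> b t = (case bas_mult n s t of None \<Rightarrow> \<zero> | Some r \<Rightarrow> b r)"
    and one_expand: "\<one> = (\<Oplus>v\<in>idem_set n. b v)"
    and co_closed [simp]: "x \<in> carrier A \<Longrightarrow> co s x \<in> carrier K"
    and co_add [simp]: "\<lbrakk>x \<in> carrier A; y \<in> carrier A\<rbrakk> \<Longrightarrow> co s (x \<oplus> y) = co s x \<oplus>\<^bsub>K\<^esub> co s y"
    and co_smult [simp]: "\<lbrakk>c \<in> carrier K; x \<in> carrier A\<rbrakk> \<Longrightarrow> co s (c \<odot> x) = c \<otimes>\<^bsub>K\<^esub> co s x"
    and co_b: "co s (b t) = (if s = t \<and> t \<in> bas_set n then \<one>\<^bsub>K\<^esub> else \<zero>\<^bsub>K\<^esub>)"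
    and expand: "x \<in> carrier A \<Longrightarrow> x = (\<Oplus>s\<in>bas_set n. co s x \<odot> b s)"
begin

section \<open>Coefficients, and linear maps given on the basis\<close>

lemma co_zero [simp]: "co s \<zero> = \<zero>\<^bsub>K\<^esub>"
  using co_smult[of "\<zero>\<^bsub>K\<^esub>" \<zero> s] by simp

lemma co_minus [simp]: "x \<in> carrier A \<Longrightarrow> co s (\<ominus> x) = \<ominus>\<^bsub>K\<^esub> co s x"
  using K.minus_equality[of "co s (\<ominus> x)" "co s x"] co_add[of "\<ominus> x" x s]
  by (simp add: A.l_neg del: co_add)

lemma co_finsum:
  assumes "finite S" "f \<in> S \<rightarrow> carrier A"
  shows "co r (\<Oplus>s\<in>S. f s) = (\<Oplus>\<^bsub>K\<^esub>s\<in>S. co r (f s))"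
  using assms by (induction S rule: finite_induct) (simp_all add: A.finsum_insert K.finsum_insert Pi_def)

lemma eqI:
  assumes "x \<in> carrier A" "y \<in> carrier A" "\<And>s. s \<in> bas_set n \<Longrightarrow> co s x = co s y"
  shows "x = y"
proof -
  have "(\<Oplus>s\<in>bas_set n. co s x \<odot> b s) = (\<Oplus>s\<in>bas_set n. co s y \<odot> b s)"
    by (rule A.finsum_cong') (use assms in \<open>auto simp: Pi_def\<close>)
  then show ?thesis using expand assms by metis
qed

lemma lin_finsum:
  assumes g: "lin g" and "finite S" "f \<in> S \<rightarrow> carrier A"
  shows "g (\<Oplus>s\<in>S. f s) = (\<Oplus>s\<in>S. g (f s))"
  using assms(2,3)
  by (induction S rule: finite_induct)
    (simp_all add: A.finsum_insert Pi_def lin_zero[OF g] lin_add[OF g] lin_closed[OF g])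

lemma lin_eqI:
  assumes g: "lin g" and h: "lin h" and eq: "\<And>s. s \<in> bas_set n \<Longrightarrow> g (b s) = h (b s)"
    and x: "x \<in> carrier A"
  shows "g x = h x"
proof -
  have *: "k x = (\<Oplus>s\<in>bas_set n. co s x \<odot> k (b s))" if k: "lin k" for k
  proof -
    have "k x = k (\<Oplus>s\<in>bas_set n. co s x \<odot> b s)" using expand[OF x] by simp
    also have "\<dots> = (\<Oplus>s\<in>bas_set n. k (co s x \<odot> b s))" using x by (intro lin_finsum k) auto
    also have "\<dots> = (\<Oplus>s\<in>bas_set n. co s x \<odot> k (b s))"
      by (rule A.finsum_cong') (use x in \<open>auto simp: lin_smult[OF k] lin_closed[OF k]\<close>)
    finally show ?thesis .
  qed
  have "(\<Oplus>s\<in>bas_set n. co s x \<odot> g (b s)) = (\<Oplus>s\<in>bas_set n. co s x \<odot> h (b s))"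
    by (rule A.finsum_cong') (use x eq in \<open>auto simp: lin_closed[OF h]\<close>)
  then show ?thesis using *[OF g] *[OF h] by simp
qed

text \<open>Only one coefficient of each map is compared, possibly at different basis elements. This
  is what is needed when multiplication by a basis element shifts coefficients.\<close>

lemma co_lin_eqI:
  assumes g: "lin g" and h: "lin h" and eq: "\<And>t. t \<in> bas_set n \<Longrightarrow> co r (g (b t)) = co s (h (b t))"
    and x: "x \<in> carrier A"
  shows "co r (g x) = co s (h x)"
proof -
  have *: "co r (k x) = (\<Oplus>\<^bsub>K\<^esub>t\<in>bas_set n. co t x \<otimes>\<^bsub>K\<^esub> co r (k (b t)))" if k: "lin k" for k r
  proof -
    have "co r (k x) = co r (k (\<Oplus>t\<in>bas_set n. co t x \<odot> b t))" using expand[OF x] by simp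
    also have "\<dots> = co r (\<Oplus>t\<in>bas_set n. k (co t x \<odot> b t))" using x by (subst lin_finsum[OF k]) auto
    also have "\<dots> = (\<Oplus>\<^bsub>K\<^esub>t\<in>bas_set n. co r (k (co t x \<odot> b t)))"
      by (rule co_finsum) (use x in \<open>auto simp: lin_closed[OF k]\<close>)
    also have "\<dots> = (\<Oplus>\<^bsub>K\<^esub>t\<in>bas_set n. co t x \<otimes>\<^bsub>K\<^esub> co r (k (b t)))"
      by (rule K.finsum_cong') (use x in \<open>auto simp: lin_smult[OF k] lin_closed[OF k]\<close>)
    finally show ?thesis .
  qed
  have "(\<Oplus>\<^bsub>K\<^esub>t\<in>bas_set n. co t x \<otimes>\<^bsub>K\<^esub> co r (g (b t))) = (\<Oplus>\<^bsub>K\<^esub>t\<in>bas_set n. co t x \<otimes>\<^bsub>K\<^esub> co s (h (b t)))"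
    by (rule K.finsum_cong') (use x eq in \<open>auto simp: lin_closed[OF h]\<close>)
  then show ?thesis using *[OF g] *[OF h] by simp
qed

definition lin_ext :: "(bas \<Rightarrow> 'a) \<Rightarrow> 'a \<Rightarrow> 'a" where
  "lin_ext g x = (\<Oplus>s\<in>bas_set n. co s x \<odot> g s)"

lemma lin_lin_ext:
  assumes g [simp]: "\<And>s. g s \<in> carrier A"
  shows "lin (lin_ext g)"
proof (rule linI)
  fix x y assume [simp]: "x \<in> carrier A" "y \<in> carrier A"
  show "lin_ext g x \<in> carrier A" by (simp add: lin_ext_def)
  show "lin_ext g (x \<oplus> y) = lin_ext g x \<oplus> lin_ext g y"
    by (simp add: lin_ext_def M.smult_l_distr A.finsum_addf)
next
  fix c x assume [simp]: "c \<in> carrier K" "x \<in> carrier A"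
  show "lin_ext g (c \<odot> x) = c \<odot> lin_ext g x"
    using lin_finsum[OF lin_scale[OF lin_id, of c], of "bas_set n" "\<lambda>s. co s x \<odot> g s"]
    by (simp add: lin_ext_def M.smult_assoc1 Pi_def)
qed

lemma lin_ext_b:
  assumes g [simp]: "\<And>s. g s \<in> carrier A"
  shows "lin_ext g (b t) = (if t \<in> bas_set n then g t else \<zero>)"
proof -
  have "lin_ext g (b t) = (\<Oplus>s\<in>bas_set n. if t = s then g s else \<zero>)" if "t \<in> bas_set n"
    unfolding lin_ext_def by (rule A.finsum_cong') (use that in \<open>auto simp: co_b\<close>)
  then show ?thesis
    using A.finsum_singleton[of t "bas_set n" g] b_outside[of t] lin_zero[OF lin_lin_ext[of g]] by auto
qed

definition bilin_ext :: "(bas \<Rightarrow> bas \<Rightarrow> 'a) \<Rightarrow> 'a \<Rightarrow> 'a \<Rightarrow> 'a" where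
  "bilin_ext F x y = lin_ext (\<lambda>s. lin_ext (F s) y) x"

lemma bilin_bilin_ext:
  assumes F [simp]: "\<And>s t. F s t \<in> carrier A"
  shows "bilin (bilin_ext F)"
  unfolding bilin_def
proof (intro conjI ballI)
  note [simp] = lin_closed[OF lin_lin_ext]
  fix x assume x [simp]: "x \<in> carrier A"
  show "lin (\<lambda>y. bilin_ext F y x)" unfolding bilin_ext_def by (rule lin_lin_ext) simp
  show "lin (bilin_ext F x)"
  proof (rule linI)
    fix y z assume [simp]: "y \<in> carrier A" "z \<in> carrier A"
    show "bilin_ext F x y \<in> carrier A" by (simp add: bilin_ext_def)
    show "bilin_ext F x (y \<oplus> z) = bilin_ext F x y \<oplus> bilin_ext F x z"
      by (simp add: bilin_ext_def lin_add[OF lin_lin_ext] lin_ext_def[of "\<lambda>s. _ s \<oplus> _ s"]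
          M.smult_r_distr A.finsum_addf) (simp add: lin_ext_def)
  next
    fix c y assume [simp]: "c \<in> carrier K" "y \<in> carrier A"
    have "(\<Oplus>s\<in>bas_set n. co s x \<odot> (c \<odot> lin_ext (F s) y)) = (\<Oplus>s\<in>bas_set n. c \<odot> (co s x \<odot> lin_ext (F s) y))"
      by (rule A.finsum_cong') (auto simp: M.smult_assoc1[symmetric] K.m_comm)
    then show "bilin_ext F x (c \<odot> y) = c \<odot> bilin_ext F x y"
      using lin_finsum[OF lin_scale[OF lin_id, of c], of "bas_set n" "\<lambda>s. co s x \<odot> lin_ext (F s) y"]
      by (simp add: bilin_ext_def lin_smult[OF lin_lin_ext] lin_ext_def[of "\<lambda>s. _ \<odot> _ s"] Pi_def)
        (simp add: lin_ext_def)
  qed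
qed

lemma bilin_ext_b:
  assumes F [simp]: "\<And>s t. F s t \<in> carrier A"
  shows "bilin_ext F (b s) (b t) = (if s \<in> bas_set n \<and> t \<in> bas_set n then F s t else \<zero>)"
  by (simp add: bilin_ext_def lin_ext_b lin_closed[OF lin_lin_ext])

text \<open>Both sides of the cocycle identity are linear in each argument, so the arguments are
  replaced by basis elements one after the other.\<close>

lemma cocycleI_basis:
  assumes F: "bilin F"
    and eq: "\<And>s t u. \<lbrakk>s \<in> bas_set n; t \<in> bas_set n; u \<in> bas_set n\<rbrakk> \<Longrightarrow>
      b s \<otimes> F (b t) (b u) \<oplus> F (b s) (b t \<otimes> b u) = F (b s \<otimes> b t) (b u) \<oplus> F (b s) (b t) \<otimes> b u"
  shows "cocycle F"
proof -
  note cl = bilin_closed[OF F]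
  note lF = bilinD[OF F]
  have L1: "lin (\<lambda>x. x \<otimes> F y z \<oplus> F x (y \<otimes> z))" "lin (\<lambda>x. F (x \<otimes> y) z \<oplus> F x y \<otimes> z)"
    and L2: "lin (\<lambda>x. y \<otimes> F x z \<oplus> F y (x \<otimes> z))" "lin (\<lambda>x. F (y \<otimes> x) z \<oplus> F y x \<otimes> z)"
    and L3: "lin (\<lambda>x. y \<otimes> F z x \<oplus> F y (z \<otimes> x))" "lin (\<lambda>x. F (y \<otimes> z) x \<oplus> F y z \<otimes> x)"
    if "y \<in> carrier A" "z \<in> carrier A" for y z
    using that cl[of y z] lF(1)[of y] lF(1)[of z] lF(2)[of z] lF(1)[of "y \<otimes> z"] lF(2)[of "y \<otimes> z"]
      lF(2)[of y] lin_comp[of "\<lambda>x. F x z" "\<lambda>x. x \<otimes> y"] lin_comp[of "F y" "\<lambda>x. x \<otimes> z"]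
      lin_comp[of "\<lambda>x. F x z" "\<lambda>x. y \<otimes> x"] lin_comp[of "F y" "\<lambda>x. z \<otimes> x"]
      lin_mult_left[OF lin_id] lin_mult_right[OF lin_id]
    by (simp_all add: lin_plus lin_mult_left lin_mult_right)
  have 1: "x \<otimes> F y z \<oplus> F x (y \<otimes> z) = F (x \<otimes> y) z \<oplus> F x y \<otimes> z"
    if xyz: "x \<in> carrier A" "y \<in> carrier A" "z \<in> carrier A" for x y z
  proof (rule lin_eqI[of "\<lambda>x. x \<otimes> F y z \<oplus> F x (y \<otimes> z)", OF L1[OF xyz(2,3)] _ xyz(1)])
    fix s assume s: "s \<in> bas_set n"
    show "b s \<otimes> F y z \<oplus> F (b s) (y \<otimes> z) = F (b s \<otimes> y) z \<oplus> F (b s) y \<otimes> z"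
    proof (rule lin_eqI[of "\<lambda>y. b s \<otimes> F y z \<oplus> F (b s) (y \<otimes> z)", OF L2[OF b_closed xyz(3)] _ xyz(2)])
      fix t assume t: "t \<in> bas_set n"
      show "b s \<otimes> F (b t) z \<oplus> F (b s) (b t \<otimes> z) = F (b s \<otimes> b t) z \<oplus> F (b s) (b t) \<otimes> z"
      proof (rule lin_eqI[of "\<lambda>z. b s \<otimes> F (b t) z \<oplus> F (b s) (b t \<otimes> z)", OF L3[OF b_closed b_closed] _ xyz(3)])
      qed (rule eq[OF s t])
    qed
  qed
  then show ?thesis using F by (simp add: cocycle_def)
qed

end

section \<open>Two cocycles\<close>

text \<open>
  The terms linear in \<open>t\<close> of the multiplication table after deforming the relations to
  \<open>\<alpha>\<^sub>1\<alpha>\<^sub>2 = \<gamma>\<^sub>1\<gamma>\<^sub>2 = c\<^sup>2 + t\<close> (if \<open>q\<close>) or to \<open>c\<^sup>2 + tc\<close> (otherwise), where \<open>c = \<beta>\<^sub>1\<dots>\<beta>\<^sub>n\<close>: a path of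
  \<open>\<beta>\<close>'s of length above \<open>2n\<close> then equals \<open>- t\<close> times the path shortened by \<open>2n\<close> or \<open>n\<close>.
  \<open>Some (neg, r)\<close> stands for \<open>- r\<close> or \<open>r\<close>.
\<close>

primrec def_table :: "nat \<Rightarrow> bool \<Rightarrow> bas \<Rightarrow> bas \<Rightarrow> (bool \<times> bas) option" where
  "def_table n q (BP i L) t = (case t of
        BP j M \<Rightarrow>
          if j = (i + L) mod n \<and> 2 * n < L + M \<and> L + M \<le> 2 * n + (if q then 2 * n else n)
          then Some (True, BP i (L + M - (if q then 2 * n else n))) else None
      | _ \<Rightarrow> None)"
| "def_table n q EA t = None"
| "def_table n q EG t = None"
| "def_table n q A1 t = (case t of
        A2 \<Rightarrow> Some (False, BP 0 (if q then 0 else n))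
      | A2G1 \<Rightarrow> if q then Some (False, G1) else None
      | _ \<Rightarrow> None)"
| "def_table n q A2 t = (case t of
        A1 \<Rightarrow> if q then Some (False, EA) else None
      | _ \<Rightarrow> None)"
| "def_table n q G1 t = (case t of
        G2 \<Rightarrow> Some (False, BP 0 (if q then 0 else n))
      | G2A1 \<Rightarrow> if q then Some (False, A1) else None
      | _ \<Rightarrow> None)"
| "def_table n q G2 t = (case t of
        G1 \<Rightarrow> if q then Some (False, EG) else None
      | _ \<Rightarrow> None)"
| "def_table n q A2G1 t = (case t of
        G2 \<Rightarrow> if q then Some (False, A2) else None
      | _ \<Rightarrow> None)"
| "def_table n q G2A1 t = (case t of
        A2 \<Rightarrow> if q then Some (False, G2) else None
      | _ \<Rightarrow> None)"

context gamma_star_basis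
begin

definition def_val :: "bool \<Rightarrow> bas \<Rightarrow> bas \<Rightarrow> 'a" where
  "def_val q s t = (case def_table n q s t of None \<Rightarrow> \<zero> | Some (neg, r) \<Rightarrow> if neg then \<ominus> b r else b r)"

lemma def_val_closed: "def_val q s t \<in> carrier A"
  by (auto simp: def_val_def split: option.split)

definition defc :: "bool \<Rightarrow> 'a \<Rightarrow> 'a \<Rightarrow> 'a" where
  "defc q = bilin_ext (def_val q)"

lemma defc_b: "defc q (b s) (b t) = (if s \<in> bas_set n \<and> t \<in> bas_set n then def_val q s t else \<zero>)"
  unfolding defc_def by (rule bilin_ext_b[OF def_val_closed])

lemma bilin_defc: "bilin (defc q)"
  unfolding defc_def by (rule bilin_bilin_ext[OF def_val_closed])

lemma defc_zero: "defc q \<zero> (b v) = \<zero>" "defc q (b v) \<zero> = \<zero>"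
  by (simp_all add: bilin_zero[OF bilin_defc])

text \<open>Total length above 2n needs no separate treatment: both sides are then zero, as
  \<open>b\<close> vanishes off the basis.\<close>

lemma BP_mult:
  assumes "i < n"
  shows "b (BP i L) \<otimes> b (BP ((i + L) mod n) M) = b (BP i (L + M))"
  using assms by (simp add: b_mult b_outside)

lemma BP_mult_zero: "j \<noteq> (i + L) mod n \<Longrightarrow> b (BP i L) \<otimes> b (BP j M) = \<zero>"
  by (simp add: b_mult)

text \<open>In the deformation by tc the table also asks that L + M be at most 3n, since longer
  paths are of order t^2. Here that bound is absorbed by \<open>b\<close>, which is zero at lengths
  above 2n.\<close>

lemma defc_BP:
  assumes "i < n"
  shows "defc q (b (BP i L)) (b (BP ((i + L) mod n) M)) =
    (if L \<le> 2 * n \<and> M \<le> 2 * n \<and> 2 * n < L + M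
     then \<ominus> b (BP i (L + M - (if q then 2 * n else n))) else \<zero>)"
  using assms by (simp add: defc_b def_val_def b_outside)

lemma defc_BP_zero: "j \<noteq> (i + L) mod n \<Longrightarrow> defc q (b (BP i L)) (b (BP j M)) = \<zero>"
  by (simp add: defc_b def_val_def)

text \<open>For composable paths each of the four terms is zero or the same element, minus the whole
  path shortened by d. On the left exactly one of the cases M + N > 2n and M + N \<le> 2n occurs, on
  the right exactly one of L + M \<le> 2n and L + M > 2n; so the element appears once on each side
  precisely when L + M + N > 2n.\<close>

lemma cocycle_defc_BP:
  assumes ijk: "i < n" "j < n" "k < n" and LMN: "L \<le> 2 * n" "M \<le> 2 * n" "N \<le> 2 * n"
  shows "b (BP i L) \<otimes> defc q (b (BP j M)) (b (BP k N)) \<oplus> defc q (b (BP i L)) (b (BP j M) \<otimes> b (BP k N)) =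
      defc q (b (BP i L) \<otimes> b (BP j M)) (b (BP k N)) \<oplus> defc q (b (BP i L)) (b (BP j M)) \<otimes> b (BP k N)"
proof (cases "j = (i + L) mod n")
  case j: True
  show ?thesis
  proof (cases "k = (j + M) mod n")
    case k: True
    define d where "d = (if q then 2 * n else n)"
    have k': "k = (i + (L + M)) mod n" unfolding k j by (simp add: mod_simps add.assoc)
    have d: "d \<le> 2 * n" "0 < d" using n_pos by (auto simp: d_def)
    have 1: "b (BP i L) \<otimes> defc q (b (BP j M)) (b (BP k N)) =
        (if 2 * n < M + N then \<ominus> b (BP i (L + M + N - d)) else \<zero>)"
      using d LMN unfolding k defc_BP[OF ijk(2)] d_def[symmetric]
      by (simp add: A.r_minus j BP_mult ijk add.assoc)
    have 2: "defc q (b (BP i L)) (b (BP j M) \<otimes> b (BP k N)) =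
        (if M + N \<le> 2 * n \<and> 2 * n < L + M + N then \<ominus> b (BP i (L + M + N - d)) else \<zero>)"
      using LMN unfolding k BP_mult[OF ijk(2)] unfolding j defc_BP[OF ijk(1)] d_def[symmetric]
      by (simp add: add.assoc)
    have 3: "defc q (b (BP i L) \<otimes> b (BP j M)) (b (BP k N)) =
        (if L + M \<le> 2 * n \<and> 2 * n < L + M + N then \<ominus> b (BP i (L + M + N - d)) else \<zero>)"
      using LMN unfolding k' j BP_mult[OF ijk(1)] defc_BP[OF ijk(1)] d_def[symmetric] by simp
    \<comment> \<open>d is n or 2n, so shortening by d does not move the end vertex.\<close>
    have e: "(i + (L + M)) mod n = (i + (L + M - d)) mod n" if "2 * n < L + M"
    proof -
      have "i + (L + M) = i + (L + M - d) + d" using that d by simp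
      moreover have "(i + (L + M - d) + d) mod n = (i + (L + M - d)) mod n" by (simp add: d_def)
      ultimately show ?thesis by metis
    qed
    have 4: "defc q (b (BP i L)) (b (BP j M)) \<otimes> b (BP k N) =
        (if 2 * n < L + M then \<ominus> b (BP i (L + M + N - d)) else \<zero>)"
    proof (cases "2 * n < L + M")
      case True
      then have "b (BP i (L + M - d)) \<otimes> b (BP ((i + (L + M)) mod n) N) = b (BP i (L + M + N - d))"
        using d unfolding e[OF True] BP_mult[OF ijk(1)] by simp
      then show ?thesis
        using True LMN unfolding k' j defc_BP[OF ijk(1)] d_def[symmetric] by (simp add: A.l_minus)
    next
      case False
      then show ?thesis unfolding k' j defc_BP[OF ijk(1)] by simp
    qed
    show ?thesis unfolding 1 2 3 4 by auto
  next
    case k: False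
    then have "k \<noteq> (i + (L + M)) mod n" using j by (simp add: mod_simps add.assoc)
    moreover have "(i + (L + M - (if q then 2 * n else n))) mod n = (i + (L + M)) mod n" if "2 * n < L + M"
    proof -
      have "i + (L + M) = i + (L + M - (if q then 2 * n else n)) + (if q then 2 * n else n)" using that by simp
      moreover have "(x + (if q then 2 * n else n)) mod n = x mod n" for x by simp
      ultimately show ?thesis by metis
    qed
    ultimately show ?thesis
      using k unfolding j
      by (simp add: BP_mult BP_mult_zero defc_BP defc_BP_zero defc_zero ijk A.l_minus)
  qed
next
  case j: False
  have "b (BP i L) \<otimes> defc q (b (BP j M)) (b (BP k N)) = \<zero>"
    using j BP_mult_zero[OF j] ijk by (cases "k = (j + M) mod n") (simp_all add: defc_BP defc_BP_zero A.r_minus)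
  moreover have "defc q (b (BP i L)) (b (BP j M) \<otimes> b (BP k N)) = \<zero>"
    using j ijk by (cases "k = (j + M) mod n") (simp_all add: BP_mult BP_mult_zero defc_BP_zero defc_zero)
  ultimately show ?thesis using j by (simp add: BP_mult_zero defc_BP_zero defc_zero)
qed

text \<open>Beyond triples of beta-paths the identity is checked on the table. Cancellation occurs
  at overlaps such as (alpha_1, alpha_2, p) with p a nontrivial beta-path: the negative value at
  (c^2, p) is offset by the value at (alpha_1, alpha_2) multiplied by p.\<close>

lemma cocycle_defc: "cocycle (defc q)"
proof (rule cocycleI_basis[OF bilin_defc])
  fix s t u assume st: "s \<in> bas_set n" "t \<in> bas_set n" "u \<in> bas_set n"
  have n: "0 < n" "\<not> n = 0" using n_pos by auto
  note S = b_mult defc_b def_val_def defc_zero A.r_minus A.l_minus n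
  show "b s \<otimes> defc q (b t) (b u) \<oplus> defc q (b s) (b t \<otimes> b u) =
      defc q (b s \<otimes> b t) (b u) \<oplus> defc q (b s) (b t) \<otimes> b u"
  proof (cases s)
    case EA
    show ?thesis unfolding EA by (cases t; cases u) (simp_all add: S)
  next
    case EG
    show ?thesis unfolding EG by (cases t; cases u) (simp_all add: S)
  next
    case A1
    show ?thesis unfolding A1 using st(2,3) by (cases t; cases u) (simp_all add: S A.l_neg)
  next
    case A2
    show ?thesis unfolding A2 using st(2,3) by (cases t; cases u) (simp_all add: S)
  next
    case G1
    show ?thesis unfolding G1 using st(2,3) by (cases t; cases u) (simp_all add: S A.l_neg)
  next
    case G2
    show ?thesis unfolding G2 using st(2,3) by (cases t; cases u) (simp_all add: S)
  next
    case A2G1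
    show ?thesis unfolding A2G1 using st(2,3) by (cases t; cases u) (simp_all add: S)
  next
    case G2A1
    show ?thesis unfolding G2A1 using st(2,3) by (cases t; cases u) (simp_all add: S)
  next
    case (BP i L)
    show ?thesis
    proof (cases "\<exists>j M k N. t = BP j M \<and> u = BP k N")
      case True
      then show ?thesis using st BP cocycle_defc_BP by auto
    next
      case False
      then show ?thesis unfolding BP using st BP
        by (cases t; cases u) (simp_all add: S A.r_neg add.commute[of n L])
    qed
  qed
qed

end

section \<open>Coefficients of products, and independence of the two cocycles\<close>

lemma ball_bas_set:
  "(\<forall>t\<in>bas_set n. P t) \<longleftrightarrow> (\<forall>i<n. \<forall>L\<le>2 * n. P (BP i L)) \<and> P EA \<and> P EG \<and> P A1 \<and> P A2 \<and>
    P G1 \<and> P G2 \<and> P A2G1 \<and> P G2A1"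
  by (auto simp: bas_set_def)

context gamma_star_basis
begin

text \<open>This and the next three lemmas reduce the coefficient of a product with a basis element
  to a check on the multiplication table.\<close>

lemma co_left:
  assumes "\<forall>t\<in>bas_set n. co r (b s \<otimes> b t) = co r' (b t)" "x \<in> carrier A"
  shows "co r (b s \<otimes> x) = co r' x"
  using co_lin_eqI[OF lin_mult_left[OF lin_id b_closed] lin_id] assms by blast

lemma co_left_zero:
  assumes "\<forall>t\<in>bas_set n. co r (b s \<otimes> b t) = \<zero>\<^bsub>K\<^esub>" "x \<in> carrier A"
  shows "co r (b s \<otimes> x) = \<zero>\<^bsub>K\<^esub>"
  using co_lin_eqI[OF lin_mult_left[OF lin_id b_closed] lin_const_zero, of r s r] assms by simp

lemma co_right:
  assumes "\<forall>t\<in>bas_set n. co r (b t \<otimes> b s) = co r' (b t)" "x \<in> carrier A"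
  shows "co r (x \<otimes> b s) = co r' x"
  using co_lin_eqI[OF lin_mult_right[OF lin_id b_closed] lin_id] assms by blast

lemma co_right_zero:
  assumes "\<forall>t\<in>bas_set n. co r (b t \<otimes> b s) = \<zero>\<^bsub>K\<^esub>" "x \<in> carrier A"
  shows "co r (x \<otimes> b s) = \<zero>\<^bsub>K\<^esub>"
  using co_lin_eqI[OF lin_mult_right[OF lin_id b_closed] lin_const_zero, of r s r] assms by simp

text \<open>\<open>p\<close> is read off at (alpha_2, alpha_1), where no coboundary reaches e_(n+1).
  \<open>q\<close> is read off as the coefficient of c at (alpha_1, alpha_2), after the values at
  (c, alpha_1) and (c, c) have restricted \<open>g\<close>.\<close>

lemma defc_independent:
  assumes p: "p \<in> carrier K" and q: "q \<in> carrier K" and g: "lin g"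
    and eq: "\<And>x y. x \<in> carrier A \<Longrightarrow> y \<in> carrier A \<Longrightarrow>
      p \<odot> defc True x y \<oplus> q \<odot> defc False x y = cobd g x y"
  shows "p = \<zero>\<^bsub>K\<^esub> \<and> q = \<zero>\<^bsub>K\<^esub>"
proof -
  note [simp] = p q lin_closed[OF g] lin_zero[OF g]
  have n: "0 < n" using n_pos by simp
  have val: "p \<odot> defc True (b s) (b t) \<oplus> q \<odot> defc False (b s) (b t) =
      b s \<otimes> g (b t) \<ominus> g (b s \<otimes> b t) \<oplus> g (b s) \<otimes> b t" for s t
    using eq[of "b s" "b t"] by (simp add: cobd_def)
  \<comment> \<open>Products alpha_2 x and x alpha_1 have no component at e_(n+1), and alpha_2
    alpha_1 = 0, whereas \<open>defc True\<close> takes the value e_(n+1) at this pair.\<close>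
  have "co EA (p \<odot> b EA) = \<zero>\<^bsub>K\<^esub>"
  proof -
    have l: "co EA (b A2 \<otimes> g (b A1)) = \<zero>\<^bsub>K\<^esub>"
      by (rule co_left_zero) (simp_all add: ball_bas_set b_mult co_b)
    have r: "co EA (g (b A2) \<otimes> b A1) = \<zero>\<^bsub>K\<^esub>"
      by (rule co_right_zero) (simp_all add: ball_bas_set b_mult co_b)
    show ?thesis
      using arg_cong[OF val[of A2 A1], of "co EA"] l r by (simp add: defc_b def_val_def a_minus_def b_mult)
  qed
  then have p0: "p = \<zero>\<^bsub>K\<^esub>" by (simp add: co_b)
  let ?c = "b (BP 0 n)"
  \<comment> \<open>Both cocycles vanish at (c, alpha_1) and c alpha_1 = 0, so c g(alpha_1) + g(c)
    alpha_1 = 0; the coefficient of alpha_1 sees only the e_1-term of g(c).\<close>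
  have gc: "co (BP 0 0) (g ?c) = \<zero>\<^bsub>K\<^esub>"
  proof -
    have l: "co A1 (?c \<otimes> g (b A1)) = \<zero>\<^bsub>K\<^esub>"
      by (rule co_left_zero) (simp_all add: ball_bas_set b_mult co_b n)
    have r: "co A1 (g ?c \<otimes> b A1) = co (BP 0 0) (g ?c)"
      by (rule co_right) (simp_all add: ball_bas_set b_mult co_b)
    show ?thesis
      using arg_cong[OF val[of "BP 0 n" A1], of "co A1"] l r n
      by (simp add: defc_b def_val_def a_minus_def b_mult)
  qed
  \<comment> \<open>Both cocycles vanish at (c, c), so g(c^2) = c g(c) + g(c) c, in which the
    coefficient of c is twice the e_1-coefficient of g(c).\<close>
  have "co (BP 0 n) (g (b (BP 0 (2 * n)))) = \<zero>\<^bsub>K\<^esub>"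
  proof -
    have l: "co (BP 0 n) (?c \<otimes> g ?c) = co (BP 0 0) (g ?c)"
      by (rule co_left) (simp_all add: ball_bas_set b_mult co_b n)
    have r: "co (BP 0 n) (g ?c \<otimes> ?c) = co (BP 0 0) (g ?c)"
      by (rule co_right) (simp_all add: ball_bas_set b_mult co_b n)
    have "\<ominus>\<^bsub>K\<^esub> co (BP 0 n) (g (b (BP 0 (2 * n)))) = \<zero>\<^bsub>K\<^esub>"
      using arg_cong[OF val[of "BP 0 n" "BP 0 n"], of "co (BP 0 n)"] l r n gc
      by (simp add: defc_b def_val_def a_minus_def b_mult mult_2)
    then show ?thesis by (metis K.minus_minus K.minus_zero co_closed lin_closed[OF g] b_closed)
  qed
  \<comment> \<open>Left multiples of alpha_2 and right multiples of alpha_1 have no c-component, so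
    only the term - g(c^2) of the coboundary is left.\<close>
  moreover have "q = \<ominus>\<^bsub>K\<^esub> co (BP 0 n) (g (b (BP 0 (2 * n))))"
  proof -
    have l: "co (BP 0 n) (b A1 \<otimes> g (b A2)) = \<zero>\<^bsub>K\<^esub>"
      by (rule co_left_zero) (simp_all add: ball_bas_set b_mult co_b n)
    have r: "co (BP 0 n) (g (b A1) \<otimes> b A2) = \<zero>\<^bsub>K\<^esub>"
      by (rule co_right_zero) (simp_all add: ball_bas_set b_mult co_b n)
    show ?thesis
      using arg_cong[OF val[of A1 A2], of "co (BP 0 n)"] l r n p0
      by (simp add: defc_b def_val_def a_minus_def b_mult co_b)
  qed
  ultimately show ?thesis using p0 by simp
qed

end

section \<open>Normalisation of cocycles\<close>

context gamma_star_basis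
begin

section \<open>Making a cocycle vanish on the vertices\<close>

definition cohom :: "('a \<Rightarrow> 'a \<Rightarrow> 'a) \<Rightarrow> ('a \<Rightarrow> 'a \<Rightarrow> 'a) \<Rightarrow> bool" where
  "cohom F G \<longleftrightarrow> (\<exists>g. lin g \<and> (\<forall>x\<in>carrier A. \<forall>y\<in>carrier A. F x y = G x y \<oplus> cobd g x y))"

text \<open>Normalisation relative to the subalgebra spanned by the vertices, which is more than
  vanishing at the unit: it makes \<open>F\<close> compatible with source and target.\<close>

definition normalised :: "('a \<Rightarrow> 'a \<Rightarrow> 'a) \<Rightarrow> bool" where
  "normalised F \<longleftrightarrow> cocycle F \<and>
    (\<forall>v\<in>idem_set n. \<forall>x\<in>carrier A. F (b v) x = \<zero> \<and> F x (b v) = \<zero>)"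

lemma cohom_trans:
  assumes "cohom F G" "cohom G H" "bilin H"
  shows "cohom F H"
proof -
  obtain g h where g: "lin g" "\<And>x y. x \<in> carrier A \<Longrightarrow> y \<in> carrier A \<Longrightarrow> F x y = G x y \<oplus> cobd g x y"
    and h: "lin h" "\<And>x y. x \<in> carrier A \<Longrightarrow> y \<in> carrier A \<Longrightarrow> G x y = H x y \<oplus> cobd h x y"
    using assms unfolding cohom_def by blast
  have "F x y = H x y \<oplus> cobd (\<lambda>x. g x \<oplus> h x) x y" if "x \<in> carrier A" "y \<in> carrier A" for x y
    using that g(2) h(2) cobd_plus[OF g(1) h(1) that] bilin_closed[OF assms(3) that]
      bilin_closed[OF bilin_cobd[OF g(1)] that] bilin_closed[OF bilin_cobd[OF h(1)] that]
    by (simp add: A.a_ac)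
  then show ?thesis unfolding cohom_def using lin_plus[OF g(1) h(1)] by blast
qed

lemma cohom_diff:
  assumes "bilin F" "lin g"
  shows "cohom F (\<lambda>x y. F x y \<ominus> cobd g x y)"
  unfolding cohom_def
  using assms bilin_closed[OF assms(1)] bilin_closed[OF bilin_cobd[OF assms(2)]]
  by (intro exI[of _ g]) (simp add: a_minus_def A.a_assoc A.l_neg)

lemma cohom_refl: "bilin F \<Longrightarrow> cohom F F"
  unfolding cohom_def by (intro exI[of _ "\<lambda>_. \<zero>"]) (simp add: lin_const_zero cobd_zero bilin_closed)

lemma cocycle_diff: "cocycle F \<Longrightarrow> cocycle G \<Longrightarrow> cocycle (\<lambda>x y. F x y \<ominus> G x y)"
  unfolding a_minus_def by (intro cocycle_plus cocycle_uminus)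

lemma idem_mult: "v \<in> idem_set n \<Longrightarrow> w \<in> idem_set n \<Longrightarrow> b v \<otimes> b w = (if v = w then b v else \<zero>)"
  by (auto simp: idem_set_def b_mult split: if_splits)

lemma lin_sum:
  assumes "finite V" "\<And>v. v \<in> V \<Longrightarrow> lin (h v)"
  shows "lin (\<lambda>x. \<Oplus>v\<in>V. h v x)"
  using assms
proof (induction V rule: finite_induct)
  case (insert v V)
  have 1: "lin (\<lambda>x. h v x \<oplus> (\<Oplus>v\<in>V. h v x))" using insert by (intro lin_plus) auto
  have "(\<Oplus>v\<in>insert v V. h v x) = h v x \<oplus> (\<Oplus>v\<in>V. h v x)" if "x \<in> carrier A" for x
    using insert that by (intro A.finsum_insert) (auto simp: Pi_def lin_closed)
  then show ?case using 1 by (simp add: lin_def Pi_def)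
qed (simp add: lin_const_zero)

lemma sum_idem_left: "x \<in> carrier A \<Longrightarrow> (\<Oplus>v\<in>idem_set n. b v \<otimes> x) = x"
  using A.finsum_ldistr[of "idem_set n" x b] A.l_one[of x] unfolding one_expand by (simp add: Pi_def)

lemma sum_idem_right: "x \<in> carrier A \<Longrightarrow> (\<Oplus>v\<in>idem_set n. x \<otimes> b v) = x"
  using A.finsum_rdistr[of "idem_set n" x b] A.r_one[of x] unfolding one_expand by (simp add: Pi_def)

text \<open>The span of the vertices is separable with separability idempotent the sum of v
  \<otimes> v. Contracting \<open>F\<close> with it gives g(x) = sum of v F(v, x); multiplying the
  cocycle identity at (v, w, y) by v and summing over v yields F(w, y) =
  \<open>cobd g w y\<close>.\<close>

lemma cohom_left_normalised:
  assumes F: "cocycle F"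
  shows "\<exists>G. cohom F G \<and> cocycle G \<and> (\<forall>v\<in>idem_set n. \<forall>x\<in>carrier A. G (b v) x = \<zero>)"
proof -
  note [simp] = cocycle_closed[OF F] bilin_zero[OF cocycle_bilin[OF F]]
  define g where "g x = (\<Oplus>v\<in>idem_set n. b v \<otimes> F (b v) x)" for x
  have g: "lin g" unfolding g_def
    by (intro lin_sum lin_mult_left bilinD[OF cocycle_bilin[OF F]]) simp_all
  note [simp] = lin_closed[OF g]
  have "F (b w) y \<ominus> cobd g (b w) y = \<zero>" if w: "w \<in> idem_set n" and [simp]: "y \<in> carrier A" for w y
  proof -
    have "(\<Oplus>v\<in>idem_set n. b v \<otimes> (b v \<otimes> F (b w) y \<oplus> F (b v) (b w \<otimes> y))) =
        (\<Oplus>v\<in>idem_set n. b v \<otimes> (F (b v \<otimes> b w) y \<oplus> F (b v) (b w) \<otimes> y))"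
      by (simp add: cocycleD[OF F])
    moreover have "(\<Oplus>v\<in>idem_set n. b v \<otimes> (b v \<otimes> F (b w) y \<oplus> F (b v) (b w \<otimes> y))) =
        (\<Oplus>v\<in>idem_set n. b v \<otimes> F (b w) y \<oplus> b v \<otimes> F (b v) (b w \<otimes> y))"
      by (rule A.finsum_cong') (auto simp: A.r_distr A.m_assoc[symmetric] idem_mult)
    moreover have "\<dots> = F (b w) y \<oplus> g (b w \<otimes> y)"
      by (subst A.finsum_addf) (simp_all add: sum_idem_left g_def)
    moreover have "(\<Oplus>v\<in>idem_set n. b v \<otimes> (F (b v \<otimes> b w) y \<oplus> F (b v) (b w) \<otimes> y)) =
        (\<Oplus>v\<in>idem_set n. b v \<otimes> F (b v \<otimes> b w) y \<oplus> (b v \<otimes> F (b v) (b w)) \<otimes> y)"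
      by (rule A.finsum_cong') (auto simp: A.r_distr A.m_assoc)
    moreover have "\<dots> = (\<Oplus>v\<in>idem_set n. b v \<otimes> F (b v \<otimes> b w) y) \<oplus> g (b w) \<otimes> y"
      by (subst A.finsum_addf) (simp_all add: g_def A.finsum_ldistr)
    moreover have "(\<Oplus>v\<in>idem_set n. b v \<otimes> F (b v \<otimes> b w) y) = b w \<otimes> F (b w) y"
      by (subst A.finsum_eq_single[of _ w]) (simp_all add: w idem_mult)
    moreover have "b w \<otimes> g y = b w \<otimes> F (b w) y"
    proof -
      have "b w \<otimes> g y = (\<Oplus>v\<in>idem_set n. b w \<otimes> (b v \<otimes> F (b v) y))"
        by (simp add: g_def A.finsum_rdistr)
      also have "\<dots> = b w \<otimes> (b w \<otimes> F (b w) y)"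
        by (rule A.finsum_eq_single) (auto simp: w idem_mult A.m_assoc[symmetric])
      finally show ?thesis by (simp add: A.m_assoc[symmetric] idem_mult w)
    qed
    ultimately have "F (b w) y \<oplus> g (b w \<otimes> y) = b w \<otimes> g y \<oplus> g (b w) \<otimes> y" by simp
    then have "F (b w) y = b w \<otimes> g y \<oplus> g (b w) \<otimes> y \<ominus> g (b w \<otimes> y)"
      by (metis A.add.inv_solve_right' A.m_closed \<open>y \<in> carrier A\<close> a_minus_def b_closed
          cocycle_closed[OF F] lin_closed[OF g] A.add.m_closed)
    also have "\<dots> = cobd g (b w) y" by (simp add: cobd_def a_minus_def A.a_ac)
    finally show ?thesis using bilin_closed[OF bilin_cobd[OF g]] by (simp add: a_minus_def A.r_neg)
  qed
  then show ?thesis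
    using cohom_diff[OF cocycle_bilin[OF F] g] cocycle_diff[OF F cocycle_cobd[OF g]] by blast
qed

text \<open>The mirror image of the previous contraction, g(x) = sum of G(x, v) v, corrects the
  second argument. The choice has to leave the first argument corrected as well.\<close>

lemma cohom_normalised:
  assumes F: "cocycle F"
  shows "\<exists>G. cohom F G \<and> normalised G"
proof -
  obtain G where FG: "cohom F G" and G: "cocycle G"
    and G0: "\<And>v x. v \<in> idem_set n \<Longrightarrow> x \<in> carrier A \<Longrightarrow> G (b v) x = \<zero>"
    using cohom_left_normalised[OF F] by blast
  note [simp] = cocycle_closed[OF G] bilin_zero[OF cocycle_bilin[OF G]]
  define g where "g x = (\<Oplus>v\<in>idem_set n. G x (b v) \<otimes> b v)" for x
  have g: "lin g" unfolding g_def
    by (intro lin_sum lin_mult_right bilinD[OF cocycle_bilin[OF G]]) simp_all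
  note [simp] = lin_closed[OF g]
  define H where "H x y = G x y \<ominus> cobd g x y" for x y
  have GH: "cohom G H" and H: "cocycle H" unfolding H_def
    by (intro cohom_diff cocycle_bilin G g cocycle_diff cocycle_cobd)+
  have "H y (b w) = \<zero>" if w: "w \<in> idem_set n" and [simp]: "y \<in> carrier A" for w y
  proof -
    have "(\<Oplus>v\<in>idem_set n. (y \<otimes> G (b w) (b v) \<oplus> G y (b w \<otimes> b v)) \<otimes> b v) =
        (\<Oplus>v\<in>idem_set n. (G (y \<otimes> b w) (b v) \<oplus> G y (b w) \<otimes> b v) \<otimes> b v)"
      by (simp add: cocycleD[OF G])
    moreover have "(\<Oplus>v\<in>idem_set n. (y \<otimes> G (b w) (b v) \<oplus> G y (b w \<otimes> b v)) \<otimes> b v) =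
        (\<Oplus>v\<in>idem_set n. y \<otimes> (G (b w) (b v) \<otimes> b v) \<oplus> G y (b w \<otimes> b v) \<otimes> b v)"
      by (rule A.finsum_cong') (auto simp: A.l_distr A.m_assoc)
    moreover have "\<dots> = y \<otimes> g (b w) \<oplus> (\<Oplus>v\<in>idem_set n. G y (b w \<otimes> b v) \<otimes> b v)"
      by (subst A.finsum_addf) (simp_all add: g_def A.finsum_rdistr)
    moreover have "(\<Oplus>v\<in>idem_set n. G y (b w \<otimes> b v) \<otimes> b v) = G y (b w) \<otimes> b w"
      by (subst A.finsum_eq_single[of _ w]) (auto simp: w idem_mult)
    moreover have "(\<Oplus>v\<in>idem_set n. (G (y \<otimes> b w) (b v) \<oplus> G y (b w) \<otimes> b v) \<otimes> b v) =
        (\<Oplus>v\<in>idem_set n. G (y \<otimes> b w) (b v) \<otimes> b v \<oplus> G y (b w) \<otimes> b v)"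
      by (rule A.finsum_cong') (auto simp: A.l_distr A.m_assoc idem_mult)
    moreover have "\<dots> = g (y \<otimes> b w) \<oplus> G y (b w)"
      by (subst A.finsum_addf) (simp_all add: g_def sum_idem_right)
    moreover have "g y \<otimes> b w = G y (b w) \<otimes> b w"
    proof -
      have "g y \<otimes> b w = (\<Oplus>v\<in>idem_set n. (G y (b v) \<otimes> b v) \<otimes> b w)"
        by (simp add: g_def A.finsum_ldistr)
      also have "\<dots> = (G y (b w) \<otimes> b w) \<otimes> b w"
        by (rule A.finsum_eq_single) (auto simp: w idem_mult A.m_assoc)
      finally show ?thesis by (simp add: A.m_assoc idem_mult w)
    qed
    ultimately have "G y (b w) \<oplus> g (y \<otimes> b w) = y \<otimes> g (b w) \<oplus> g y \<otimes> b w" by (simp add: A.a_comm)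
    then have "G y (b w) = y \<otimes> g (b w) \<oplus> g y \<otimes> b w \<ominus> g (y \<otimes> b w)"
      by (metis A.add.inv_solve_right' A.m_closed \<open>y \<in> carrier A\<close> a_minus_def b_closed
          cocycle_closed[OF G] lin_closed[OF g] A.add.m_closed)
    also have "\<dots> = cobd g y (b w)" by (simp add: cobd_def a_minus_def A.a_ac)
    finally show ?thesis unfolding H_def
      using bilin_closed[OF bilin_cobd[OF g]] by (simp add: a_minus_def A.r_neg)
  qed
  \<comment> \<open>Since \<open>G\<close> vanishes at vertices in the first argument,
    \<open>g\<close> commutes with left multiplication by them and kills them; so its coboundary
    vanishes there too.\<close>
  moreover have "H (b w) y = \<zero>" if w: "w \<in> idem_set n" and [simp]: "y \<in> carrier A" for w y
  proof -
    have "G (b w \<otimes> y) (b v) = b w \<otimes> G y (b v)" if "v \<in> idem_set n" for v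
      using cocycleD[OF G, of "b w" y "b v"] G0[OF w] by simp
    then have "g (b w \<otimes> y) = (\<Oplus>v\<in>idem_set n. b w \<otimes> (G y (b v) \<otimes> b v))"
      unfolding g_def by (intro A.finsum_cong') (auto simp: A.m_assoc)
    also have "\<dots> = b w \<otimes> g y" by (simp add: g_def A.finsum_rdistr)
    finally have 1: "g (b w \<otimes> y) = b w \<otimes> g y" .
    have 2: "g (b w) = \<zero>" by (simp add: g_def G0[OF w])
    show ?thesis by (simp add: H_def cobd_def 1 2 G0[OF w] a_minus_def A.r_neg)
  qed
  ultimately have "normalised H" using H by (simp add: normalised_def)
  then show ?thesis using cohom_trans[OF FG GH cocycle_bilin[OF H]] by blast
qed

lemma normalised_cocycle: "normalised F \<Longrightarrow> cocycle F"
  and normalised_idem: "normalised F \<Longrightarrow> v \<in> idem_set n \<Longrightarrow> x \<in> carrier A \<Longrightarrow> F (b v) x = \<zero>"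
    "normalised F \<Longrightarrow> v \<in> idem_set n \<Longrightarrow> x \<in> carrier A \<Longrightarrow> F x (b v) = \<zero>"
  by (auto simp: normalised_def)

text \<open>In the cocycle identity with a vertex in one of the three places, two terms have that
  vertex as an argument and drop out. The three places give this lemma and the next two.\<close>

lemma normalised_left:
  assumes F: "normalised F" and v: "v \<in> idem_set n" and [simp]: "x \<in> carrier A" "y \<in> carrier A"
  shows "F (b v \<otimes> x) y = b v \<otimes> F x y"
  using cocycleD[OF normalised_cocycle[OF F], of "b v" x y] cocycle_closed[OF normalised_cocycle[OF F]]
  by (simp add: normalised_idem[OF F v])

lemma normalised_right:
  assumes F: "normalised F" and v: "v \<in> idem_set n" and [simp]: "x \<in> carrier A" "y \<in> carrier A"
  shows "F x (y \<otimes> b v) = F x y \<otimes> b v"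
  using cocycleD[OF normalised_cocycle[OF F], of x y "b v"] cocycle_closed[OF normalised_cocycle[OF F]]
  by (simp add: normalised_idem[OF F v])

lemma normalised_middle:
  assumes F: "normalised F" and v: "v \<in> idem_set n" and [simp]: "x \<in> carrier A" "y \<in> carrier A"
  shows "F (x \<otimes> b v) y = F x (b v \<otimes> y)"
  using cocycleD[OF normalised_cocycle[OF F], of x "b v" y] cocycle_closed[OF normalised_cocycle[OF F]]
  by (simp add: normalised_idem[OF F v])

lemma src_idem: "s \<in> bas_set n \<Longrightarrow> src s \<in> idem_set n"
  and tgt_idem: "s \<in> bas_set n \<Longrightarrow> tgt n s \<in> idem_set n"
  using n_pos by (auto simp: src_def tgt_def split: bas.split)

lemma src_mult: "v \<in> idem_set n \<Longrightarrow> s \<in> bas_set n \<Longrightarrow> b v \<otimes> b s = (if v = src s then b s else \<zero>)"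
  by (auto simp: idem_set_def b_mult src_def split: bas.split if_splits)

lemma tgt_mult: "v \<in> idem_set n \<Longrightarrow> s \<in> bas_set n \<Longrightarrow> b s \<otimes> b v = (if v = tgt n s then b s else \<zero>)"
  using n_pos by (auto simp: idem_set_def b_mult tgt_def split: bas.split if_splits)

lemma co_src:
  assumes "v \<in> idem_set n" "x \<in> carrier A"
  shows "co r (b v \<otimes> x) = (if v = src r then co r x else \<zero>\<^bsub>K\<^esub>)"
proof (cases "v = src r")
  case True
  have "co r (b v \<otimes> x) = co r x"
    by (rule co_left) (use assms True in \<open>auto simp: src_mult co_b\<close>)
  then show ?thesis using True by simp
next
  case False
  have "co r (b v \<otimes> x) = \<zero>\<^bsub>K\<^esub>"
    by (rule co_left_zero) (use assms False in \<open>auto simp: src_mult co_b\<close>)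
  then show ?thesis using False by simp
qed

lemma co_tgt:
  assumes "v \<in> idem_set n" "x \<in> carrier A"
  shows "co r (x \<otimes> b v) = (if v = tgt n r then co r x else \<zero>\<^bsub>K\<^esub>)"
proof (cases "v = tgt n r")
  case True
  have "co r (x \<otimes> b v) = co r x"
    by (rule co_right) (use assms True in \<open>auto simp: tgt_mult co_b\<close>)
  then show ?thesis using True by simp
next
  case False
  have "co r (x \<otimes> b v) = \<zero>\<^bsub>K\<^esub>"
    by (rule co_right_zero) (use assms False in \<open>auto simp: tgt_mult co_b\<close>)
  then show ?thesis using False by simp
qed

lemma normalised_support:
  assumes F: "normalised F" and s: "s \<in> bas_set n" and t: "t \<in> bas_set n"
    and r: "src r \<noteq> src s \<or> tgt n r \<noteq> tgt n t"
  shows "co r (F (b s) (b t)) = \<zero>\<^bsub>K\<^esub>"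
proof -
  have "F (b s) (b t) = b (src s) \<otimes> F (b s) (b t)"
    using normalised_left[OF F src_idem[OF s], of "b s" "b t"] s by (simp add: src_mult src_idem)
  moreover have "F (b s) (b t) = F (b s) (b t) \<otimes> b (tgt n t)"
    using normalised_right[OF F tgt_idem[OF t], of "b s" "b t"] t by (simp add: tgt_mult tgt_idem)
  ultimately show ?thesis
    using r co_src[OF src_idem[OF s]] co_tgt[OF tgt_idem[OF t]] cocycle_closed[OF normalised_cocycle[OF F]]
    by (metis b_closed)
qed

lemma normalised_composable:
  assumes F: "normalised F" and s: "s \<in> bas_set n" and t: "t \<in> bas_set n" and "tgt n s \<noteq> src t"
  shows "F (b s) (b t) = \<zero>"
  using normalised_middle[OF F tgt_idem[OF s], of "b s" "b t"] assms
    bilin_zero[OF cocycle_bilin[OF normalised_cocycle[OF F]]]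
  by (simp add: tgt_mult src_mult tgt_idem)

text \<open>Values of \<open>F\<close> lie in the corner cut out by the outer endpoints, so only
  coefficients of normal forms parallel to the pair matter. For most pairs below there are none, or
  just one.\<close>

lemma normalised_corner_zero:
  assumes F: "normalised F" and s: "s \<in> bas_set n" and t: "t \<in> bas_set n"
    and zero: "\<forall>r\<in>bas_set n. src r = src s \<and> tgt n r = tgt n t \<longrightarrow> co r (F (b s) (b t)) = \<zero>\<^bsub>K\<^esub>"
  shows "F (b s) (b t) = \<zero>"
proof (rule eqI)
  fix r assume r: "r \<in> bas_set n"
  show "co r (F (b s) (b t)) = co r \<zero>"
  proof (cases "src r = src s \<and> tgt n r = tgt n t")
    case False
    then show ?thesis using normalised_support[OF F s t] by auto
  qed (use zero r in auto)
qed (simp_all add: cocycle_closed[OF normalised_cocycle[OF F]])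

text \<open>The hypotheses say that the linear extension of \<open>g\<close> is a bimodule map over
  the span of the vertices and vanishes on it.\<close>

lemma normalised_cobd:
  assumes g [simp]: "\<And>s. g s \<in> carrier A"
    and g0: "\<And>v. v \<in> idem_set n \<Longrightarrow> g v = \<zero>"
    and gl: "\<And>s. s \<in> bas_set n \<Longrightarrow> b (src s) \<otimes> g s = g s"
    and gr: "\<And>s. s \<in> bas_set n \<Longrightarrow> g s \<otimes> b (tgt n s) = g s"
  shows "normalised (cobd (lin_ext g))"
proof -
  have L: "lin (lin_ext g)" by (rule lin_lin_ext) simp
  note bl = bilin_cobd[OF L]
  have "cobd (lin_ext g) (b v) x = \<zero>" "cobd (lin_ext g) x (b v) = \<zero>"
    if v: "v \<in> idem_set n" and x: "x \<in> carrier A" for v x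
  proof -
    have l: "b v \<otimes> g s = (if v = src s then g s else \<zero>)" if "s \<in> bas_set n" for s
    proof -
      have "b v \<otimes> (b (src s) \<otimes> g s) = (b v \<otimes> b (src s)) \<otimes> g s" by (simp add: A.m_assoc)
      then show ?thesis using that v by (simp add: gl idem_mult src_idem split: if_splits)
    qed
    have r: "g s \<otimes> b v = (if v = tgt n s then g s else \<zero>)" if "s \<in> bas_set n" for s
    proof -
      have "(g s \<otimes> b (tgt n s)) \<otimes> b v = g s \<otimes> (b (tgt n s) \<otimes> b v)" by (simp add: A.m_assoc)
      then show ?thesis using that v by (simp add: gr idem_mult tgt_idem split: if_splits)
    qed
    show "cobd (lin_ext g) (b v) x = \<zero>"
    proof (rule lin_eqI[OF bilinD(1)[OF bl b_closed] lin_const_zero _ x])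
      fix s assume "s \<in> bas_set n"
      then show "cobd (lin_ext g) (b v) (b s) = \<zero>"
        using v by (simp add: cobd_def lin_ext_b lin_zero[OF L] idem_bas src_mult l g0 a_minus_def A.r_neg)
    qed
    show "cobd (lin_ext g) x (b v) = \<zero>"
    proof (rule lin_eqI[OF bilinD(2)[OF bl b_closed] lin_const_zero _ x])
      fix s assume "s \<in> bas_set n"
      then show "cobd (lin_ext g) (b s) (b v) = \<zero>"
        using v by (simp add: cobd_def lin_ext_b lin_zero[OF L] idem_bas tgt_mult r g0 a_minus_def A.l_neg)
    qed
  qed
  then show ?thesis by (simp add: normalised_def cocycle_cobd[OF L])
qed

lemma normalised_diff:
  assumes "normalised F" "normalised G"
  shows "normalised (\<lambda>x y. F x y \<ominus> G x y)"
  using assms cocycle_diff by (auto simp: normalised_def a_minus_def)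

lemma normalised_plus:
  assumes "normalised F" "normalised G"
  shows "normalised (\<lambda>x y. F x y \<oplus> G x y)"
  using assms cocycle_plus by (auto simp: normalised_def)

lemma normalised_scale:
  assumes "normalised F" "c \<in> carrier K"
  shows "normalised (\<lambda>x y. c \<odot> F x y)"
  using assms cocycle_scale by (auto simp: normalised_def)

section \<open>Making a cocycle vanish along the tree of normal forms\<close>

definition tree_zero :: "('a \<Rightarrow> 'a \<Rightarrow> 'a) \<Rightarrow> bool" where
  "tree_zero F \<longleftrightarrow> normalised F
    \<and> (\<forall>i<n. \<forall>L<2 * n. F (b (BP i L)) (b (BP ((i + L) mod n) 1)) = \<zero>)
    \<and> F (b A2) (b G1) = \<zero> \<and> F (b G2) (b A1) = \<zero>"

lemma tree_zero_normalised: "tree_zero F \<Longrightarrow> normalised F"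
  by (simp add: tree_zero_def)

lemma tree_zero_diff: "tree_zero F \<Longrightarrow> tree_zero G \<Longrightarrow> tree_zero (\<lambda>x y. F x y \<ominus> G x y)"
  by (auto simp: tree_zero_def normalised_diff)

lemma tree_zero_plus: "tree_zero F \<Longrightarrow> tree_zero G \<Longrightarrow> tree_zero (\<lambda>x y. F x y \<oplus> G x y)"
  by (auto simp: tree_zero_def normalised_plus)

lemma tree_zero_scale: "tree_zero F \<Longrightarrow> c \<in> carrier K \<Longrightarrow> tree_zero (\<lambda>x y. c \<odot> F x y)"
  by (auto simp: tree_zero_def normalised_scale)

text \<open>Appending arrows organises the normal forms into a tree, with the vertices as roots.
  Solving p g(a) - g(pa) + g(p) a = F(p, a) along it with g(a) = 0 on arrows gives the recursion
  g(pa) = g(p) a - F(p, a).\<close>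

primrec path_prim :: "('a \<Rightarrow> 'a \<Rightarrow> 'a) \<Rightarrow> nat \<Rightarrow> nat \<Rightarrow> 'a" where
  "path_prim F i 0 = \<zero>"
| "path_prim F i (Suc L) = path_prim F i L \<otimes> b (BP ((i + L) mod n) 1)
    \<ominus> F (b (BP i L)) (b (BP ((i + L) mod n) 1))"

definition tree_prim :: "('a \<Rightarrow> 'a \<Rightarrow> 'a) \<Rightarrow> bas \<Rightarrow> 'a" where
  "tree_prim F s = (case s of BP i L \<Rightarrow> path_prim F i L | A2G1 \<Rightarrow> \<ominus> F (b A2) (b G1)
     | G2A1 \<Rightarrow> \<ominus> F (b G2) (b A1) | _ \<Rightarrow> \<zero>)"

lemma BP_mult1: "i < n \<Longrightarrow> L < 2 * n \<Longrightarrow> b (BP i L) \<otimes> b (BP ((i + L) mod n) 1) = b (BP i (Suc L))"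
  using BP_mult[of i L 1] by simp

lemma cohom_tree_zero:
  assumes F: "normalised F"
  shows "\<exists>G. cohom F G \<and> tree_zero G"
proof -
  note Fc[simp] = cocycle_closed[OF normalised_cocycle[OF F]]
  have pc[simp]: "path_prim F i L \<in> carrier A" for i L by (induction L) simp_all
  have tc: "tree_prim F s \<in> carrier A" for s by (simp add: tree_prim_def split: bas.split)
  let ?g = "lin_ext (tree_prim F)"
  have L: "lin ?g" by (rule lin_lin_ext[OF tc])
  \<comment> \<open>The recursion stays in the corner of the path, as \<open>normalised_cobd\<close>
    requires; the next claims do the same on the right and for the two mixed paths.\<close>
  have pl: "b (BP i 0) \<otimes> path_prim F i L = path_prim F i L" if "i < n" "L \<le> 2 * n" for i L
    using that(2)
  proof (induction L)
    case (Suc L)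
    have v: "BP i 0 \<in> idem_set n" using that by simp
    have "b (BP i 0) \<otimes> F (b (BP i L)) (b (BP ((i + L) mod n) 1)) = F (b (BP i L)) (b (BP ((i + L) mod n) 1))"
      using normalised_left[OF F v, of "b (BP i L)" "b (BP ((i + L) mod n) 1)"] that(1) Suc.prems
      by (simp add: b_mult)
    then show ?case using Suc by (simp add: a_minus_def A.r_distr A.r_minus A.m_assoc[symmetric])
  qed simp
  have pr: "path_prim F i L \<otimes> b (BP ((i + L) mod n) 0) = path_prim F i L" if "i < n" "L \<le> 2 * n" for i L
  proof (cases L)
    case (Suc M)
    have v: "BP ((i + L) mod n) 0 \<in> idem_set n" using n_pos by simp
    have e: "b (BP ((i + M) mod n) 1) \<otimes> b (BP ((i + L) mod n) 0) = b (BP ((i + M) mod n) 1)"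
      using that n_pos Suc by (simp add: b_mult mod_simps)
    have "F (b (BP i M)) (b (BP ((i + M) mod n) 1)) \<otimes> b (BP ((i + L) mod n) 0) =
        F (b (BP i M)) (b (BP ((i + M) mod n) 1))"
      using normalised_right[OF F v, of "b (BP i M)" "b (BP ((i + M) mod n) 1)"] e by simp
    then show ?thesis using e unfolding Suc
      by (simp add: a_minus_def A.l_distr A.l_minus A.m_assoc)
  qed simp
  have pG: "b EA \<otimes> F (b A2) (b G1) = F (b A2) (b G1)" "F (b A2) (b G1) \<otimes> b EG = F (b A2) (b G1)"
    "b EG \<otimes> F (b G2) (b A1) = F (b G2) (b A1)" "F (b G2) (b A1) \<otimes> b EA = F (b G2) (b A1)"
    using normalised_left[OF F, of EA "b A2" "b G1"] normalised_right[OF F, of EG "b A2" "b G1"]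
      normalised_left[OF F, of EG "b G2" "b A1"] normalised_right[OF F, of EA "b G2" "b A1"]
    by (simp_all add: b_mult)
  have N: "normalised (cobd ?g)"
  proof (rule normalised_cobd[OF tc])
    fix v assume "v \<in> idem_set n"
    then show "tree_prim F v = \<zero>" by (auto simp: idem_set_def tree_prim_def)
  next
    fix s assume "s \<in> bas_set n"
    then show "b (src s) \<otimes> tree_prim F s = tree_prim F s" "tree_prim F s \<otimes> b (tgt n s) = tree_prim F s"
      by (auto simp: tree_prim_def src_def tgt_def pl pr pG A.l_minus A.r_minus split: bas.split)
  qed
  \<comment> \<open>On an arrow the recursion leaves only \<open>F\<close> at a vertex, which is
    zero; so the assumption g(a) = 0 is consistent.\<close>
  have [simp]: "tree_prim F (BP i 1) = \<zero>" "tree_prim F (BP i (Suc 0)) = \<zero>" if "i < n" for i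
    using that normalised_idem(1)[OF F, of "BP i 0"] by (simp_all add: tree_prim_def a_minus_def)
  have cancel: "\<zero> \<ominus> (p \<ominus> f) \<oplus> p = f" if "p \<in> carrier A" "f \<in> carrier A" for p f
    using that by (simp add: a_minus_def A.minus_add A.a_ac A.l_neg A.r_neg)
  have 1: "cobd ?g (b (BP i M)) (b (BP ((i + M) mod n) 1)) = F (b (BP i M)) (b (BP ((i + M) mod n) 1))"
    if "i < n" "M < 2 * n" for i M
    unfolding cobd_def using that n_pos BP_mult1[OF that]
    by (simp add: lin_ext_b[OF tc] lin_zero[OF L]) (simp add: tree_prim_def cancel)
  have 2: "cobd ?g (b A2) (b G1) = F (b A2) (b G1)" "cobd ?g (b G2) (b A1) = F (b G2) (b A1)"
    by (simp_all add: cobd_def b_mult lin_ext_b[OF tc] tree_prim_def a_minus_def)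
  have "tree_zero (\<lambda>x y. F x y \<ominus> cobd ?g x y)"
    unfolding tree_zero_def using 1 2 normalised_diff[OF F N] by (simp add: a_minus_def A.r_neg)
  then show ?thesis using cohom_diff[OF cocycle_bilin[OF normalised_cocycle[OF F]] L] by blast
qed

end

section \<open>Reduction to values on relations\<close>

lemma src_simps [simp]:
  "src (BP i L) = BP i 0" "src EA = EA" "src EG = EG" "src A1 = BP 0 0" "src A2 = EA"
  "src G1 = BP 0 0" "src G2 = EG" "src A2G1 = EA" "src G2A1 = EG"
  by (simp_all add: src_def)

lemma tgt_simps [simp]:
  "tgt n (BP i L) = BP ((i + L) mod n) 0" "tgt n EA = EA" "tgt n EG = EG" "tgt n A1 = EA"
  "tgt n A2 = BP 0 0" "tgt n G1 = EG" "tgt n G2 = BP 0 0" "tgt n A2G1 = EG" "tgt n G2A1 = EA"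
  by (simp_all add: tgt_def)

text \<open>Applied to lengths: the closed beta-paths at a vertex among the normal forms are the
  trivial one and those going once or twice round the cycle.\<close>

lemma mult_mod_cases:
  fixes n L :: nat
  assumes "L mod n = 0" "L \<le> 2 * n" "n \<ge> 1"
  shows "L = 0 \<or> L = n \<or> L = 2 * n"
proof -
  obtain k where "L = n * k" using assms(1) by auto
  moreover have "k \<le> 2" using assms calculation by auto
  then have "k = 0 \<or> k = 1 \<or> k = 2" by auto
  ultimately show ?thesis by auto
qed

context gamma_star_basis
begin

lemma cocycle_basis:
  assumes "cocycle F"
  shows "b s \<otimes> F (b t) (b u) \<oplus> F (b s) (b t \<otimes> b u) = F (b s \<otimes> b t) (b u) \<oplus> F (b s) (b t) \<otimes> b u"
  using cocycleD[OF assms] by simp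

text \<open>The second path is lengthened by one arrow at a time: F(p, qa) = F(pq, a) + F(p, q) a -
  p F(q, a), and all three terms vanish.\<close>

lemma tree_zero_path:
  assumes F: "tree_zero F" and i: "i < n" and "L + M \<le> 2 * n"
  shows "F (b (BP i L)) (b (BP ((i + L) mod n) M)) = \<zero>"
  using assms(3)
proof (induction M)
  case 0
  show ?case using normalised_idem(2)[OF tree_zero_normalised[OF F]] n_pos by simp
next
  case (Suc M)
  let ?j = "(i + L) mod n"
  have N: "normalised F" by (rule tree_zero_normalised[OF F])
  note C = normalised_cocycle[OF N]
  have T: "F (b (BP k N)) (b (BP ((k + N) mod n) 1)) = \<zero>" if "k < n" "N < 2 * n" for k N
    using F that by (simp add: tree_zero_def)
  have j: "?j < n" using n_pos by simp
  have e: "(?j + M) mod n = (i + (L + M)) mod n" by (simp add: mod_simps add.assoc)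
  have 1: "F (b (BP ?j M)) (b (BP ((?j + M) mod n) 1)) = \<zero>" using T[OF j, of M] Suc.prems by simp
  have 2: "F (b (BP i (L + M))) (b (BP ((?j + M) mod n) 1)) = \<zero>"
    unfolding e using T[OF i, of "L + M"] Suc.prems by simp
  have 3: "b (BP ?j M) \<otimes> b (BP ((?j + M) mod n) 1) = b (BP ?j (Suc M))"
    using BP_mult1[OF j] Suc.prems by simp
  show ?case
    using cocycle_basis[OF C, of "BP i L" "BP ?j M" "BP ((?j + M) mod n) 1"] 1 2 Suc
    by (simp add: 3 BP_mult[OF i] del: One_nat_def) (simp add: cocycle_closed[OF C])
qed

text \<open>If \<open>F\<close> vanishes on arrows in the second argument, then \<open>F x (y a) = F x y \<otimes> a\<close>.\<close>

lemma cocycle_vanishI: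
  assumes F: "normalised F"
    and beta: "\<And>s j. s \<in> bas_set n \<Longrightarrow> j < n \<Longrightarrow> F (b s) (b (BP j 1)) = \<zero>"
    and arrows: "\<And>s t. s \<in> bas_set n \<Longrightarrow> t \<in> {A1, A2, G1, G2} \<Longrightarrow> F (b s) (b t) = \<zero>"
    and x: "x \<in> carrier A" and y: "y \<in> carrier A"
  shows "F x y = \<zero>"
proof -
  note C = normalised_cocycle[OF F]
  note B = cocycle_bilin[OF C]
  have lift: "F x (b t) = \<zero>"
    if "\<And>s. s \<in> bas_set n \<Longrightarrow> F (b s) (b t) = \<zero>" and "x \<in> carrier A" for t x
    using lin_eqI[OF bilinD(2)[OF B b_closed] lin_const_zero _ that(2)] that(1) by blast
  have beta': "F x (b (BP j 1)) = \<zero>" if "x \<in> carrier A" "j < n" for x j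
    using lift beta that by blast
  have step: "F x (b s \<otimes> b t) = \<zero>"
    if "\<And>x. x \<in> carrier A \<Longrightarrow> F x (b s) = \<zero>" "\<And>x. x \<in> carrier A \<Longrightarrow> F x (b t) = \<zero>"
      "x \<in> carrier A" for x s t
    using cocycleD[OF C, of x "b s" "b t"] that cocycle_closed[OF C] by simp
  have path: "F x (b (BP j M)) = \<zero>" if "x \<in> carrier A" "j < n" "M \<le> 2 * n" for x j M
    using that(1,3)
  proof (induction M arbitrary: x)
    case 0
    then show ?case using normalised_idem(2)[OF F] that by simp
  next
    case (Suc M)
    then have "b (BP j M) \<otimes> b (BP ((j + M) mod n) 1) = b (BP j (Suc M))"
      using BP_mult1[OF that(2)] by simp
    then show ?case using step[of "BP j M" "BP ((j + M) mod n) 1" x] Suc beta' n_pos by simp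
  qed
  have arr: "F x (b t) = \<zero>" if "x \<in> carrier A" "t \<in> {A1, A2, G1, G2}" for x t
    using lift arrows that by blast
  have "F x (b t) = \<zero>" if "t \<in> bas_set n" for t
  proof (cases t)
    case A2G1
    then show ?thesis using step[of A2 G1 x] arr x by (simp add: b_mult)
  next
    case G2A1
    then show ?thesis using step[of G2 A1 x] arr x by (simp add: b_mult)
  qed (use that path arr x normalised_idem(2)[OF F] in auto)
  then show ?thesis using lin_eqI[OF bilinD(1)[OF B x] lin_const_zero _ y] by blast
qed

text \<open>By \<open>cocycle_vanishI\<close> only an arrow as second argument matters. The cocycle
  identity at an overlap of relations shows that a remaining value, perhaps multiplied by a normal
  form, is zero. That multiplication is injective on the coefficients which the endpoints allow,
  except for c^2 at (gamma_1, gamma_2), which is why this coefficient is among the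
  hypotheses.\<close>

lemma tree_zero_vanish:
  assumes F: "tree_zero F"
    and cA1: "F (b (BP 0 n)) (b A1) = \<zero>"
    and A1A2: "F (b A1) (b A2) = \<zero>"
    and G1G2: "co (BP 0 (2 * n)) (F (b G1) (b G2)) = \<zero>\<^bsub>K\<^esub>"
    and x: "x \<in> carrier A" and y: "y \<in> carrier A"
  shows "F x y = \<zero>"
proof -
  have N: "normalised F" by (rule tree_zero_normalised[OF F])
  note C = normalised_cocycle[OF N]
  note Z[simp] = bilin_zero[OF cocycle_bilin[OF C]]
  note cl[simp] = cocycle_closed[OF C]
  note coc = cocycle_basis[OF C]
  have n: "0 < n" "1 \<le> n" "n \<noteq> 0" using n_pos by auto
  note [simp] = n(1,3)
  let ?c = "BP 0 n" and ?cc = "BP 0 (2 * n)" and ?b0 = "BP 0 1"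
  note S = b_mult mult_2
  note corner = normalised_corner_zero[OF N]
  have A2G1: "F (b A2) (b G1) = \<zero>" and G2A1: "F (b G2) (b A1) = \<zero>" using F by (simp_all add: tree_zero_def)
  have c_c: "F (b ?c) (b ?c) = \<zero>" using tree_zero_path[OF F, of 0 n n] by simp
  have c_cc: "F (b ?c) (b ?cc) = F (b ?cc) (b ?c)"
    using coc[of ?c ?c ?c] c_c by (simp add: S)
  have cc_A1: "F (b ?cc) (b A1) = \<zero>" using coc[of ?c ?c A1] c_c cA1 by (simp add: S)
  have BP_A1: "F (b (BP i L)) (b A1) = \<zero>" if "i < n" "L \<le> 2 * n" for i L
  \<comment> \<open>Only closed paths at vertex 1 matter: with another end the pair is not
    composable, and no normal form leads from one of the vertices 2, ..., n to n + 1.\<close>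
  proof (cases "i = 0 \<and> (i + L) mod n = 0")
    case True
    then have "L = 0 \<or> L = n \<or> L = 2 * n" using mult_mod_cases[of L n] that n True by auto
    then show ?thesis using True cA1 cc_A1 normalised_idem(1)[OF N, of "BP 0 0" "b A1"] by auto
  next
    case False
    show ?thesis
    proof (cases "(i + L) mod n = 0")
      case True
      with False show ?thesis using that by (intro corner) (auto simp: ball_bas_set)
    next
      case False
      then show ?thesis using that by (intro normalised_composable[OF N]) auto
    qed
  qed
  \<comment> \<open>Writing c^2 as alpha_1 alpha_2 brings in the two values assumed to vanish; the
    symmetry \<open>c_c\<close> and \<open>c_cc\<close> then transfers the result to (c^2,
    c).\<close>
  have "F (b ?c) (b ?cc) = \<zero>" using coc[of ?c A1 A2] A1A2 cA1 by (simp add: S)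
  then have cc_c: "F (b ?cc) (b ?c) = \<zero>" using c_cc by simp
  \<comment> \<open>The value is a multiple of alpha_2, and left multiplication by alpha_1 detects
    it because alpha_1 alpha_2 = c^2 is nonzero.\<close>
  have A2_c: "F (b A2) (b ?c) = \<zero>"
  proof -
    have "b A1 \<otimes> F (b A2) (b ?c) = \<zero>" using coc[of A1 A2 ?c] cc_c A1A2 by (simp add: S)
    moreover have "co ?cc (b A1 \<otimes> F (b A2) (b ?c)) = co A2 (F (b A2) (b ?c))"
      by (rule co_left) (simp_all add: ball_bas_set b_mult co_b)
    ultimately have "co A2 (F (b A2) (b ?c)) = \<zero>\<^bsub>K\<^esub>" by simp
    then show ?thesis by (intro corner) (auto simp: ball_bas_set)
  qed
  \<comment> \<open>Here alpha_1 carries the information over to the gamma side: gamma_2 alpha_1 is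
    a normal form, whereas gamma_2 gamma_1 = 0.\<close>
  have G2_c: "F (b G2) (b ?c) = \<zero>"
  proof -
    have "F (b G2) (b ?c) \<otimes> b A1 = \<zero>" using coc[of G2 ?c A1] cA1 by (simp add: S)
    moreover have "co G2A1 (F (b G2) (b ?c) \<otimes> b A1) = co G2 (F (b G2) (b ?c))"
      by (rule co_right) (simp_all add: ball_bas_set b_mult co_b)
    ultimately have "co G2 (F (b G2) (b ?c)) = \<zero>\<^bsub>K\<^esub>" by simp
    then show ?thesis by (intro corner) (auto simp: ball_bas_set)
  qed
  \<comment> \<open>For n = 1 the arrow beta_1 is c itself; otherwise no normal form leads from n +
    1 or n + 2 to vertex 2.\<close>
  have A2_b: "F (b A2) (b ?b0) = \<zero>" and G2_b: "F (b G2) (b ?b0) = \<zero>"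
  proof -
    show "F (b A2) (b ?b0) = \<zero>"
    proof (cases "n = 1")
      case True then show ?thesis using A2_c by simp
    next
      case False
      with n have "1 mod n \<noteq> 0" by simp
      then show ?thesis by (intro corner) (auto simp: ball_bas_set Suc_le_eq)
    qed
    show "F (b G2) (b ?b0) = \<zero>"
    proof (cases "n = 1")
      case True then show ?thesis using G2_c by simp
    next
      case False
      with n have "1 mod n \<noteq> 0" by simp
      then show ?thesis by (intro corner) (auto simp: ball_bas_set Suc_le_eq)
    qed
  qed
  have cc_b: "F (b ?cc) (b ?b0) = \<zero>" using coc[of A1 A2 ?b0] A2_b A1A2 by (simp add: S)
  have BP_b: "F (b (BP i (2 * n))) (b (BP i 1)) = \<zero>" if i: "i < n" for i
  proof (cases "i = 0")
    case True
    then show ?thesis using cc_b by simp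
  next
    case False
    \<comment> \<open>The relation (iii) at vertex i + 1 is cut at its first visit to vertex 1 as
      xy, where y = w \<beta> with \<beta> the arrow leaving vertex i + 1. The choice of z completes
      y to c^2. The triple (x, w, \<beta>) identifies the wanted value with F(x, y), and (x, y, z)
      shows F(x, y) z = 0, as F(x, c^2) is known from (x, alpha_1, alpha_2).\<close>
    let ?x = "BP i (n - i)" and ?y = "BP 0 (n + i + 1)" and ?j = "(i + 1) mod n"
    let ?z = "BP ?j (n - i - 1)" and ?w = "BP 0 (n + i)"
    have "F (b ?x) (b ?cc) = \<zero>"
      using coc[of ?x A1 A2] A1A2 BP_A1[of i "n - i"] False i by (simp add: S)
    moreover have "b ?y \<otimes> b ?z = b ?cc"
    proof -
      have "0 + (n + i + 1) = (i + 1) + n" by simp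
      then have "(0 + (n + i + 1)) mod n = ?j" by (simp only: mod_add_self2)
      then show ?thesis using BP_mult[of 0 "n + i + 1" "n - i - 1"] i by (simp add: mult_2)
    qed
    moreover have "b ?x \<otimes> b ?y = \<zero>" using i by (simp add: b_mult)
    moreover have "F (b ?y) (b ?z) = \<zero>"
    proof -
      have "0 + (n + i + 1) = (i + 1) + n" by simp
      then have "(0 + (n + i + 1)) mod n = ?j" by (simp only: mod_add_self2)
      then show ?thesis using tree_zero_path[OF F, of 0 "n + i + 1" "n - i - 1"] i by simp
    qed
    ultimately have wz: "F (b ?x) (b ?y) \<otimes> b ?z = \<zero>"
      using coc[of ?x ?y ?z] by simp
    have xw: "b ?x \<otimes> b ?w = b (BP i (2 * n))" and Fxw: "F (b ?x) (b ?w) = \<zero>"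
      using BP_mult[OF i, of "n - i" "n + i"] tree_zero_path[OF F i, of "n - i" "n + i"] i
      by (simp_all add: mult_2)
    have "b ?w \<otimes> b (BP i 1) = b ?y" and "F (b ?w) (b (BP i 1)) = \<zero>"
      using BP_mult[of 0 "n + i" 1] tree_zero_path[OF F, of 0 "n + i" 1] i by simp_all
    with xw Fxw have eq: "F (b (BP i (2 * n))) (b (BP i 1)) = F (b ?x) (b ?y)"
      using coc[of ?x ?w "BP i 1"] by simp
    have "co (BP i L) (F (b ?x) (b ?y)) = \<zero>\<^bsub>K\<^esub>" if L: "L \<le> 2 * n" "(i + L) mod n = ?j" for L
    proof -
      \<comment> \<open>As n \<ge> 2 here, the endpoints allow only L = 1 and L = n + 1. So
        appending z keeps the length within 2n, and multiplication by z loses no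
        coefficient.\<close>
      have "L \<le> n + i + 1"
      proof (rule ccontr)
        assume "\<not> L \<le> n + i + 1"
        define d where "d = L - (n + 1)"
        have d: "L = n + 1 + d" "0 < d" "d < n" using \<open>\<not> L \<le> n + i + 1\<close> L False i by (auto simp: d_def)
        have "(i + 1 + d) mod n = (i + 1) mod n" using L(2) unfolding d(1)
          by (metis add.assoc add.commute mod_add_self2)
        then have "[i + 1 + d = i + 1 + 0] (mod n)" by (simp add: cong_def)
        then have "[d = 0] (mod n)" using cong_add_lcancel_nat by blast
        then show False using d by (simp add: cong_def)
      qed
      then have "co (BP i (L + (n - i - 1))) (F (b ?x) (b ?y) \<otimes> b ?z) = co (BP i L) (F (b ?x) (b ?y))"
        using i L False
        by (intro co_right) (auto simp: ball_bas_set b_mult co_b)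
      then show ?thesis using wz by simp
    qed
    moreover have "Suc (n + i) mod n = Suc i mod n" using mod_add_self1[of n "Suc i"] by (simp del: mod_add_self1)
    ultimately show ?thesis unfolding eq using i False
      by (intro corner) (auto simp: ball_bas_set mod_simps)
  qed
  \<comment> \<open>Right multiplication by beta_1 preserves the coefficients of e_1 and c and kills
    only c^2, whose coefficient is zero by hypothesis.\<close>
  have G1G2': "F (b G1) (b G2) = \<zero>"
  proof -
    have z: "F (b G1) (b G2) \<otimes> b ?b0 = \<zero>" using coc[of G1 G2 ?b0] G2_b cc_b by (simp add: S)
    have "co (BP 0 (L + 1)) (F (b G1) (b G2) \<otimes> b ?b0) = co (BP 0 L) (F (b G1) (b G2))"
      if "L = 0 \<or> L = n" for L
      using that by (intro co_right) (auto simp: ball_bas_set b_mult co_b Suc_le_eq)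
    then have "co (BP 0 L) (F (b G1) (b G2)) = \<zero>\<^bsub>K\<^esub>" if "L = 0 \<or> L = n" for L
      using that z by auto
    then have "co (BP 0 L) (F (b G1) (b G2)) = \<zero>\<^bsub>K\<^esub>" if "L mod n = 0" "L \<le> 2 * n" for L
      using mult_mod_cases[of L n] that n G1G2 by auto
    then show ?thesis by (intro corner) (auto simp: ball_bas_set)
  qed
  \<comment> \<open>The value is a multiple of gamma_1, detected by left multiplication with
    alpha_2, since alpha_2 gamma_1 is a normal form.\<close>
  have c_G1: "F (b ?c) (b G1) = \<zero>"
  proof -
    have "b A2 \<otimes> F (b ?c) (b G1) = \<zero>" using coc[of A2 ?c G1] A2_c by (simp add: S)
    moreover have "co A2G1 (b A2 \<otimes> F (b ?c) (b G1)) = co G1 (F (b ?c) (b G1))"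
      by (rule co_left) (simp_all add: ball_bas_set b_mult co_b)
    ultimately have "co G1 (F (b ?c) (b G1)) = \<zero>\<^bsub>K\<^esub>" by simp
    then show ?thesis by (intro corner) (auto simp: ball_bas_set)
  qed
  have cc_G1: "F (b ?cc) (b G1) = \<zero>" using coc[of ?c ?c G1] c_c c_G1 by (simp add: S)
  have BP_G1: "F (b (BP i L)) (b G1) = \<zero>" if "i < n" "L \<le> 2 * n" for i L
  proof (cases "i = 0 \<and> (i + L) mod n = 0")
    case True
    then have "L = 0 \<or> L = n \<or> L = 2 * n" using mult_mod_cases[of L n] that n True by auto
    then show ?thesis using True c_G1 cc_G1 normalised_idem(1)[OF N, of "BP 0 0" "b G1"] by auto
  next
    case False
    show ?thesis
    proof (cases "(i + L) mod n = 0")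
      case True
      with False show ?thesis using that by (intro corner) (auto simp: ball_bas_set)
    next
      case False
      then show ?thesis using that by (intro normalised_composable[OF N]) auto
    qed
  qed
  have A2_cc: "F (b A2) (b ?cc) = \<zero>" using coc[of A2 ?c ?c] c_c A2_c by (simp add: S)
  have G2_cc: "F (b G2) (b ?cc) = \<zero>" using coc[of G2 ?c ?c] c_c G2_c by (simp add: S)
  \<comment> \<open>The value is a multiple of e_(n+1); associating alpha_2 alpha_1 alpha_2 in two
    ways shows that alpha_2 annihilates it from the right.\<close>
  have A2A1: "F (b A2) (b A1) = \<zero>"
  proof -
    have "F (b A2) (b A1) \<otimes> b A2 = \<zero>" using coc[of A2 A1 A2] A1A2 A2_cc by (simp add: S)
    moreover have "co A2 (F (b A2) (b A1) \<otimes> b A2) = co EA (F (b A2) (b A1))"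
      by (rule co_right) (simp_all add: ball_bas_set b_mult co_b)
    ultimately have "co EA (F (b A2) (b A1)) = \<zero>\<^bsub>K\<^esub>" by simp
    then show ?thesis by (intro corner) (auto simp: ball_bas_set)
  qed
  have G2G1: "F (b G2) (b G1) = \<zero>"
  proof -
    have "F (b G2) (b G1) \<otimes> b G2 = \<zero>" using coc[of G2 G1 G2] G1G2' G2_cc by (simp add: S)
    moreover have "co G2 (F (b G2) (b G1) \<otimes> b G2) = co EG (F (b G2) (b G1))"
      by (rule co_right) (simp_all add: ball_bas_set b_mult co_b)
    ultimately have "co EG (F (b G2) (b G1)) = \<zero>\<^bsub>K\<^esub>" by simp
    then show ?thesis by (intro corner) (auto simp: ball_bas_set)
  qed
  have G2A1_A2: "F (b G2A1) (b A2) = \<zero>" using coc[of G2 A1 A2] A1A2 G2_cc G2A1 by (simp add: S)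
  have A2G1_G2: "F (b A2G1) (b G2) = \<zero>" using coc[of A2 G1 G2] G1G2' A2_cc A2G1 by (simp add: S)
  note comp = normalised_composable[OF N]
  show ?thesis
  proof (rule cocycle_vanishI[OF N _ _ x y])
    fix s j assume s: "s \<in> bas_set n" and j: "j < n"
    show "F (b s) (b (BP j 1)) = \<zero>"
    proof (cases "tgt n s = BP j 0")
      case True
      show ?thesis
      proof (cases s)
        case (BP i L)
        have j': "j = (i + L) mod n" using True BP by simp
        show ?thesis
        proof (cases "L = 2 * n")
          case True
          then show ?thesis using BP_b[of i] BP j' s by simp
        next
          case False
          then show ?thesis unfolding BP j' using tree_zero_path[OF F, of i L 1] s BP by simp
        qed
      qed (use True A2_b G2_b in auto)
    next
      case False
      then show ?thesis using s j n by (intro comp) auto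
    qed
  next
    fix s t assume s: "s \<in> bas_set n" and t: "t \<in> {A1, A2, G1, G2}"
    show "F (b s) (b t) = \<zero>"
    proof (cases "tgt n s = src t")
      case True
      then show ?thesis
        using t s A1A2 G1G2' A2A1 G2G1 A2G1 G2A1 A2G1_G2 G2A1_A2 BP_A1 BP_G1 normalised_idem(1)[OF N]
        by (cases s) auto
    next
      case False
      then show ?thesis using s t by (intro comp) auto
    qed
  qed
qed

section \<open>The extra correction for n = 1 and the decomposition of a cocycle\<close>

lemma cohom_tree_zero_A1:
  assumes F: "tree_zero F"
  shows "\<exists>G. cohom F G \<and> tree_zero G \<and> G (b (BP 0 n)) (b A1) = \<zero>"
proof (cases "n = 1")
  case False
  then have n: "2 \<le> n" using n_pos by simp
  have N: "normalised F" by (rule tree_zero_normalised[OF F])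
  note C = normalised_cocycle[OF N]
  have e: "1 mod n = 1" using n by simp
  \<comment> \<open>No normal form leads from vertex 2 to n + 1, so splitting off the first arrow of
    c settles the case n \<ge> 2 without any correction.\<close>
  have "F (b (BP 1 (n - 1))) (b A1) = \<zero>"
    using n by (intro normalised_corner_zero[OF N]) (auto simp: ball_bas_set)
  moreover have "F (b (BP 0 1)) (b (BP 1 (n - 1))) = \<zero>"
    using tree_zero_path[OF F, of 0 1 "n - 1"] n e by simp
  moreover have "b (BP 0 1) \<otimes> b (BP 1 (n - 1)) = b (BP 0 n)"
    using BP_mult[of 0 1 "n - 1"] n e by simp
  ultimately have "F (b (BP 0 n)) (b A1) = \<zero>"
    using cocycle_basis[OF C, of "BP 0 1" "BP 1 (n - 1)" A1] n
    by (simp add: bilin_zero[OF cocycle_bilin[OF C]] b_mult cocycle_closed[OF C])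
  then show ?thesis using F cohom_refl[OF cocycle_bilin[OF C]] by blast
next
  case n: True
  have N: "normalised F" by (rule tree_zero_normalised[OF F])
  note C = normalised_cocycle[OF N]
  note [simp] = cocycle_closed[OF C]
  define k where "k = co A1 (F (b (BP 0 1)) (b A1))"
  have k[simp]: "k \<in> carrier K" by (simp add: k_def)
  have FA1: "F (b (BP 0 1)) (b A1) = k \<odot> b A1"
  proof (rule eqI)
    fix r assume "r \<in> bas_set n"
    then show "co r (F (b (BP 0 1)) (b A1)) = co r (k \<odot> b A1)"
    proof (cases "r = A1")
      case False
      then have "src r \<noteq> BP 0 0 \<or> tgt n r \<noteq> EA" by (cases r) auto
      then show ?thesis using False normalised_support[OF N, of "BP 0 1" A1 r] n by (simp add: co_b)
    qed (simp add: k_def co_b)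
  qed simp_all
  \<comment> \<open>Taking g(beta_1) = k e_1 removes F(beta_1, alpha_1) = k alpha_1. To keep the
    value at (beta_1, beta_1) zero, g(beta_1^2) must be beta_1 g(beta_1) + g(beta_1) beta_1, which
    is k beta_1 added to itself.\<close>
  define g where "g s = (if s = BP 0 1 then k \<odot> b (BP 0 0) else if s = BP 0 2
    then k \<odot> b (BP 0 1) \<oplus> k \<odot> b (BP 0 1) else \<zero>)" for s
  have g: "g s \<in> carrier A" for s by (simp add: g_def)
  let ?g = "lin_ext g"
  have L: "lin ?g" by (rule lin_lin_ext[OF g])
  have Ng: "normalised (cobd ?g)"
  proof (rule normalised_cobd[OF g])
    fix s assume "s \<in> bas_set n"
    then show "b (src s) \<otimes> g s = g s" "g s \<otimes> b (tgt n s) = g s"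
      using n by (auto simp: g_def b_mult smult_mult_left smult_mult_right A.l_distr A.r_distr)
  qed (auto simp: idem_set_def g_def)
  have gb: "?g (b s) = (if s \<in> bas_set n then g s else \<zero>)" for s by (rule lin_ext_b[OF g])
  have vals: "?g (b (BP 0 1)) = k \<odot> b (BP 0 0)" "?g (b A1) = \<zero>"
    "?g (b (BP 0 2)) = k \<odot> b (BP 0 1) \<oplus> k \<odot> b (BP 0 1)"
    unfolding gb using n by (simp_all add: g_def)
  have prods: "b (BP 0 1) \<otimes> b (BP 0 1) = b (BP 0 2)" "b (BP 0 1) \<otimes> b (BP 0 0) = b (BP 0 1)"
    "b (BP 0 0) \<otimes> b (BP 0 1) = b (BP 0 1)" "b (BP 0 1) \<otimes> b A1 = \<zero>" "b (BP 0 0) \<otimes> b A1 = b A1"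
    using n by (simp_all add: b_mult numeral_2_eq_2)
  have tz: "tree_zero (cobd ?g)"
  proof -
    have "cobd ?g (b (BP i M)) (b (BP ((i + M) mod n) 1)) = \<zero>" if "i < n" "M < 2 * n" for i M
    proof -
      have "i = 0" "M = 0 \<or> M = 1" using that n by auto
      then show ?thesis
      proof (elim disjE)
        assume "i = 0" "M = 0"
        then show ?thesis using normalised_idem(1)[OF Ng, of "BP 0 0"] n by simp
      next
        have e: "k \<odot> b (BP 0 1) \<ominus> (k \<odot> b (BP 0 1) \<oplus> k \<odot> b (BP 0 1)) \<oplus> k \<odot> b (BP 0 1) = \<zero>"
          by (simp add: a_minus_def A.minus_add A.a_ac A.r_neg A.r_neg2 A.r_neg1)
        assume "i = 0" "M = 1"
        moreover have "(0 + 1) mod n = 0" using n by simp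
        ultimately show ?thesis using e by (simp add: cobd_def prods vals smult_mult_left smult_mult_right del: One_nat_def)
      qed
    qed
    moreover have "cobd ?g (b A2) (b G1) = \<zero>" "cobd ?g (b G2) (b A1) = \<zero>"
      by (simp_all add: cobd_def b_mult gb g_def a_minus_def)
    ultimately show ?thesis using Ng by (simp add: tree_zero_def)
  qed
  have "cobd ?g (b (BP 0 1)) (b A1) = k \<odot> b A1"
    by (simp add: cobd_def prods vals lin_zero[OF L] smult_mult_left a_minus_def del: One_nat_def)
  then have "F (b (BP 0 1)) (b A1) \<ominus> cobd ?g (b (BP 0 1)) (b A1) = \<zero>"
    using FA1 by (simp add: a_minus_def A.r_neg del: One_nat_def)
  then have "F (b (BP 0 n)) (b A1) \<ominus> cobd ?g (b (BP 0 n)) (b A1) = \<zero>"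
    using arg_cong[OF n, of "\<lambda>m. F (b (BP 0 m)) (b A1) \<ominus> cobd ?g (b (BP 0 m)) (b A1)"] by simp
  then show ?thesis using cohom_diff[OF cocycle_bilin[OF C] L] tree_zero_diff[OF F tz] by blast
qed

lemma tree_zero_defc: "tree_zero (defc q)"
proof -
  have "defc q (b v) x = \<zero>" "defc q x (b v) = \<zero>" if v: "v \<in> idem_set n" and x: "x \<in> carrier A" for v x
  proof -
    show "defc q (b v) x = \<zero>"
    proof (rule lin_eqI[OF bilinD(1)[OF bilin_defc b_closed] lin_const_zero _ x])
      fix s assume "s \<in> bas_set n"
      then show "defc q (b v) (b s) = \<zero>"
        using v by (cases s) (auto simp: idem_set_def defc_b def_val_def)
    qed
    show "defc q x (b v) = \<zero>"
    proof (rule lin_eqI[OF bilinD(2)[OF bilin_defc b_closed] lin_const_zero _ x])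
      fix s assume "s \<in> bas_set n"
      then show "defc q (b s) (b v) = \<zero>"
        using v by (cases s) (auto simp: idem_set_def defc_b def_val_def)
    qed
  qed
  then have "normalised (defc q)" by (simp add: normalised_def cocycle_defc)
  then show ?thesis by (simp add: tree_zero_def defc_b def_val_def)
qed

text \<open>\<open>H\<close> is built from the two cocycles and a coboundary so as to share with
  \<open>G\<close> the values that \<open>tree_zero_vanish\<close> asks about. Applied to the
  difference, that lemma gives G = H, so the remaining coefficients of G(gamma_1, gamma_2) agree
  automatically.\<close>

lemma cocycle_span:
  assumes F: "cocycle F"
  shows "\<exists>p\<in>carrier K. \<exists>q\<in>carrier K. \<exists>g. lin g \<and>
    (\<forall>x\<in>carrier A. \<forall>y\<in>carrier A. F x y = p \<odot> defc True x y \<oplus> q \<odot> defc False x y \<oplus> cobd g x y)"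
proof -
  obtain F1 where F1: "cohom F F1" "normalised F1" using cohom_normalised[OF F] by blast
  obtain F2 where F2: "cohom F1 F2" "tree_zero F2" using cohom_tree_zero[OF F1(2)] by blast
  obtain G where G: "cohom F2 G" and tG: "tree_zero G" and GA1: "G (b (BP 0 n)) (b A1) = \<zero>"
    using cohom_tree_zero_A1[OF F2(2)] by blast
  have N: "normalised G" by (rule tree_zero_normalised[OF tG])
  note C = normalised_cocycle[OF N]
  have FG: "cohom F G"
    using cohom_trans[OF F1(1) cohom_trans[OF F2(1) G]] cocycle_bilin[OF C] by blast
  note [simp] = cocycle_closed[OF C]
  have n: "0 < n" "n \<noteq> 0" using n_pos by auto
  let ?W = "G (b A1) (b A2)"
  define p q x2 y2 where "p = co (BP 0 0) ?W" and "q = co (BP 0 n) ?W"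
    and "x2 = co (BP 0 (2 * n)) ?W" and "y2 = co (BP 0 (2 * n)) (G (b G1) (b G2))"
  have [simp]: "p \<in> carrier K" "q \<in> carrier K" "x2 \<in> carrier K" "y2 \<in> carrier K"
    by (simp_all add: p_def q_def x2_def y2_def)
  have W: "?W = p \<odot> b (BP 0 0) \<oplus> q \<odot> b (BP 0 n) \<oplus> x2 \<odot> b (BP 0 (2 * n))"
  proof (rule eqI)
    fix r assume r: "r \<in> bas_set n"
    show "co r ?W = co r (p \<odot> b (BP 0 0) \<oplus> q \<odot> b (BP 0 n) \<oplus> x2 \<odot> b (BP 0 (2 * n)))"
    proof (cases "src r = BP 0 0 \<and> tgt n r = BP 0 0")
      case True
      then obtain L where L: "r = BP 0 L" "L mod n = 0" by (cases r) auto
      then have "L = 0 \<or> L = n \<or> L = 2 * n" using mult_mod_cases[of L n] r n_pos by simp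
      then show ?thesis unfolding L(1) using n by (auto simp: co_b p_def q_def x2_def)
    next
      case False
      then show ?thesis using normalised_support[OF N, of A1 A2 r] by (auto simp: co_b n)
    qed
  qed simp_all
  \<comment> \<open>Scaling alpha_2 by \<open>x2\<close> and gamma_2 by \<open>y2\<close> produces
    the coefficients of c^2; the values on alpha_2 gamma_1 and gamma_2 alpha_1 are scaled alike so
    that the coboundary stays zero on the tree.\<close>
  define h where "h s = (case s of A2 \<Rightarrow> x2 \<odot> b A2 | A2G1 \<Rightarrow> x2 \<odot> b A2G1 | G2 \<Rightarrow> y2 \<odot> b G2
    | G2A1 \<Rightarrow> y2 \<odot> b G2A1 | _ \<Rightarrow> \<zero>)" for s
  have h: "h s \<in> carrier A" for s by (simp add: h_def split: bas.split)
  let ?h = "lin_ext h"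
  have Lh: "lin ?h" by (rule lin_lin_ext[OF h])
  have hb: "?h (b s) = (if s \<in> bas_set n then h s else \<zero>)" for s by (rule lin_ext_b[OF h])
  have Nh: "normalised (cobd ?h)"
  proof (rule normalised_cobd[OF h])
    fix s assume "s \<in> bas_set n"
    then show "b (src s) \<otimes> h s = h s" "h s \<otimes> b (tgt n s) = h s"
      using n by (auto simp: h_def b_mult smult_mult_left smult_mult_right split: bas.split)
  qed (auto simp: idem_set_def h_def)
  have th: "tree_zero (cobd ?h)"
  proof -
    have "cobd ?h (b (BP i M)) (b (BP ((i + M) mod n) 1)) = \<zero>" if "i < n" "M < 2 * n" for i M
      unfolding cobd_def using BP_mult1[OF that] n by (simp add: hb h_def a_minus_def)
    moreover have "cobd ?h (b A2) (b G1) = \<zero>" "cobd ?h (b G2) (b A1) = \<zero>"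
      by (simp_all add: cobd_def b_mult hb h_def a_minus_def smult_mult_left A.l_neg)
    ultimately show ?thesis using Nh by (simp add: tree_zero_def)
  qed
  define H where "H x y = p \<odot> defc True x y \<oplus> q \<odot> defc False x y \<oplus> cobd ?h x y" for x y
  have tH: "tree_zero H" unfolding H_def
    by (intro tree_zero_plus tree_zero_scale tree_zero_defc th) simp_all
  have Hc: "H x y \<in> carrier A" if "x \<in> carrier A" "y \<in> carrier A" for x y
    using cocycle_closed[OF normalised_cocycle[OF tree_zero_normalised[OF tH]]] that by blast
  have HA1: "H (b (BP 0 n)) (b A1) = \<zero>"
    using n by (simp add: H_def defc_b def_val_def cobd_def b_mult hb h_def lin_zero[OF Lh] a_minus_def)
  have HA2: "H (b A1) (b A2) = ?W"
    unfolding W using n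
    by (simp add: H_def defc_b def_val_def cobd_def b_mult hb h_def smult_mult_right a_minus_def)
  have HG2: "co (BP 0 (2 * n)) (H (b G1) (b G2)) = y2"
    using n by (simp add: H_def defc_b def_val_def cobd_def b_mult hb h_def smult_mult_right a_minus_def co_b)
  have "G x y \<ominus> H x y = \<zero>" if "x \<in> carrier A" "y \<in> carrier A" for x y
    by (rule tree_zero_vanish[OF tree_zero_diff[OF tG tH] _ _ _ that])
      (simp_all add: GA1 HA1 HA2 HG2 a_minus_def A.r_neg Hc y2_def[symmetric] K.r_neg)
  then have GH: "G x y = H x y" if "x \<in> carrier A" "y \<in> carrier A" for x y
    using that by (simp add: Hc)
  obtain g where g: "lin g" "\<And>x y. x \<in> carrier A \<Longrightarrow> y \<in> carrier A \<Longrightarrow> F x y = G x y \<oplus> cobd g x y"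
    using FG unfolding cohom_def by blast
  have "F x y = p \<odot> defc True x y \<oplus> q \<odot> defc False x y \<oplus> cobd (\<lambda>x. ?h x \<oplus> g x) x y"
    if "x \<in> carrier A" "y \<in> carrier A" for x y
    using that g(2) GH bilin_closed[OF bilin_defc that] bilin_closed[OF bilin_cobd[OF g(1)] that]
      bilin_closed[OF bilin_cobd[OF Lh] that]
    by (simp add: cobd_plus[OF Lh g(1)] H_def A.a_assoc)
  then show ?thesis using lin_plus[OF Lh g(1)]
    by (intro bexI[of _ p] bexI[of _ q] exI[of _ "\<lambda>x. ?h x \<oplus> g x"]) simp_all
qed

theorem HH2_dim:
  "vectorspace K (HH K A 2) \<and> vectorspace.fin_dim K (HH K A 2) \<and> vectorspace.dim K (HH K A 2) = 2"
  by (rule HH2_dim_two[OF cocycle_defc cocycle_defc]) (use cocycle_span defc_independent in blast)+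

end

section \<open>Path algebras\<close>

text \<open>The substitution i = j + k, which matches the two ways of cutting a path into three
  pieces in the proof of associativity.\<close>

lemma (in abelian_monoid) finsum_triangle:
  fixes m :: nat
  assumes "\<And>j i. j \<le> i \<Longrightarrow> i \<le> m \<Longrightarrow> T j i \<in> carrier G"
  shows "(\<Oplus>i\<in>{..m}. \<Oplus>j\<in>{..i}. T j i) = (\<Oplus>j\<in>{..m}. \<Oplus>k\<in>{..m - j}. T j (j + k))"
  using assms
proof (induction m)
  case (Suc m)
  note T[simp] = Suc.prems
  have "(\<Oplus>j\<in>{..m}. \<Oplus>k\<in>{..Suc m - j}. T j (j + k)) =
      (\<Oplus>j\<in>{..m}. T j (Suc m) \<oplus> (\<Oplus>k\<in>{..m - j}. T j (j + k)))"
  proof (rule finsum_cong')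
    fix j assume "j \<in> {..m}"
    then have j: "Suc m - j = Suc (m - j)" "j + Suc (m - j) = Suc m" by auto
    show "(\<Oplus>k\<in>{..Suc m - j}. T j (j + k)) = T j (Suc m) \<oplus> (\<Oplus>k\<in>{..m - j}. T j (j + k))"
      unfolding j(1) using \<open>j \<in> {..m}\<close> j(2) by (subst finsum_Suc) (auto simp: Pi_def)
  qed (auto simp: Pi_def)
  also have "\<dots> = (\<Oplus>j\<in>{..m}. T j (Suc m)) \<oplus> (\<Oplus>j\<in>{..m}. \<Oplus>k\<in>{..m - j}. T j (j + k))"
    by (rule finsum_addf) (auto simp: Pi_def)
  also have "(\<Oplus>j\<in>{..m}. \<Oplus>k\<in>{..m - j}. T j (j + k)) = (\<Oplus>i\<in>{..m}. \<Oplus>j\<in>{..i}. T j i)"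
    using Suc.IH T by simp
  finally have "(\<Oplus>j\<in>{..m}. \<Oplus>k\<in>{..Suc m - j}. T j (j + k)) =
      (\<Oplus>j\<in>{..m}. T j (Suc m)) \<oplus> (\<Oplus>i\<in>{..m}. \<Oplus>j\<in>{..i}. T j i)" .
  moreover have "(\<Oplus>i\<in>{..Suc m}. \<Oplus>j\<in>{..i}. T j i) =
      (\<Oplus>j\<in>{..Suc m}. T j (Suc m)) \<oplus> (\<Oplus>i\<in>{..m}. \<Oplus>j\<in>{..i}. T j i)"
    by (rule finsum_Suc) (auto simp: Pi_def)
  moreover have "(\<Oplus>j\<in>{..Suc m}. T j (Suc m)) = T (Suc m) (Suc m) \<oplus> (\<Oplus>j\<in>{..m}. T j (Suc m))"
    by (rule finsum_Suc) (auto simp: Pi_def)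
  moreover have "(\<Oplus>j\<in>{..Suc m}. \<Oplus>k\<in>{..Suc m - j}. T j (j + k)) =
      (\<Oplus>k\<in>{..Suc m - Suc m}. T (Suc m) (Suc m + k)) \<oplus> (\<Oplus>j\<in>{..m}. \<Oplus>k\<in>{..Suc m - j}. T j (j + k))"
    by (rule finsum_Suc) (auto simp: Pi_def)
  moreover have "(\<Oplus>k\<in>{..Suc m - Suc m}. T (Suc m) (Suc m + k)) = T (Suc m) (Suc m)" by simp
  moreover have "(\<Oplus>j\<in>{..m}. T j (Suc m)) \<in> carrier G" "(\<Oplus>i\<in>{..m}. \<Oplus>j\<in>{..i}. T j i) \<in> carrier G"
    by (auto simp: Pi_def intro!: finsum_closed)
  ultimately show ?case using T[of "Suc m" "Suc m"] by (simp only: a_assoc order_refl)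
qed simp

locale path_alg = K: field K + Q: wf_digraph Q
  for K :: "('k, 'b) ring_scheme" (structure) and Q :: "('v, 'e) pre_digraph" +
  assumes finite_verts: "finite (verts Q)"
begin

abbreviation QP :: "('v \<times> 'e list) set" where "QP \<equiv> quiver_paths Q"
abbreviation KQ :: "('k, 'v \<times> 'e list \<Rightarrow> 'k) module" where "KQ \<equiv> path_algebra K Q"
abbreviation ending :: "'v \<Rightarrow> 'e list \<Rightarrow> 'v" where "ending u es \<equiv> last (pre_digraph.awalk_verts Q u es)"

lemma QP_append_iff: "(u, es @ fs) \<in> QP \<longleftrightarrow> (u, es) \<in> QP \<and> (ending u es, fs) \<in> QP"
  unfolding quiver_paths_def by (auto simp: Q.awalk_append_iff)

lemma ending_append: "ending (ending u es) fs = ending u (es @ fs)"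
  by (cases "fs = []"; cases "es = []") (auto simp: Q.awalk_verts_conv)

lemma QP_take: "(u, es) \<in> QP \<Longrightarrow> (u, take i es) \<in> QP"
  and QP_drop: "(u, es) \<in> QP \<Longrightarrow> (ending u (take i es), drop i es) \<in> QP"
  using QP_append_iff[of u "take i es" "drop i es"] by simp_all

lemma QP_nil: "(u, []) \<in> QP \<longleftrightarrow> u \<in> verts Q"
  by (auto simp: quiver_paths_def Q.awalk_Nil_iff)

lemma carrier_KQ:
  "f \<in> carrier KQ \<longleftrightarrow> f \<in> QP \<rightarrow>\<^sub>E carrier K \<and> finite {p \<in> QP. f p \<noteq> \<zero>}"
  by (simp add: path_algebra_def)

lemma KQ_closed: "f \<in> carrier KQ \<Longrightarrow> p \<in> QP \<Longrightarrow> f p \<in> carrier K"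
  by (auto simp: carrier_KQ)

lemma KQ_eqI:
  assumes "f \<in> extensional QP" "g \<in> extensional QP" "\<And>u es. (u, es) \<in> QP \<Longrightarrow> f (u, es) = g (u, es)"
  shows "f = g"
  using assms by (intro extensionalityI[of f QP g]) auto

lemma KQ_ext: "f \<in> carrier KQ \<Longrightarrow> f \<in> extensional QP"
  by (auto simp: carrier_KQ PiE_def)

lemma KQ_mult: "(u, es) \<in> QP \<Longrightarrow> (f \<otimes>\<^bsub>KQ\<^esub> g) (u, es) =
    (\<Oplus>i\<in>{..length es}. f (u, take i es) \<otimes> g (ending u (take i es), drop i es))"
  by (simp add: path_algebra_def)

lemma KQ_add: "p \<in> QP \<Longrightarrow> (f \<oplus>\<^bsub>KQ\<^esub> g) p = f p \<oplus> g p"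
  and KQ_zero: "p \<in> QP \<Longrightarrow> \<zero>\<^bsub>KQ\<^esub> p = \<zero>"
  and KQ_smult: "p \<in> QP \<Longrightarrow> (c \<odot>\<^bsub>KQ\<^esub> f) p = c \<otimes> f p"
  by (simp_all add: path_algebra_def)

lemma KQ_one: "(u, es) \<in> QP \<Longrightarrow> \<one>\<^bsub>KQ\<^esub> (u, es) = (if es = [] then \<one> else \<zero>)"
  by (simp add: path_algebra_def)

lemma KQ_extensional:
  "f \<otimes>\<^bsub>KQ\<^esub> g \<in> extensional QP" "f \<oplus>\<^bsub>KQ\<^esub> g \<in> extensional QP" "\<zero>\<^bsub>KQ\<^esub> \<in> extensional QP"
  "c \<odot>\<^bsub>KQ\<^esub> f \<in> extensional QP" "\<one>\<^bsub>KQ\<^esub> \<in> extensional QP"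
  by (simp_all add: path_algebra_def)

lemma KQ_carrierI:
  assumes "f \<in> extensional QP" "\<And>u es. (u, es) \<in> QP \<Longrightarrow> f (u, es) \<in> carrier K"
    "finite S" "\<And>u es. (u, es) \<in> QP \<Longrightarrow> (u, es) \<notin> S \<Longrightarrow> f (u, es) = \<zero>"
  shows "f \<in> carrier KQ"
proof -
  have "{p \<in> QP. f p \<noteq> \<zero>} \<subseteq> S" using assms(4) by auto
  then show ?thesis using assms finite_subset by (auto simp: carrier_KQ PiE_def Pi_def)
qed

lemma KQ_supp: "f \<in> carrier KQ \<Longrightarrow> finite {p \<in> QP. f p \<noteq> \<zero>}"
  by (simp add: carrier_KQ)

lemma KQ_mult_closed:
  assumes f: "f \<in> carrier KQ" and g: "g \<in> carrier KQ"
  shows "f \<otimes>\<^bsub>KQ\<^esub> g \<in> carrier KQ"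
\<comment> \<open>A product is supported on concatenations of paths from the two supports, a finite
  set.\<close>
proof (rule KQ_carrierI[where S = "(\<lambda>((u, es), (v, fs)). (u, es @ fs)) `
    ({p \<in> QP. f p \<noteq> \<zero>} \<times> {p \<in> QP. g p \<noteq> \<zero>})"])
  fix u es assume p: "(u, es) \<in> QP"
  note [simp] = KQ_closed[OF f QP_take[OF p]] KQ_closed[OF g QP_drop[OF p]]
  show "(f \<otimes>\<^bsub>KQ\<^esub> g) (u, es) \<in> carrier K" by (simp add: KQ_mult p)
  assume S: "(u, es) \<notin> (\<lambda>((u, es), (v, fs)). (u, es @ fs)) `
    ({p \<in> QP. f p \<noteq> \<zero>} \<times> {p \<in> QP. g p \<noteq> \<zero>})"
  have "f (u, take i es) \<otimes> g (ending u (take i es), drop i es) = \<zero>" for i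
  proof (rule ccontr)
    assume "\<not> ?thesis"
    then have "f (u, take i es) \<noteq> \<zero>" "g (ending u (take i es), drop i es) \<noteq> \<zero>" by auto
    then have "((u, take i es), (ending u (take i es), drop i es)) \<in>
        {p \<in> QP. f p \<noteq> \<zero>} \<times> {p \<in> QP. g p \<noteq> \<zero>}"
      using QP_take[OF p] QP_drop[OF p] by simp
    from imageI[OF this, of "\<lambda>((u, es), (v, fs)). (u, es @ fs)"] S show False by simp
  qed
  then show "(f \<otimes>\<^bsub>KQ\<^esub> g) (u, es) = \<zero>" by (simp add: KQ_mult p)
qed (use f g in \<open>simp_all add: KQ_extensional KQ_supp\<close>)

lemma KQ_add_closed:
  assumes f: "f \<in> carrier KQ" and g: "g \<in> carrier KQ"
  shows "f \<oplus>\<^bsub>KQ\<^esub> g \<in> carrier KQ"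
proof (rule KQ_carrierI[where S = "{p \<in> QP. f p \<noteq> \<zero>} \<union> {p \<in> QP. g p \<noteq> \<zero>}"])
qed (use f g in \<open>auto simp: KQ_extensional KQ_supp KQ_add KQ_closed\<close>)

lemma KQ_smult_closed:
  assumes f: "f \<in> carrier KQ" and c: "c \<in> carrier K"
  shows "c \<odot>\<^bsub>KQ\<^esub> f \<in> carrier KQ"
proof (rule KQ_carrierI[where S = "{p \<in> QP. f p \<noteq> \<zero>}"])
qed (use f c in \<open>auto simp: KQ_extensional KQ_supp KQ_smult KQ_closed\<close>)

lemma KQ_one_closed: "\<one>\<^bsub>KQ\<^esub> \<in> carrier KQ"
proof (rule KQ_carrierI[where S = "(\<lambda>u. (u, [])) ` verts Q"])
qed (auto simp: KQ_extensional KQ_one finite_verts QP_nil)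

lemma KQ_zero_closed: "\<zero>\<^bsub>KQ\<^esub> \<in> carrier KQ"
  by (rule KQ_carrierI[where S = "{}"]) (auto simp: KQ_extensional KQ_zero)

lemma KQ_assoc:
  assumes f: "f \<in> carrier KQ" and g: "g \<in> carrier KQ" and h: "h \<in> carrier KQ"
  shows "(f \<otimes>\<^bsub>KQ\<^esub> g) \<otimes>\<^bsub>KQ\<^esub> h = f \<otimes>\<^bsub>KQ\<^esub> (g \<otimes>\<^bsub>KQ\<^esub> h)"
proof (rule KQ_eqI[OF KQ_extensional(1) KQ_extensional(1)])
  fix u es assume p: "(u, es) \<in> QP"
  let ?m = "length es"
  \<comment> \<open>The contribution of cutting the path at positions j and i with j \<le>
    i.\<close>
  define T where "T j i = f (u, take j es) \<otimes> g (ending u (take j es), take (i - j) (drop j es))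
     \<otimes> h (ending u (take i es), drop i es)" for j i
  have fc: "f (u, take j es) \<in> carrier K" for j by (rule KQ_closed[OF f QP_take[OF p]])
  have gc: "g (ending u (take j es), take i (drop j es)) \<in> carrier K" for i j
    by (rule KQ_closed[OF g QP_take[OF QP_drop[OF p]]])
  have hc: "h (ending u (take i es), drop i es) \<in> carrier K" for i
    by (rule KQ_closed[OF h QP_drop[OF p]])
  have T: "T j i \<in> carrier K" for i j by (simp add: T_def fc gc hc)
  have "((f \<otimes>\<^bsub>KQ\<^esub> g) \<otimes>\<^bsub>KQ\<^esub> h) (u, es) = (\<Oplus>i\<in>{..?m}. \<Oplus>j\<in>{..i}. T j i)"
    unfolding KQ_mult[OF p]
  proof (rule K.finsum_cong')
    fix i assume "i \<in> {..?m}"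
    then have i: "i \<le> ?m" by simp
    have "(f \<otimes>\<^bsub>KQ\<^esub> g) (u, take i es) =
        (\<Oplus>j\<in>{..i}. f (u, take j es) \<otimes> g (ending u (take j es), take (i - j) (drop j es)))"
      unfolding KQ_mult[OF QP_take[OF p]] using i
      by (intro K.finsum_cong') (auto simp: fc gc min_def drop_take)
    then show "(f \<otimes>\<^bsub>KQ\<^esub> g) (u, take i es) \<otimes> h (ending u (take i es), drop i es) =
        (\<Oplus>j\<in>{..i}. T j i)"
      unfolding T_def by (simp add: K.finsum_ldistr fc gc hc)
  qed (auto simp: T intro!: K.finsum_closed)
  also have "\<dots> = (\<Oplus>j\<in>{..?m}. \<Oplus>k\<in>{..?m - j}. T j (j + k))"
    by (rule K.finsum_triangle) (rule T)
  also have "\<dots> = (f \<otimes>\<^bsub>KQ\<^esub> (g \<otimes>\<^bsub>KQ\<^esub> h)) (u, es)"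
    unfolding KQ_mult[OF p]
  proof (rule K.finsum_cong'[symmetric, OF refl])
    fix j assume "j \<in> {..?m}"
    then have j: "j \<le> ?m" by simp
    have "ending (ending u (take j es)) (take k (drop j es)) = ending u (take (j + k) es)" for k
      by (simp add: ending_append take_add)
    then have "(g \<otimes>\<^bsub>KQ\<^esub> h) (ending u (take j es), drop j es) =
        (\<Oplus>k\<in>{..?m - j}. g (ending u (take j es), take k (drop j es))
          \<otimes> h (ending u (take (j + k) es), drop (j + k) es))"
      unfolding KQ_mult[OF QP_drop[OF p]]
      by (intro K.finsum_cong') (auto simp: gc hc add.commute)
    then show "f (u, take j es) \<otimes> (g \<otimes>\<^bsub>KQ\<^esub> h) (ending u (take j es), drop j es) =
        (\<Oplus>k\<in>{..?m - j}. T j (j + k))"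
      unfolding T_def by (simp add: K.finsum_rdistr fc gc hc K.m_assoc)
  qed (auto simp: T intro!: K.finsum_closed)
  finally show "((f \<otimes>\<^bsub>KQ\<^esub> g) \<otimes>\<^bsub>KQ\<^esub> h) (u, es) = (f \<otimes>\<^bsub>KQ\<^esub> (g \<otimes>\<^bsub>KQ\<^esub> h)) (u, es)" .
qed

lemma abelian_group_KQ: "abelian_group KQ"
proof (rule abelian_groupI)
  fix f assume f: "f \<in> carrier KQ"
  show "\<zero>\<^bsub>KQ\<^esub> \<oplus>\<^bsub>KQ\<^esub> f = f"
    by (rule KQ_eqI) (auto simp: KQ_extensional KQ_ext[OF f] KQ_add KQ_zero KQ_closed[OF f])
  have "(\<ominus> \<one>) \<odot>\<^bsub>KQ\<^esub> f \<oplus>\<^bsub>KQ\<^esub> f = \<zero>\<^bsub>KQ\<^esub>"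
    by (rule KQ_eqI) (auto simp: KQ_extensional KQ_add KQ_zero KQ_smult KQ_closed[OF f] K.l_minus K.l_neg)
  then show "\<exists>g\<in>carrier KQ. g \<oplus>\<^bsub>KQ\<^esub> f = \<zero>\<^bsub>KQ\<^esub>" using KQ_smult_closed[OF f] by blast
next
  fix f g assume f: "f \<in> carrier KQ" and g: "g \<in> carrier KQ"
  show "f \<oplus>\<^bsub>KQ\<^esub> g = g \<oplus>\<^bsub>KQ\<^esub> f"
    by (rule KQ_eqI) (auto simp: KQ_extensional KQ_add KQ_closed[OF f] KQ_closed[OF g] K.a_comm)
  fix h assume h: "h \<in> carrier KQ"
  show "f \<oplus>\<^bsub>KQ\<^esub> g \<oplus>\<^bsub>KQ\<^esub> h = f \<oplus>\<^bsub>KQ\<^esub> (g \<oplus>\<^bsub>KQ\<^esub> h)"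
    by (rule KQ_eqI) (auto simp: KQ_extensional KQ_add KQ_closed[OF f] KQ_closed[OF g] KQ_closed[OF h] K.a_assoc)
qed (simp_all add: KQ_zero_closed KQ_add_closed)

lemma ring_KQ: "ring KQ"
proof (rule ringI)
  show "abelian_group KQ" by (rule abelian_group_KQ)
  show "Group.monoid KQ"
  proof (rule monoidI)
    fix f assume f: "f \<in> carrier KQ"
    show "\<one>\<^bsub>KQ\<^esub> \<otimes>\<^bsub>KQ\<^esub> f = f"
    proof (rule KQ_eqI[OF KQ_extensional(1) KQ_ext[OF f]])
      fix u es assume p: "(u, es) \<in> QP"
      show "(\<one>\<^bsub>KQ\<^esub> \<otimes>\<^bsub>KQ\<^esub> f) (u, es) = f (u, es)"
        unfolding KQ_mult[OF p]
        by (subst K.finsum_eq_single[of _ 0])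
          (use QP_take[OF p, of 0] in \<open>auto simp: KQ_one QP_take[OF p] KQ_closed[OF f] QP_drop[OF p] p\<close>)
    qed
    show "f \<otimes>\<^bsub>KQ\<^esub> \<one>\<^bsub>KQ\<^esub> = f"
    proof (rule KQ_eqI[OF KQ_extensional(1) KQ_ext[OF f]])
      fix u es assume p: "(u, es) \<in> QP"
      show "(f \<otimes>\<^bsub>KQ\<^esub> \<one>\<^bsub>KQ\<^esub>) (u, es) = f (u, es)"
        unfolding KQ_mult[OF p]
        by (subst K.finsum_eq_single[of _ "length es"])
          (use QP_drop[OF p, of "length es"] in
            \<open>auto simp: KQ_one QP_take[OF p] KQ_closed[OF f] QP_drop[OF p] p\<close>)
    qed
  qed (simp_all add: KQ_mult_closed KQ_one_closed KQ_assoc)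
next
  fix f g h assume f: "f \<in> carrier KQ" and g: "g \<in> carrier KQ" and h: "h \<in> carrier KQ"
  show "(f \<oplus>\<^bsub>KQ\<^esub> g) \<otimes>\<^bsub>KQ\<^esub> h = f \<otimes>\<^bsub>KQ\<^esub> h \<oplus>\<^bsub>KQ\<^esub> g \<otimes>\<^bsub>KQ\<^esub> h"
  proof (rule KQ_eqI[OF KQ_extensional(1) KQ_extensional(2)])
    fix u es assume p: "(u, es) \<in> QP"
    note [simp] = KQ_closed[OF f QP_take[OF p]] KQ_closed[OF g QP_take[OF p]] KQ_closed[OF h QP_drop[OF p]]
    show "((f \<oplus>\<^bsub>KQ\<^esub> g) \<otimes>\<^bsub>KQ\<^esub> h) (u, es) = (f \<otimes>\<^bsub>KQ\<^esub> h \<oplus>\<^bsub>KQ\<^esub> g \<otimes>\<^bsub>KQ\<^esub> h) (u, es)"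
      by (simp add: KQ_mult KQ_add p QP_take[OF p] K.l_distr K.finsum_addf)
  qed
  show "h \<otimes>\<^bsub>KQ\<^esub> (f \<oplus>\<^bsub>KQ\<^esub> g) = h \<otimes>\<^bsub>KQ\<^esub> f \<oplus>\<^bsub>KQ\<^esub> h \<otimes>\<^bsub>KQ\<^esub> g"
  proof (rule KQ_eqI[OF KQ_extensional(1) KQ_extensional(2)])
    fix u es assume p: "(u, es) \<in> QP"
    note [simp] = KQ_closed[OF f QP_drop[OF p]] KQ_closed[OF g QP_drop[OF p]] KQ_closed[OF h QP_take[OF p]]
    show "(h \<otimes>\<^bsub>KQ\<^esub> (f \<oplus>\<^bsub>KQ\<^esub> g)) (u, es) = (h \<otimes>\<^bsub>KQ\<^esub> f \<oplus>\<^bsub>KQ\<^esub> h \<otimes>\<^bsub>KQ\<^esub> g) (u, es)"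
      by (simp add: KQ_mult KQ_add p QP_drop[OF p] K.r_distr K.finsum_addf)
  qed
qed

lemma k_algebra_KQ: "k_algebra K KQ"
proof -
  interpret ring KQ by (rule ring_KQ)
  show ?thesis
  proof
    fix c x y assume c: "c \<in> carrier K" and x: "x \<in> carrier KQ" and y: "y \<in> carrier KQ"
    show "(c \<odot>\<^bsub>KQ\<^esub> x) \<otimes>\<^bsub>KQ\<^esub> y = c \<odot>\<^bsub>KQ\<^esub> (x \<otimes>\<^bsub>KQ\<^esub> y)"
    proof (rule KQ_eqI[OF KQ_extensional(1) KQ_extensional(4)])
      fix u es assume p: "(u, es) \<in> QP"
      note [simp] = KQ_closed[OF x QP_take[OF p]] KQ_closed[OF y QP_drop[OF p]] c
      show "((c \<odot>\<^bsub>KQ\<^esub> x) \<otimes>\<^bsub>KQ\<^esub> y) (u, es) = (c \<odot>\<^bsub>KQ\<^esub> (x \<otimes>\<^bsub>KQ\<^esub> y)) (u, es)"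
        by (simp add: KQ_mult KQ_smult p QP_take[OF p] K.finsum_rdistr K.m_assoc)
    qed
    show "x \<otimes>\<^bsub>KQ\<^esub> (c \<odot>\<^bsub>KQ\<^esub> y) = c \<odot>\<^bsub>KQ\<^esub> (x \<otimes>\<^bsub>KQ\<^esub> y)"
    proof (rule KQ_eqI[OF KQ_extensional(1) KQ_extensional(4)])
      fix u es assume p: "(u, es) \<in> QP"
      note [simp] = KQ_closed[OF x QP_take[OF p]] KQ_closed[OF y QP_drop[OF p]] c
      show "(x \<otimes>\<^bsub>KQ\<^esub> (c \<odot>\<^bsub>KQ\<^esub> y)) (u, es) = (c \<odot>\<^bsub>KQ\<^esub> (x \<otimes>\<^bsub>KQ\<^esub> y)) (u, es)"
        by (simp add: KQ_mult KQ_smult p QP_drop[OF p] K.finsum_rdistr K.m_lcomm)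
    qed
  next
    fix c d x y assume c: "c \<in> carrier K" and d: "d \<in> carrier K" and x: "x \<in> carrier KQ"
    show "(c \<oplus> d) \<odot>\<^bsub>KQ\<^esub> x = c \<odot>\<^bsub>KQ\<^esub> x \<oplus>\<^bsub>KQ\<^esub> d \<odot>\<^bsub>KQ\<^esub> x"
      by (rule KQ_eqI) (auto simp: KQ_extensional KQ_add KQ_smult c d KQ_closed[OF x] K.l_distr)
    show "(c \<otimes> d) \<odot>\<^bsub>KQ\<^esub> x = c \<odot>\<^bsub>KQ\<^esub> (d \<odot>\<^bsub>KQ\<^esub> x)"
      by (rule KQ_eqI) (auto simp: KQ_extensional KQ_smult c d KQ_closed[OF x] K.m_assoc)
  next
    fix c x y assume c: "c \<in> carrier K" and x: "x \<in> carrier KQ" and y: "y \<in> carrier KQ"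
    show "c \<odot>\<^bsub>KQ\<^esub> (x \<oplus>\<^bsub>KQ\<^esub> y) = c \<odot>\<^bsub>KQ\<^esub> x \<oplus>\<^bsub>KQ\<^esub> c \<odot>\<^bsub>KQ\<^esub> y"
      by (rule KQ_eqI) (auto simp: KQ_extensional KQ_add KQ_smult c KQ_closed[OF x] KQ_closed[OF y] K.r_distr)
  next
    fix x assume x: "x \<in> carrier KQ"
    show "\<one> \<odot>\<^bsub>KQ\<^esub> x = x"
      by (rule KQ_eqI) (auto simp: KQ_extensional KQ_ext[OF x] KQ_smult KQ_closed[OF x])
  qed (simp_all add: KQ_smult_closed)
qed

section \<open>The paths as a basis of the path algebra\<close>

lemma path_elem_apply: "q \<in> QP \<Longrightarrow> path_elem K Q p q = (if q = p then \<one> else \<zero>)"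
  by (simp add: path_elem_def)

lemma path_elem_closed: "path_elem K Q p \<in> carrier KQ"
  by (rule KQ_carrierI[where S = "{p}"]) (auto simp: path_elem_def)

lemma path_elem_mult:
  assumes p: "(u, es) \<in> QP" and q: "(v, fs) \<in> QP"
  shows "path_elem K Q (u, es) \<otimes>\<^bsub>KQ\<^esub> path_elem K Q (v, fs) =
    (if v = ending u es then path_elem K Q (u, es @ fs) else \<zero>\<^bsub>KQ\<^esub>)"
proof (rule KQ_eqI[OF KQ_extensional(1)])
  show "(if v = ending u es then path_elem K Q (u, es @ fs) else \<zero>\<^bsub>KQ\<^esub>) \<in> extensional QP"
    by (simp add: KQ_extensional path_elem_def)
  fix a gs assume r: "(a, gs) \<in> QP"
  let ?T = "\<lambda>i. path_elem K Q (u, es) (a, take i gs) \<otimes>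
    path_elem K Q (v, fs) (ending a (take i gs), drop i gs)"
  have T: "?T i = (if a = u \<and> take i gs = es \<and> ending a (take i gs) = v \<and> drop i gs = fs then \<one> else \<zero>)" for i
    using QP_take[OF r, of i] QP_drop[OF r, of i] by (auto simp: path_elem_apply)
  show "(path_elem K Q (u, es) \<otimes>\<^bsub>KQ\<^esub> path_elem K Q (v, fs)) (a, gs) =
      (if v = ending u es then path_elem K Q (u, es @ fs) else \<zero>\<^bsub>KQ\<^esub>) (a, gs)"
  proof (cases "a = u \<and> gs = es @ fs \<and> v = ending u es")
    case True
    have T1: "?T (length es) = \<one>" unfolding T using True by simp
    have "(\<Oplus>i\<in>{..length gs}. ?T i) = ?T (length es)"
    proof (rule K.finsum_eq_single)
      fix i assume i: "i \<in> {..length gs}" "i \<noteq> length es"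
      then have "length (take i gs) \<noteq> length es" by simp
      then have "take i gs \<noteq> es" by metis
      then show "?T i = \<zero>" unfolding T by simp
    next
      show "?T (length es) \<in> carrier K" unfolding T1 by simp
    qed (use True in simp_all)
    then have "(path_elem K Q (u, es) \<otimes>\<^bsub>KQ\<^esub> path_elem K Q (v, fs)) (a, gs) = \<one>"
      unfolding KQ_mult[OF r] T1 .
    then show ?thesis using True r by (simp add: path_elem_apply)
  next
    case False
    have "?T i = \<zero>" for i unfolding T using False append_take_drop_id[of i gs] by auto
    then have "(path_elem K Q (u, es) \<otimes>\<^bsub>KQ\<^esub> path_elem K Q (v, fs)) (a, gs) = \<zero>"
      unfolding KQ_mult[OF r] by simp
    then show ?thesis using False r by (auto simp: path_elem_apply KQ_zero)
  qed
qed

text \<open>Induction on a finite set containing the support: the term at one path is split off, and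
  the rest is supported on the smaller set.\<close>

lemma path_span_induct:
  assumes zero: "P \<zero>\<^bsub>KQ\<^esub>"
    and add: "\<And>x y. x \<in> carrier KQ \<Longrightarrow> y \<in> carrier KQ \<Longrightarrow> P x \<Longrightarrow> P y \<Longrightarrow> P (x \<oplus>\<^bsub>KQ\<^esub> y)"
    and smult: "\<And>c p. c \<in> carrier K \<Longrightarrow> p \<in> QP \<Longrightarrow> P (c \<odot>\<^bsub>KQ\<^esub> path_elem K Q p)"
    and x: "x \<in> carrier KQ"
  shows "P x"
proof -
  have "finite S \<Longrightarrow> \<forall>x\<in>carrier KQ. {p \<in> QP. x p \<noteq> \<zero>} \<subseteq> S \<longrightarrow> P x" for S
  proof (induction S rule: finite_induct)
    case empty
    have "x = \<zero>\<^bsub>KQ\<^esub>" if "x \<in> carrier KQ" "{p \<in> QP. x p \<noteq> \<zero>} \<subseteq> {}" for x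
      using that by (intro KQ_eqI) (auto simp: KQ_ext KQ_extensional KQ_zero)
    then show ?case using zero by blast
  next
    case (insert p S)
    show ?case
    proof (intro ballI impI)
      fix x assume x: "x \<in> carrier KQ" and S: "{q \<in> QP. x q \<noteq> \<zero>} \<subseteq> insert p S"
      show "P x"
      proof (cases "p \<in> QP")
        case False
        then have "{q \<in> QP. x q \<noteq> \<zero>} \<subseteq> S" using S by auto
        then show ?thesis using insert.IH x by blast
      next
        case p: True
        define y where "y = (\<lambda>q\<in>QP. if q = p then \<zero> else x q)"
        have y: "y \<in> carrier KQ"
          by (rule KQ_carrierI[where S = "{q \<in> QP. x q \<noteq> \<zero>}"])
            (auto simp: y_def KQ_supp[OF x] KQ_closed[OF x])
        have "{q \<in> QP. y q \<noteq> \<zero>} \<subseteq> S" using S by (auto simp: y_def)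
        then have Py: "P y" using insert.IH y by blast
        have "x = y \<oplus>\<^bsub>KQ\<^esub> x p \<odot>\<^bsub>KQ\<^esub> path_elem K Q p"
          by (rule KQ_eqI[OF KQ_ext[OF x] KQ_extensional(2)])
            (use x p in \<open>auto simp: KQ_add KQ_smult path_elem_apply y_def KQ_closed\<close>)
        then show ?thesis
          using add[OF y KQ_smult_closed[OF path_elem_closed KQ_closed[OF x p]] Py smult[OF KQ_closed[OF x p] p]]
          by simp
      qed
    qed
  qed
  then show ?thesis using KQ_supp[OF x] x by blast
qed

end

section \<open>Quotients of algebras by two-sided ideals\<close>

locale k_algebra_quotient = k_algebra K A + ideal I A
  for K :: "('k, 'b) ring_scheme" and A :: "('k, 'a, 'm) module_scheme" (structure) and I
begin

sublocale MQ: module_quotient K A I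
proof (intro module_quotient.intro module_quotient_axioms.intro)
  show "module K A" by (rule M.module_axioms)
next
  show "subgroup I (add_monoid A)" by (rule a_subgroup)
  fix c x assume c: "c \<in> carrier K" and x: "x \<in> I"
  then have xc: "x \<in> carrier A" by simp
  \<comment> \<open>A scalar acts as multiplication by a ring element, so an ideal of the ring is
    closed under scalars.\<close>
  have "c \<odot> x = (c \<odot> \<one>) \<otimes> x" using smult_mult_left[OF c A.one_closed xc] xc by simp
  then show "c \<odot> x \<in> I" using I_l_closed[OF x, of "c \<odot> \<one>"] c by simp
qed

abbreviation AQ where "AQ \<equiv> quotient_module A I"
abbreviation cls where "cls x \<equiv> I +> x"

lemma cls_mult:
  assumes "x \<in> carrier A" "y \<in> carrier A"
  shows "cls x \<otimes>\<^bsub>AQ\<^esub> cls y = cls (x \<otimes> y)"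
  using rcoset_mult_add[OF assms]
  by (simp add: quotient_module_def FactRing_def ring.extend_def ring.fields_def module.fields_def monoid.defs ring.defs)

lemma cls_one: "\<one>\<^bsub>AQ\<^esub> = cls \<one>"
  by (simp add: quotient_module_def FactRing_def ring.extend_def ring.fields_def module.fields_def monoid.defs ring.defs)

lemma cls_zero: "\<zero>\<^bsub>AQ\<^esub> = cls \<zero>"
  using MQ.coset_eq_self_iff[of \<zero>] additive_subgroup.zero_closed[OF is_additive_subgroup]
  by (simp add: MQ.quotient_simps)

lemma k_algebra_quotient: "k_algebra K AQ"
proof -
  interpret Q: module K AQ by (rule MQ.module_quotient_module)
  have "ring AQ"
  proof (rule ringI)
    show "abelian_group AQ" by (rule Q.M.abelian_group_axioms)
    show "Group.monoid AQ"
      by (rule monoidI)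
        (auto elim!: MQ.quotient_carrierE simp: cls_mult cls_one MQ.coset_closed A.m_assoc)
  qed (auto elim!: MQ.quotient_carrierE simp: cls_mult MQ.quotient_add A.l_distr A.r_distr)
  then interpret R: ring AQ .
  show ?thesis
    by unfold_locales
      (auto elim!: MQ.quotient_carrierE simp: cls_mult MQ.quotient_smult smult_mult_left smult_mult_right)
qed

end

section \<open>The normal form basis of \<open>\<Gamma>\<^sup>*(n)\<close>\<close>

text \<open>The start is counted from 0, so that the path ends at position
  \<open>(i + L) mod n\<close>; adding 1 returns to the numbering of the arrows.\<close>

definition beta_word :: "nat \<Rightarrow> nat \<Rightarrow> nat \<Rightarrow> arrow list" where
  "beta_word n i L = map (\<lambda>k. Beta ((i + k) mod n + 1)) [0..<L]"

definition path_of :: "nat \<Rightarrow> bas \<Rightarrow> nat \<times> arrow list" where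
  "path_of n s = (case s of BP i L \<Rightarrow> (i + 1, beta_word n i L) | EA \<Rightarrow> (n + 1, []) | EG \<Rightarrow> (n + 2, [])
    | A1 \<Rightarrow> (1, [Alpha1]) | A2 \<Rightarrow> (n + 1, [Alpha2]) | G1 \<Rightarrow> (1, [Gamma1]) | G2 \<Rightarrow> (n + 2, [Gamma2])
    | A2G1 \<Rightarrow> (n + 1, [Alpha2, Gamma1]) | G2A1 \<Rightarrow> (n + 2, [Gamma2, Alpha1]))"

definition bas_of :: "arrow \<Rightarrow> bas" where
  "bas_of a = (case a of Beta j \<Rightarrow> BP (j - 1) 1 | Alpha1 \<Rightarrow> A1 | Alpha2 \<Rightarrow> A2 | Gamma1 \<Rightarrow> G1 | Gamma2 \<Rightarrow> G2)"

lemma path_of_simps [simp]: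
  "path_of n (BP i L) = (i + 1, beta_word n i L)" "path_of n EA = (n + 1, [])" "path_of n EG = (n + 2, [])"
  "path_of n A1 = (1, [Alpha1])" "path_of n A2 = (n + 1, [Alpha2])" "path_of n G1 = (1, [Gamma1])"
  "path_of n G2 = (n + 2, [Gamma2])" "path_of n A2G1 = (n + 1, [Alpha2, Gamma1])"
  "path_of n G2A1 = (n + 2, [Gamma2, Alpha1])"
  by (simp_all add: path_of_def)

lemma length_beta_word [simp]: "length (beta_word n i L) = L"
  by (simp add: beta_word_def)

lemma beta_word_0 [simp]: "beta_word n i 0 = []"
  by (simp add: beta_word_def)

lemma beta_word_Suc: "beta_word n i (Suc L) = beta_word n i L @ [Beta ((i + L) mod n + 1)]"
  by (simp add: beta_word_def)

lemma beta_word_append: "beta_word n i L @ beta_word n ((i + L) mod n) M = beta_word n i (L + M)"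
  by (induction M) (simp_all add: beta_word_Suc mod_simps add.assoc flip: append_assoc)

lemma take_beta_word: "k \<le> L \<Longrightarrow> take k (beta_word n i L) = beta_word n i k"
  using beta_word_append[of n i k "L - k"] by (metis append_eq_conv_conj le_add_diff_inverse length_beta_word)

lemma drop_beta_word: "k \<le> L \<Longrightarrow> drop k (beta_word n i L) = beta_word n ((i + k) mod n) (L - k)"
  using beta_word_append[of n i k "L - k"] by (metis append_eq_conv_conj le_add_diff_inverse length_beta_word)

lemma betas_eq_beta_word: "i + m \<le> n \<Longrightarrow> betas (i + 1) (i + m) = beta_word n i m"
  by (rule nth_equalityI) (auto simp: betas_def beta_word_def simp del: upt_Suc)

lemma beta_word_not_alpha [simp]:
  "beta_word n i L \<noteq> Alpha1 # es" "beta_word n i L \<noteq> Alpha2 # es"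
  "beta_word n i L \<noteq> Gamma1 # es" "beta_word n i L \<noteq> Gamma2 # es"
  "Alpha1 # es \<noteq> beta_word n i L" "Alpha2 # es \<noteq> beta_word n i L"
  "Gamma1 # es \<noteq> beta_word n i L" "Gamma2 # es \<noteq> beta_word n i L"
  by (cases L; auto simp: beta_word_def upt_conv_Cons simp del: upt_Suc)+

lemma beta_word_eq_Nil [simp]: "beta_word n i L = [] \<longleftrightarrow> L = 0" "[] = beta_word n i L \<longleftrightarrow> L = 0"
  by (auto simp: beta_word_def)

lemma quiver_Q_simps [simp]:
  "verts (quiver_Q n) = {1..n + 2}" "tail (quiver_Q n) = arrow_source n" "head (quiver_Q n) = arrow_target n"
  "arcs (quiver_Q n) = Beta ` {1..n} \<union> {Alpha1, Alpha2, Gamma1, Gamma2}"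
  by (simp_all add: quiver_Q_def)

locale gamma_path = path_alg K "quiver_Q n" for K :: "('k, 'b) ring_scheme" (structure) and n :: nat +
  assumes n_pos: "n \<ge> 1"

lemma gamma_pathI:
  assumes "field K" "n \<ge> 1"
  shows "gamma_path K n"
proof -
  interpret field K by fact
  show ?thesis
    using assms(2) by unfold_locales auto
qed

context gamma_path
begin

abbreviation PE :: "nat \<times> arrow list \<Rightarrow> nat \<times> arrow list \<Rightarrow> 'k" where "PE p \<equiv> path_elem K (quiver_Q n) p"

lemma ending_simp: "ending u es = (if es = [] then u else arrow_target n (last es))"
  by (simp add: Q.awalk_verts_conv)

lemma QP_Cons: "(u, e # es) \<in> QP \<longleftrightarrow> e \<in> arcs (quiver_Q n) \<and> u = arrow_source n e \<and> (arrow_target n e, es) \<in> QP"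
  by (auto simp: quiver_paths_def Q.awalk_Cons_iff)

lemma beta_word_path:
  assumes "i < n"
  shows "(i + 1, beta_word n i L) \<in> QP \<and> ending (i + 1) (beta_word n i L) = (i + L) mod n + 1"
proof (induction L)
  case 0
  then show ?case using assms by (simp add: QP_nil ending_simp)
next
  case (Suc L)
  let ?j = "(i + L) mod n"
  have j: "?j < n" using n_pos by simp
  have t: "arrow_target n (Beta (?j + 1)) = (i + Suc L) mod n + 1"
    using j by (simp add: mod_Suc)
  moreover have "(?j + 1, [Beta (?j + 1)]) \<in> QP"
    using j n_pos by (auto simp: QP_Cons QP_nil Suc_le_eq less_SucI)
  ultimately show ?case
    using Suc by (simp add: beta_word_Suc QP_append_iff) (simp add: ending_simp)
qed

lemma path_of_QP: "s \<in> bas_set n \<Longrightarrow> path_of n s \<in> QP"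
  using beta_word_path n_pos by (cases s) (auto simp: QP_Cons QP_nil)

lemma ending_path_of:
  "s \<in> bas_set n \<Longrightarrow> ending (fst (path_of n s)) (snd (path_of n s)) = fst (path_of n (tgt n s))"
  using beta_word_path by (cases s) (auto simp: ending_simp[of _ "_ # _"] ending_simp[of _ "[]"])

section \<open>Coefficient functionals on the path algebra and their common kernel\<close>

abbreviation cc :: "nat \<times> arrow list" where "cc \<equiv> (1, beta_word n 0 (2 * n))"

definition path_coeff :: "bas \<Rightarrow> (nat \<times> arrow list \<Rightarrow> 'k) \<Rightarrow> 'k" where
  "path_coeff s x = (if s = BP 0 (2 * n) then x cc \<oplus> (x (1, [Alpha1, Alpha2]) \<oplus> x (1, [Gamma1, Gamma2]))
    else x (path_of n s))"

definition path_coeff_ideal :: "(nat \<times> arrow list \<Rightarrow> 'k) set" where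
  "path_coeff_ideal = {x \<in> carrier KQ. \<forall>s\<in>bas_set n. path_coeff s x = \<zero>}"

lemma cc_QP: "cc \<in> QP" "(1, [Alpha1, Alpha2]) \<in> QP" "(1, [Gamma1, Gamma2]) \<in> QP"
  using beta_word_path[of 0] n_pos by (auto simp: QP_Cons QP_nil)

lemma path_coeff_add:
  assumes s: "s \<in> bas_set n" and x: "x \<in> carrier KQ" and y: "y \<in> carrier KQ"
  shows "path_coeff s (x \<oplus>\<^bsub>KQ\<^esub> y) = path_coeff s x \<oplus> path_coeff s y"
  using cc_QP path_of_QP[OF s] KQ_closed[OF x] KQ_closed[OF y]
  by (simp add: path_coeff_def KQ_add K.a_ac)

lemma path_coeff_smult:
  assumes s: "s \<in> bas_set n" and x: "x \<in> carrier KQ" and c: "c \<in> carrier K"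
  shows "path_coeff s (c \<odot>\<^bsub>KQ\<^esub> x) = c \<otimes> path_coeff s x"
  using cc_QP path_of_QP[OF s] KQ_closed[OF x] c
  by (simp add: path_coeff_def KQ_smult K.r_distr)

lemma path_coeff_closed:
  assumes s: "s \<in> bas_set n" and x: "x \<in> carrier KQ"
  shows "path_coeff s x \<in> carrier K"
  using cc_QP path_of_QP[OF s] KQ_closed[OF x] by (simp add: path_coeff_def)

lemma mult_single:
  assumes x: "x \<in> carrier KQ" and y: "y \<in> carrier KQ" and p: "(u, es) \<in> QP" and w: "w \<le> length es"
    and zero: "\<And>i. \<lbrakk>i \<le> length es; i \<noteq> w\<rbrakk> \<Longrightarrow>
      x (u, take i es) = \<zero> \<or> y (ending u (take i es), drop i es) = \<zero>"
  shows "(x \<otimes>\<^bsub>KQ\<^esub> y) (u, es) = x (u, take w es) \<otimes> y (ending u (take w es), drop w es)"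
proof -
  note c = KQ_closed[OF x QP_take[OF p]] KQ_closed[OF y QP_drop[OF p]]
  show ?thesis
    unfolding KQ_mult[OF p]
  proof (rule K.finsum_eq_single)
    fix i assume i: "i \<in> {..length es}" "i \<noteq> w"
    then show "x (u, take i es) \<otimes> y (ending u (take i es), drop i es) = \<zero>"
      using zero[of i] c[of i] by auto
  qed (use w c in auto)
qed

lemma path_coeff_ideal_path_zero:
  assumes "y \<in> path_coeff_ideal" "s \<in> bas_set n" "s \<noteq> BP 0 (2 * n)"
  shows "y (path_of n s) = \<zero>"
  using assms by (auto simp: path_coeff_ideal_def path_coeff_def)

text \<open>Proper initial and terminal parts of the paths that contribute to some coefficient belong to the basis.\<close>

lemma path_coeff_ideal_suffix:
  assumes y: "y \<in> path_coeff_ideal"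
    and p: "(u, es) \<in> insert (1, [Alpha1, Alpha2]) (insert (1, [Gamma1, Gamma2]) (path_of n ` bas_set n))"
    and i: "i \<le> length es" "0 < i"
  shows "y (ending u (take i es), drop i es) = \<zero>"
proof -
  note Z = path_coeff_ideal_path_zero[OF y]
  have n: "0 < n" using n_pos by simp
  note z = Z[of EA] Z[of EG] Z[of A1] Z[of A2] Z[of G1] Z[of G2] Z[of A2G1] Z[of G2A1] Z[of "BP 0 0"]
  have path: ?thesis if "u = j + 1" "es = beta_word n j L" "j < n" "L \<le> 2 * n" for j L
  proof -
    have "i \<le> L" "L - i \<noteq> 2 * n" using that i n by auto
    then show ?thesis
      using that i Z[of "BP ((j + i) mod n) (L - i)"] beta_word_path[of j] n
      by (simp add: take_beta_word drop_beta_word)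
  qed
  show ?thesis
    using p
  proof (elim insertE imageE)
    fix s assume s: "(u, es) = path_of n s" "s \<in> bas_set n"
    show ?thesis
    proof (cases s)
      case (BP j L)
      then show ?thesis using s by (intro path[of j L]) auto
    qed (use s i z n in \<open>auto simp: le_Suc_eq ending_simp\<close>)
  qed (use i z n in \<open>auto simp: le_Suc_eq ending_simp\<close>)
qed

lemma path_coeff_ideal_prefix:
  assumes y: "y \<in> path_coeff_ideal"
    and p: "(u, es) \<in> insert (1, [Alpha1, Alpha2]) (insert (1, [Gamma1, Gamma2]) (path_of n ` bas_set n))"
    and i: "i < length es"
  shows "y (u, take i es) = \<zero>"
proof -
  note Z = path_coeff_ideal_path_zero[OF y]
  have n: "0 < n" using n_pos by simp
  note z = Z[of EA] Z[of EG] Z[of A1] Z[of A2] Z[of G1] Z[of G2] Z[of A2G1] Z[of G2A1] Z[of "BP 0 0"]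
  have path: ?thesis if "u = j + 1" "es = beta_word n j L" "j < n" "L \<le> 2 * n" for j L
    using that i Z[of "BP j i"] n by (simp add: take_beta_word)
  show ?thesis
    using p
  proof (elim insertE imageE)
    fix s assume s: "(u, es) = path_of n s" "s \<in> bas_set n"
    show ?thesis
    proof (cases s)
      case (BP j L)
      then show ?thesis using s by (intro path[of j L]) auto
    qed (use s i z n in \<open>auto simp: less_Suc_eq\<close>)
  qed (use i z n in \<open>auto simp: less_Suc_eq\<close>)
qed

lemma cc_mem: "cc \<in> path_of n ` bas_set n"
  using n_pos by (intro image_eqI[of _ _ "BP 0 (2 * n)"]) auto

text \<open>As \<open>y\<close> vanishes on proper terminal parts, only the cut at 0 survives in the
  product. In the functional of c^2 all three paths start at vertex 1, so the same factor x(e_1)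
  comes out of the sum.\<close>

lemma path_coeff_ideal_l_closed:
  assumes x: "x \<in> carrier KQ" and y: "y \<in> path_coeff_ideal"
  shows "x \<otimes>\<^bsub>KQ\<^esub> y \<in> path_coeff_ideal"
proof -
  have yc: "y \<in> carrier KQ" using y by (simp add: path_coeff_ideal_def)
  have mult: "(x \<otimes>\<^bsub>KQ\<^esub> y) (u, es) = x (u, []) \<otimes> y (u, es)"
    if p: "(u, es) \<in> insert (1, [Alpha1, Alpha2]) (insert (1, [Gamma1, Gamma2]) (path_of n ` bas_set n))"
    for u es
  proof -
    have "(u, es) \<in> QP" using p cc_QP path_of_QP by auto
    from mult_single[OF x yc this, of 0] path_coeff_ideal_suffix[OF y p] show ?thesis by simp
  qed
  have x1: "x (1, []) \<in> carrier K" using KQ_closed[OF x, of "(1, [])"] n_pos by (simp add: QP_nil)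
  have ycl: "y cc \<in> carrier K" "y (1, [Alpha1, Alpha2]) \<in> carrier K" "y (1, [Gamma1, Gamma2]) \<in> carrier K"
    using KQ_closed[OF yc] cc_QP by auto
  have ysum: "y cc \<oplus> (y (1, [Alpha1, Alpha2]) \<oplus> y (1, [Gamma1, Gamma2])) = \<zero>"
    using y n_pos by (auto simp: path_coeff_ideal_def path_coeff_def dest!: bspec[of _ _ "BP 0 (2 * n)"])
  have "path_coeff s (x \<otimes>\<^bsub>KQ\<^esub> y) = \<zero>" if s: "s \<in> bas_set n" for s
  proof (cases "s = BP 0 (2 * n)")
    case True
    have "path_coeff s (x \<otimes>\<^bsub>KQ\<^esub> y) = x (1, []) \<otimes> (y cc \<oplus> (y (1, [Alpha1, Alpha2]) \<oplus> y (1, [Gamma1, Gamma2])))"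
      using mult[of 1 "beta_word n 0 (2 * n)"] mult[of 1 "[Alpha1, Alpha2]"] mult[of 1 "[Gamma1, Gamma2]"] cc_mem
        x1 ycl by (simp add: path_coeff_def True K.r_distr)
    then show ?thesis unfolding ysum using x1 by simp
  next
    case False
    obtain u es where p: "path_of n s = (u, es)" by fastforce
    then have mem: "(u, es) \<in> path_of n ` bas_set n" using s by (metis image_eqI)
    have "(u, []) \<in> QP" using path_of_QP[OF s] QP_take[of u es 0] p by simp
    then show ?thesis
      using mult[of u es] path_coeff_ideal_path_zero[OF y s False] s False p KQ_closed[OF x, of "(u, [])"]
      by (simp add: path_coeff_def mem)
  qed
  then show ?thesis using KQ_mult_closed[OF x yc] by (simp add: path_coeff_ideal_def)
qed

text \<open>The mirror image: only the cut at the end survives, and the three paths in the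
  functional of c^2 share the end vertex 1.\<close>

lemma path_coeff_ideal_r_closed:
  assumes x: "x \<in> carrier KQ" and y: "y \<in> path_coeff_ideal"
  shows "y \<otimes>\<^bsub>KQ\<^esub> x \<in> path_coeff_ideal"
proof -
  have yc: "y \<in> carrier KQ" using y by (simp add: path_coeff_ideal_def)
  have mult: "(y \<otimes>\<^bsub>KQ\<^esub> x) (u, es) = y (u, es) \<otimes> x (ending u es, [])"
    if p: "(u, es) \<in> insert (1, [Alpha1, Alpha2]) (insert (1, [Gamma1, Gamma2]) (path_of n ` bas_set n))"
    for u es
  proof -
    have "(u, es) \<in> QP" using p cc_QP path_of_QP by auto
    from mult_single[OF yc x this, of "length es"] path_coeff_ideal_prefix[OF y p] show ?thesis by simp
  qed
  have x1: "x (1, []) \<in> carrier K" using KQ_closed[OF x, of "(1, [])"] n_pos by (simp add: QP_nil)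
  have ycl: "y cc \<in> carrier K" "y (1, [Alpha1, Alpha2]) \<in> carrier K" "y (1, [Gamma1, Gamma2]) \<in> carrier K"
    using KQ_closed[OF yc] cc_QP by auto
  have ysum: "y cc \<oplus> (y (1, [Alpha1, Alpha2]) \<oplus> y (1, [Gamma1, Gamma2])) = \<zero>"
    using y n_pos by (auto simp: path_coeff_ideal_def path_coeff_def dest!: bspec[of _ _ "BP 0 (2 * n)"])
  have e: "ending 1 (beta_word n 0 (2 * n)) = 1" "ending 1 [Alpha1, Alpha2] = 1" "ending 1 [Gamma1, Gamma2] = 1"
    using beta_word_path[of 0 "2 * n"] n_pos by (auto simp: ending_simp[of _ "_ # _"])
  have "path_coeff s (y \<otimes>\<^bsub>KQ\<^esub> x) = \<zero>" if s: "s \<in> bas_set n" for s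
  proof (cases "s = BP 0 (2 * n)")
    case True
    have "path_coeff s (y \<otimes>\<^bsub>KQ\<^esub> x) = (y cc \<oplus> (y (1, [Alpha1, Alpha2]) \<oplus> y (1, [Gamma1, Gamma2]))) \<otimes> x (1, [])"
      using mult[of 1 "beta_word n 0 (2 * n)"] mult[of 1 "[Alpha1, Alpha2]"] mult[of 1 "[Gamma1, Gamma2]"] cc_mem
        x1 ycl unfolding e by (simp add: path_coeff_def True K.l_distr)
    then show ?thesis unfolding ysum using x1 by simp
  next
    case False
    obtain u es where p: "path_of n s = (u, es)" by fastforce
    then have mem: "(u, es) \<in> path_of n ` bas_set n" using s by (metis image_eqI)
    have "(ending u es, []) \<in> QP" using path_of_QP[OF s] QP_drop[of u es "length es"] p by simp
    then show ?thesis
      using mult[of u es] path_coeff_ideal_path_zero[OF y s False] s False p KQ_closed[OF x, of "(ending u es, [])"]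
      by (simp add: path_coeff_def mem)
  qed
  then show ?thesis using KQ_mult_closed[OF yc x] by (simp add: path_coeff_ideal_def)
qed

lemma ideal_coeff_ideal: "ideal path_coeff_ideal KQ"
proof (rule idealI[OF ring_KQ _ path_coeff_ideal_l_closed path_coeff_ideal_r_closed])
  interpret R: ring KQ by (rule ring_KQ)
  interpret KA: k_algebra K KQ by (rule k_algebra_KQ)
  show "subgroup path_coeff_ideal (add_monoid KQ)"
  proof (rule R.add.subgroupI)
    have "path_coeff s \<zero>\<^bsub>KQ\<^esub> = \<zero>" if "s \<in> bas_set n" for s
      using cc_QP path_of_QP[OF that] by (simp add: path_coeff_def KQ_zero)
    then have "\<zero>\<^bsub>KQ\<^esub> \<in> path_coeff_ideal" by (simp add: path_coeff_ideal_def)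
    then show "path_coeff_ideal \<noteq> {}" by blast
    fix x assume x: "x \<in> path_coeff_ideal"
    then have "(\<ominus>\<^bsub>KQ\<^esub> \<one>\<^bsub>KQ\<^esub>) \<otimes>\<^bsub>KQ\<^esub> x \<in> path_coeff_ideal" by (intro path_coeff_ideal_l_closed) auto
    moreover have "x \<in> carrier KQ" using x by (simp add: path_coeff_ideal_def)
    ultimately show "\<ominus>\<^bsub>KQ\<^esub> x \<in> path_coeff_ideal" by (simp add: R.l_minus)
    fix y assume "y \<in> path_coeff_ideal"
    then show "x \<oplus>\<^bsub>KQ\<^esub> y \<in> path_coeff_ideal"
      using x by (simp add: path_coeff_ideal_def path_coeff_add)
  qed (auto simp: path_coeff_ideal_def)
qed

end

section \<open>The multiplication table in the quotient\<close>

lemma bas_mult_SomeD: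
  assumes "bas_mult n s t = Some r" "n \<ge> 1"
  shows "s \<in> bas_set n \<and> t \<in> bas_set n \<and> r \<in> bas_set n"
  using assms by (cases s; cases t) (auto split: if_splits)

text \<open>Associativity of the table with an arrow as third factor: the induction step when the
  right factor is built up arrow by arrow.\<close>

lemma bas_mult_step:
  assumes s: "s \<in> bas_set n" and j: "j < n" and M: "M < 2 * n"
  shows "bas_mult n s (BP j (Suc M)) =
    (case bas_mult n s (BP j M) of None \<Rightarrow> None | Some r \<Rightarrow> bas_mult n r (BP ((j + M) mod n) 1))"
  using assms by (cases s) (auto simp: mod_simps add.assoc)

context gamma_path
begin

abbreviation rel_ideal :: "(nat \<times> arrow list \<Rightarrow> 'k) set" where
  "rel_ideal \<equiv> genideal KQ (relations_I K n)"

lemma relations_subset: "relations_I K n \<subseteq> carrier KQ"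
proof -
  interpret R: ring KQ by (rule ring_KQ)
  show ?thesis
    by (auto simp: relations_I_def Let_def arrow_word_def path_elem_closed)
qed

sublocale GQ: k_algebra_quotient K KQ rel_ideal
proof (intro k_algebra_quotient.intro)
  show "k_algebra K KQ" by (rule k_algebra_KQ)
  show "ideal rel_ideal KQ" by (rule ring.genideal_ideal[OF ring_KQ relations_subset])
qed

abbreviation GS :: "('k, (nat \<times> arrow list \<Rightarrow> 'k) set) module" where "GS \<equiv> Gamma_star K n"

lemma Gamma_star_eq: "GS = GQ.AQ"
  by (simp add: Gamma_star_def Let_def)

sublocale GA: k_algebra K "GS"
  unfolding Gamma_star_eq by (rule GQ.k_algebra_quotient)

definition pe :: "nat \<times> arrow list \<Rightarrow> (nat \<times> arrow list \<Rightarrow> 'k) set" where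
  "pe p = GQ.cls (PE p)"

lemma pe_closed: "pe p \<in> carrier (GS)"
  by (simp add: pe_def Gamma_star_eq GQ.MQ.coset_closed path_elem_closed)

lemma pe_mult:
  assumes "(u, es) \<in> QP" "(v, fs) \<in> QP"
  shows "pe (u, es) \<otimes>\<^bsub>GS\<^esub> pe (v, fs) =
    (if v = ending u es then pe (u, es @ fs) else \<zero>\<^bsub>GS\<^esub>)"
  using path_elem_mult[OF assms]
  by (simp add: pe_def Gamma_star_eq GQ.cls_mult path_elem_closed GQ.cls_zero)

lemma rel_zero:
  assumes "arrow_word K n es \<in> relations_I K n"
  shows "pe (arrow_source n (hd es), es) = \<zero>\<^bsub>GS\<^esub>"
proof -
  have "arrow_word K n es \<in> rel_ideal"
    using assms ring.genideal_self[OF ring_KQ relations_subset] by blast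
  then show ?thesis
    by (simp add: pe_def Gamma_star_eq GQ.MQ.quotient_simps GQ.MQ.coset_eq_self_iff path_elem_closed arrow_word_def)
qed

lemma rel_eq:
  assumes "arrow_word K n es \<ominus>\<^bsub>KQ\<^esub> arrow_word K n fs \<in> relations_I K n"
  shows "pe (arrow_source n (hd es), es) = pe (arrow_source n (hd fs), fs)"
proof -
  have "arrow_word K n es \<ominus>\<^bsub>KQ\<^esub> arrow_word K n fs \<in> rel_ideal"
    using assms ring.genideal_self[OF ring_KQ relations_subset] by blast
  then show ?thesis
    by (simp add: pe_def GQ.MQ.coset_eq_iff path_elem_closed arrow_word_def)
qed

lemma cc_word: "betas 1 n @ betas 1 n = beta_word n 0 (2 * n)"
  using betas_eq_beta_word[of 0 n n] beta_word_append[of n 0 n n] by (simp add: mult_2)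

lemma hd_cc: "hd (beta_word n 0 (2 * n)) = Beta 1"
  using n_pos by (simp add: beta_word_def hd_map)

lemma pe_alpha: "pe (1, [Alpha1, Alpha2]) = pe cc"
  using rel_eq[of "[Alpha1, Alpha2]" "beta_word n 0 (2 * n)"]
  by (simp add: relations_I_def Let_def cc_word hd_cc del: One_nat_def)

lemma pe_gamma: "pe (1, [Gamma1, Gamma2]) = pe cc"
  using rel_eq[of "beta_word n 0 (2 * n)" "[Gamma1, Gamma2]"]
  by (simp add: relations_I_def Let_def cc_word hd_cc del: One_nat_def)

lemma pe_zero:
  "pe (n, [Beta n, Alpha1]) = \<zero>\<^bsub>GS\<^esub>" "pe (n, [Beta n, Gamma1]) = \<zero>\<^bsub>GS\<^esub>"
  "pe (n + 1, [Alpha2, Beta 1]) = \<zero>\<^bsub>GS\<^esub>" "pe (n + 2, [Gamma2, Beta 1]) = \<zero>\<^bsub>GS\<^esub>"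
  "pe (n + 1, [Alpha2, Alpha1]) = \<zero>\<^bsub>GS\<^esub>" "pe (n + 2, [Gamma2, Gamma1]) = \<zero>\<^bsub>GS\<^esub>"
  using rel_zero[of "[Beta n, Alpha1]"] rel_zero[of "[Beta n, Gamma1]"] rel_zero[of "[Alpha2, Beta 1]"]
    rel_zero[of "[Gamma2, Beta 1]"] rel_zero[of "[Alpha2, Alpha1]"] rel_zero[of "[Gamma2, Gamma1]"]
  by (simp_all add: relations_I_def Let_def del: One_nat_def)

text \<open>With j = i + 1 this is relation (iii). The corresponding vanishing at vertex 1 is a
  consequence of other relations and is derived in \<open>gb_beta\<close>.\<close>

lemma pe_long_pos:
  assumes "0 < i" "i < n"
  shows "pe (i + 1, beta_word n i (2 * n + 1)) = \<zero>\<^bsub>GS\<^esub>"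
proof -
  let ?w = "betas (i + 1) n @ betas 1 n @ betas 1 (i + 1 - 1) @ [Beta (i + 1)]"
  have "?w = beta_word n i (2 * n + 1)"
  proof -
    have 1: "betas (i + 1) n = beta_word n i (n - i)" using betas_eq_beta_word[of i "n - i" n] assms by simp
    have 2: "betas 1 n = beta_word n 0 n" using betas_eq_beta_word[of 0 n n] by simp
    have 3: "betas 1 (i + 1 - 1) = beta_word n 0 i" using betas_eq_beta_word[of 0 i n] assms by simp
    have 4: "beta_word n 0 i @ [Beta (i + 1)] = beta_word n 0 (i + 1)" using assms by (simp add: beta_word_Suc)
    have 5: "beta_word n 0 n @ beta_word n 0 (i + 1) = beta_word n 0 (n + (i + 1))"
      using beta_word_append[of n 0 n "i + 1"] by simp
    have 6: "beta_word n i (n - i) @ beta_word n 0 (n + (i + 1)) = beta_word n i ((n - i) + (n + (i + 1)))"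
      using beta_word_append[of n i "n - i" "n + (i + 1)"] assms by simp
    show ?thesis unfolding 1 2 3 4 5 6 using assms by (simp add: mult_2)
  qed
  moreover have "arrow_word K n ?w \<in> relations_I K n"
    unfolding relations_I_def Let_def using assms by (intro UnI2) (auto intro!: exI[of _ "i + 1"])
  moreover have "arrow_source n (hd (beta_word n i (2 * n + 1))) = i + 1"
    using assms by (simp add: beta_word_def upt_conv_Cons del: upt_Suc)
  ultimately show ?thesis using rel_zero[of ?w] by simp
qed

lemma QP_arrows: "(n + 1, [Alpha2]) \<in> QP" "(n + 2, [Gamma2]) \<in> QP" "(1, [Alpha1]) \<in> QP" "(1, [Gamma1]) \<in> QP"
  "j < n \<Longrightarrow> (j + 1, [Beta (j + 1)]) \<in> QP" "(n + 1, [Alpha2, Gamma1]) \<in> QP" "(n + 2, [Gamma2, Alpha1]) \<in> QP"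
  "u \<in> {1..n + 2} \<Longrightarrow> (u, []) \<in> QP"
  using n_pos by (auto simp: QP_Cons QP_nil)

text \<open>c^2 a = alpha_1 alpha_2 a, where alpha_2 a is zero by assumption. For a = beta_1 this
  gives the missing case of relation (iii).\<close>

lemma pe_cc_arrow:
  assumes "(1, [a]) \<in> QP" "pe (n + 1, [Alpha2, a]) = \<zero>\<^bsub>GS\<^esub>"
  shows "pe (1, beta_word n 0 (2 * n) @ [a]) = \<zero>\<^bsub>GS\<^esub>"
proof -
  have e: "ending 1 [Alpha1, Alpha2] = 1" "ending 1 (beta_word n 0 (2 * n)) = 1" "ending 1 [Alpha1] = n + 1"
    "ending (n + 1) [Alpha2] = 1"
    using beta_word_path[of 0 "2 * n"] n_pos by (auto simp: ending_simp[of _ "_ # _"])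
  have q: "(n + 1, [Alpha2, a]) \<in> QP" using assms(1) by (auto simp: QP_Cons)
  have "pe (1, beta_word n 0 (2 * n) @ [a]) = pe (1, [Alpha1, Alpha2]) \<otimes>\<^bsub>GS\<^esub> pe (1, [a])"
    unfolding pe_alpha using pe_mult[OF cc_QP(1) assms(1)] e by simp
  also have "\<dots> = pe (1, [Alpha1, Alpha2, a])" using pe_mult[OF cc_QP(2) assms(1)] e by simp
  also have "\<dots> = pe (1, [Alpha1]) \<otimes>\<^bsub>GS\<^esub> pe (n + 1, [Alpha2, a])"
    using pe_mult[OF QP_arrows(3) q] e by simp
  finally show ?thesis using assms(2) pe_closed by simp
qed

lemma pe_arrow_cc:
  assumes "(u, [a]) \<in> QP" "pe (u, [a, Beta 1]) = \<zero>\<^bsub>GS\<^esub>" "arrow_target n a = 1"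
  shows "pe (u, a # beta_word n 0 (2 * n)) = \<zero>\<^bsub>GS\<^esub>"
proof -
  have w: "beta_word n 0 (2 * n) = Beta 1 # beta_word n (1 mod n) (2 * n - 1)"
    using beta_word_append[of n 0 1 "2 * n - 1"] n_pos by (simp add: beta_word_Suc)
  have q: "(u, [a, Beta 1]) \<in> QP" using assms(1,3) n_pos by (auto simp: QP_Cons QP_nil)
  have r: "(arrow_target n (Beta 1), beta_word n (1 mod n) (2 * n - 1)) \<in> QP"
    using cc_QP(1) unfolding w by (simp add: QP_Cons)
  have "pe (u, a # beta_word n 0 (2 * n)) =
      pe (u, [a, Beta 1]) \<otimes>\<^bsub>GS\<^esub> pe (arrow_target n (Beta 1), beta_word n (1 mod n) (2 * n - 1))"
    unfolding w using pe_mult[OF q r] by (simp add: ending_simp)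
  then show ?thesis using assms(2) pe_closed by simp
qed

text \<open>Replacing gamma_1 gamma_2 by c^2 makes the first word start with alpha_2 beta_1 = 0; the
  second is symmetric.\<close>

lemma pe_triple:
  "pe (n + 1, [Alpha2, Gamma1, Gamma2]) = \<zero>\<^bsub>GS\<^esub>"
  "pe (n + 2, [Gamma2, Alpha1, Alpha2]) = \<zero>\<^bsub>GS\<^esub>"
proof -
  have e: "ending (n + 1) [Alpha2] = 1" "ending (n + 2) [Gamma2] = 1" by (simp_all add: ending_simp)
  show "pe (n + 1, [Alpha2, Gamma1, Gamma2]) = \<zero>\<^bsub>GS\<^esub>"
    using pe_mult[OF QP_arrows(1) cc_QP(3)] pe_mult[OF QP_arrows(1) cc_QP(1)] e
      pe_arrow_cc[OF QP_arrows(1) pe_zero(3)] by (simp add: pe_gamma del: One_nat_def)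
  show "pe (n + 2, [Gamma2, Alpha1, Alpha2]) = \<zero>\<^bsub>GS\<^esub>"
    using pe_mult[OF QP_arrows(2) cc_QP(2)] pe_mult[OF QP_arrows(2) cc_QP(1)] e
      pe_arrow_cc[OF QP_arrows(2) pe_zero(4)] by (simp add: pe_alpha del: One_nat_def)
qed

definition gb :: "bas \<Rightarrow> (nat \<times> arrow list \<Rightarrow> 'k) set" where
  "gb s = (if s \<in> bas_set n then pe (path_of n s) else \<zero>\<^bsub>GS\<^esub>)"

lemma gb_closed: "gb s \<in> carrier (GS)"
  by (simp add: gb_def pe_closed)

abbreviation gbo :: "bas option \<Rightarrow> (nat \<times> arrow list \<Rightarrow> 'k) set" where
  "gbo r \<equiv> (case r of None \<Rightarrow> \<zero>\<^bsub>GS\<^esub> | Some t \<Rightarrow> gb t)"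

lemma gb_beta:
  assumes i: "i < n" and L: "L \<le> 2 * n" and j: "j < n"
  shows "gb (BP i L) \<otimes>\<^bsub>GS\<^esub> gb (BP j 1) = gbo (bas_mult n (BP i L) (BP j 1))"
proof -
  have p: "(i + 1, beta_word n i L) \<in> QP" "ending (i + 1) (beta_word n i L) = (i + L) mod n + 1"
    "(j + 1, beta_word n j 1) \<in> QP" using beta_word_path[OF i] beta_word_path[OF j] by auto
  have "gb (BP i L) \<otimes>\<^bsub>GS\<^esub> gb (BP j 1) =
      (if j = (i + L) mod n then pe (i + 1, beta_word n i (L + 1)) else \<zero>\<^bsub>GS\<^esub>)"
    using assms pe_mult[OF p(1,3)] p(2) beta_word_append[of n i L 1] by (auto simp: gb_def)
  moreover have "pe (i + 1, beta_word n i (2 * n + 1)) = \<zero>\<^bsub>GS\<^esub>"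
  proof (cases "i = 0")
    case True
    have "(1, [Beta 1]) \<in> QP" using QP_arrows(5)[of 0] n_pos by simp
    from pe_cc_arrow[OF this pe_zero(3)] show ?thesis using True by (simp add: beta_word_Suc)
  qed (use i pe_long_pos in simp)
  ultimately show ?thesis using assms by (cases "L = 2 * n") (auto simp: gb_def)
qed

text \<open>A beta-path of positive length that ends at vertex 1 has beta_n as its last arrow, and
  beta_n alpha_1 = beta_n gamma_1 = 0.\<close>

lemma gb_beta_out:
  assumes i: "i < n" and L: "L \<le> 2 * n" and a: "a = Alpha1 \<or> a = Gamma1"
  shows "pe (i + 1, beta_word n i L) \<otimes>\<^bsub>GS\<^esub> pe (1, [a]) =
    (if i = 0 \<and> L = 0 then pe (1, [a]) else \<zero>\<^bsub>GS\<^esub>)"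
proof -
  have p: "(i + 1, beta_word n i L) \<in> QP" "ending (i + 1) (beta_word n i L) = (i + L) mod n + 1"
    using beta_word_path[OF i] by auto
  have q: "(1, [a]) \<in> QP" using a QP_arrows(3,4) by auto
  have m: "pe (i + 1, beta_word n i L) \<otimes>\<^bsub>GS\<^esub> pe (1, [a]) =
      (if (i + L) mod n = 0 then pe (i + 1, beta_word n i L @ [a]) else \<zero>\<^bsub>GS\<^esub>)"
    using pe_mult[OF p(1) q] p(2) by auto
  show ?thesis
  proof (cases "L = 0 \<or> (i + L) mod n \<noteq> 0")
    case True
    then show ?thesis using m i by auto
  next
    case False
    then obtain M where M: "L = Suc M" using not0_implies_Suc by blast
    have e: "(i + M) mod n + 1 = n" using False unfolding M by (simp add: mod_Suc split: if_splits)
    have r: "(i + 1, beta_word n i M) \<in> QP" "ending (i + 1) (beta_word n i M) = n"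
      using beta_word_path[OF i, of M] e by auto
    have t: "(n, [Beta n, a]) \<in> QP" using q n_pos by (auto simp: QP_Cons)
    have "pe (i + 1, beta_word n i L @ [a]) = pe (i + 1, beta_word n i M) \<otimes>\<^bsub>GS\<^esub> pe (n, [Beta n, a])"
      using pe_mult[OF r(1) t] r(2) e unfolding M by (simp add: beta_word_Suc)
    also have "\<dots> = \<zero>\<^bsub>GS\<^esub>" using a pe_zero(1,2) pe_closed by auto
    finally show ?thesis using m False by simp
  qed
qed

lemma gb_arrow:
  assumes s: "s \<in> bas_set n" and a: "a \<in> {A1, A2, G1, G2} \<or> (\<exists>j<n. a = BP j 1)"
  shows "gb s \<otimes>\<^bsub>GS\<^esub> gb a = gbo (bas_mult n s a)"
proof -
  have as: "a \<in> bas_set n" using a n_pos by auto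
  obtain u es v fs where p: "path_of n s = (u, es)" and q: "path_of n a = (v, fs)" by fastforce
  have m: "gb s \<otimes>\<^bsub>GS\<^esub> gb a =
    (if v = fst (path_of n (tgt n s)) then pe (u, es @ fs) else \<zero>\<^bsub>GS\<^esub>)"
    using pe_mult[of u es v fs] path_of_QP[OF s] path_of_QP[OF as] ending_path_of[OF s] s as
    by (simp add: gb_def p q)
  have w1: "beta_word n j (Suc 0) = [Beta (Suc j)]" if "j < n" for j
    using that by (simp add: beta_word_Suc)
  show ?thesis
  proof (cases s)
    case (BP i L)
    show ?thesis
      using a
    proof
      assume "\<exists>j<n. a = BP j 1"
      then show ?thesis using gb_beta s BP by auto
    next
      have iL: "i < n" "L \<le> 2 * n" using s BP by auto
      assume "a \<in> {A1, A2, G1, G2}"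
      then consider "a = A1" | "a = G1" | "a = A2 \<or> a = G2" by blast
      then show ?thesis
      proof cases
        case 1
        then show ?thesis using gb_beta_out[OF iL, of Alpha1] iL unfolding BP 1 by (simp add: gb_def)
      next
        case 2
        then show ?thesis using gb_beta_out[OF iL, of Gamma1] iL unfolding BP 2 by (simp add: gb_def)
      next
        case 3
        have "(i + L) mod n < n" using n_pos by simp
        then have "v \<noteq> fst (path_of n (tgt n s))" using 3 q BP by auto
        then have "gb s \<otimes>\<^bsub>GS\<^esub> gb a = \<zero>\<^bsub>GS\<^esub>" using m by simp
        moreover have "bas_mult n s a = None" using 3 BP by auto
        ultimately show ?thesis by simp
      qed
    qed
  next
    case EA
    have "v = n + 1 \<longleftrightarrow> a = A2" using a q n_pos by auto
    then show ?thesis using m p q a EA by (auto simp: gb_def)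
  next
    case EG
    have "v = n + 2 \<longleftrightarrow> a = G2" using a q n_pos by auto
    then show ?thesis using m p q a EG by (auto simp: gb_def)
  next
    case A1
    have "v = n + 1 \<longleftrightarrow> a = A2" using a q n_pos by auto
    then show ?thesis using m p q a A1 pe_alpha n_pos by (auto simp: gb_def)
  next
    case G1
    have "v = n + 2 \<longleftrightarrow> a = G2" using a q n_pos by auto
    then show ?thesis using m p q a G1 pe_gamma n_pos by (auto simp: gb_def)
  next
    case A2
    have "v = 1 \<longleftrightarrow> a \<in> {A1, G1, BP 0 1}" using a q n_pos by auto
    then show ?thesis using m p q a A2 pe_zero w1[of 0] n_pos by (auto simp: gb_def)
  next
    case G2
    have "v = 1 \<longleftrightarrow> a \<in> {A1, G1, BP 0 1}" using a q n_pos by auto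
    then show ?thesis using m p q a G2 pe_zero w1[of 0] n_pos by (auto simp: gb_def)
  next
    case A2G1
    have "v = n + 2 \<longleftrightarrow> a = G2" using a q n_pos by auto
    then show ?thesis using m p q a A2G1 pe_triple by (auto simp: gb_def)
  next
    case G2A1
    have "v = n + 1 \<longleftrightarrow> a = A2" using a q n_pos by auto
    then show ?thesis using m p q a G2A1 pe_triple by (auto simp: gb_def)
  qed
qed

lemma gb_idem:
  assumes s: "s \<in> bas_set n" and v: "v \<in> idem_set n"
  shows "gb s \<otimes>\<^bsub>GS\<^esub> gb v = gbo (bas_mult n s v)"
proof -
  have vs: "v \<in> bas_set n" using v by (rule idem_bas)
  obtain u es where p: "path_of n s = (u, es)" by fastforce
  have q: "snd (path_of n v) = []" using v by (auto simp: idem_set_def)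
  have m: "gb s \<otimes>\<^bsub>GS\<^esub> gb v =
    (if fst (path_of n v) = fst (path_of n (tgt n s)) then pe (u, es) else \<zero>\<^bsub>GS\<^esub>)"
    using pe_mult[of u es "fst (path_of n v)" "[]"] path_of_QP[OF s] path_of_QP[OF vs] ending_path_of[OF s] s vs
    by (simp add: gb_def p) (metis append_Nil2 prod.collapse q)
  have ii: "fst (path_of n v) = fst (path_of n w) \<longleftrightarrow> v = w" if "w \<in> idem_set n" for w
    using v that by (auto simp: idem_set_def)
  have "tgt n s \<in> idem_set n" using s n_pos by (cases s) auto
  then have "gb s \<otimes>\<^bsub>GS\<^esub> gb v = (if v = tgt n s then gb s else \<zero>\<^bsub>GS\<^esub>)"
    using m ii s by (simp add: gb_def p)
  moreover have "gbo (bas_mult n s v) = (if v = tgt n s then gb s else \<zero>\<^bsub>GS\<^esub>)"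
    using s v n_pos by (cases s) (auto simp: idem_set_def split: if_splits)
  ultimately show ?thesis by simp
qed

text \<open>The right factor is built up from a vertex by appending arrows, using s(ra) = (sr)a.
  Only products with a vertex or an arrow on the right have to be compared with the
  relations.\<close>

lemma gb_mult: "gb s \<otimes>\<^bsub>GS\<^esub> gb t = gbo (bas_mult n s t)"
proof (cases "s \<in> bas_set n \<and> t \<in> bas_set n")
  case False
  then have "bas_mult n s t = None" using bas_mult_SomeD[OF _ n_pos] by (metis not_Some_eq)
  moreover have "gb s = \<zero>\<^bsub>GS\<^esub> \<or> gb t = \<zero>\<^bsub>GS\<^esub>" using False by (auto simp: gb_def)
  then have "gb s \<otimes>\<^bsub>GS\<^esub> gb t = \<zero>\<^bsub>GS\<^esub>"
    by (elim disjE) (simp_all only: GA.A.l_null GA.A.r_null gb_closed)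
  ultimately show ?thesis by simp
next
  case True
  then have s: "s \<in> bas_set n" and t: "t \<in> bas_set n" by auto
  have step: "gb s \<otimes>\<^bsub>GS\<^esub> gb r = gbo (bas_mult n s r)"
    if "gb s \<otimes>\<^bsub>GS\<^esub> gb r' = gbo (bas_mult n s r')" "gb r' \<otimes>\<^bsub>GS\<^esub> gb a = gb r"
      "a \<in> {A1, A2, G1, G2} \<or> (\<exists>j<n. a = BP j 1)"
      "bas_mult n s r = (case bas_mult n s r' of None \<Rightarrow> None | Some q \<Rightarrow> bas_mult n q a)" for r r' a
  proof -
    have "gb s \<otimes>\<^bsub>GS\<^esub> gb r = (gb s \<otimes>\<^bsub>GS\<^esub> gb r') \<otimes>\<^bsub>GS\<^esub> gb a"
      using that(2) gb_closed by (simp add: GA.A.m_assoc)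
    then show ?thesis
      using that(1,3,4) gb_arrow bas_mult_SomeD[OF _ n_pos, of s r'] gb_closed
      by (cases "bas_mult n s r'") simp_all
  qed
  have path: "gb s \<otimes>\<^bsub>GS\<^esub> gb (BP j M) = gbo (bas_mult n s (BP j M))" if "j < n" "M \<le> 2 * n" for j M
    using that(2)
  proof (induction M)
    case 0
    then show ?case using gb_idem[OF s, of "BP j 0"] that by simp
  next
    case (Suc M)
    show ?case
    proof (rule step[of "BP j M" "BP ((j + M) mod n) 1"])
      show "gb (BP j M) \<otimes>\<^bsub>GS\<^esub> gb (BP ((j + M) mod n) 1) = gb (BP j (Suc M))"
        using gb_beta[of j M "(j + M) mod n"] that(1) Suc.prems n_pos by simp
      show "bas_mult n s (BP j (Suc M)) =
          (case bas_mult n s (BP j M) of None \<Rightarrow> None | Some r \<Rightarrow> bas_mult n r (BP ((j + M) mod n) 1))"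
        using bas_mult_step[OF s that(1)] Suc.prems by simp
    qed (use Suc n_pos in auto)
  qed
  show ?thesis
  proof (cases t)
    case (BP j M)
    then show ?thesis using t path by simp
  next
    case A2G1
    show ?thesis unfolding A2G1
    proof (rule step[of A2 G1])
      show "gb s \<otimes>\<^bsub>GS\<^esub> gb A2 = gbo (bas_mult n s A2)" using gb_arrow[OF s, of A2] by simp
      show "gb A2 \<otimes>\<^bsub>GS\<^esub> gb G1 = gb A2G1" using gb_arrow[of A2 G1] by simp
      show "bas_mult n s A2G1 = (case bas_mult n s A2 of None \<Rightarrow> None | Some q \<Rightarrow> bas_mult n q G1)"
        using n_pos by (cases s) simp_all
    qed simp
  next
    case G2A1
    show ?thesis unfolding G2A1
    proof (rule step[of G2 A1])
      show "gb s \<otimes>\<^bsub>GS\<^esub> gb G2 = gbo (bas_mult n s G2)" using gb_arrow[OF s, of G2] by simp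
      show "gb G2 \<otimes>\<^bsub>GS\<^esub> gb A1 = gb G2A1" using gb_arrow[of G2 A1] by simp
      show "bas_mult n s G2A1 = (case bas_mult n s G2 of None \<Rightarrow> None | Some q \<Rightarrow> bas_mult n q A1)"
        using n_pos by (cases s) simp_all
    qed simp
  qed (use gb_idem[OF s] gb_arrow[OF s] in auto)
qed

end

section \<open>Independence and spanning of the normal forms\<close>

lemma beta_word_eqD: "beta_word n i L = beta_word m j M \<Longrightarrow> L = M"
  by (metis length_beta_word)

context gamma_path
begin

lemma path_coeff_PE:
  assumes "s \<in> bas_set n" "p \<in> QP"
  shows "path_coeff s (PE p) = (if p = path_of n s \<or> s = BP 0 (2 * n) \<and> p \<in> {(1, [Alpha1, Alpha2]), (1, [Gamma1, Gamma2])}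
    then \<one> else \<zero>)"
  using assms cc_QP path_of_QP[OF assms(1)] by (auto simp: path_coeff_def path_elem_apply)

lemma path_coeff_diff:
  assumes s: "s \<in> bas_set n" and x: "x \<in> carrier KQ" and y: "y \<in> carrier KQ"
  shows "path_coeff s (x \<ominus>\<^bsub>KQ\<^esub> y) = path_coeff s x \<ominus> path_coeff s y"
proof -
  have "\<ominus>\<^bsub>KQ\<^esub> y = (\<ominus> \<one>) \<odot>\<^bsub>KQ\<^esub> y" using y by (simp add: GQ.M.smult_l_minus)
  then show ?thesis
    using x y path_coeff_closed[OF s y] s
    by (simp add: a_minus_def path_coeff_add path_coeff_smult KQ_smult_closed K.l_minus)
qed

text \<open>The two paths in a difference look alike to every functional: 1 for that of c^2, 0 for
  the others. The word of a monomial relation is neither a normal form nor alpha_1 alpha_2 nor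
  gamma_1 gamma_2, so no functional sees it.\<close>

lemma relations_coeff_ideal: "relations_I K n \<subseteq> path_coeff_ideal"
proof
  fix x assume x: "x \<in> relations_I K n"
  have diff: "PE p \<ominus>\<^bsub>KQ\<^esub> PE q \<in> path_coeff_ideal"
    if "p \<in> {cc, (1, [Alpha1, Alpha2]), (1, [Gamma1, Gamma2])}" "q \<in> {cc, (1, [Alpha1, Alpha2]), (1, [Gamma1, Gamma2])}" for p q
  proof -
    have "path_coeff s (PE p) = path_coeff s (PE q)" if s: "s \<in> bas_set n" for s
    proof (cases "s = BP 0 (2 * n)")
      case True
      then show ?thesis
        using \<open>p \<in> _\<close> \<open>q \<in> _\<close> cc_QP s by (auto simp: path_coeff_PE)
    next
      case False
      have "path_of n s \<notin> {cc, (1, [Alpha1, Alpha2]), (1, [Gamma1, Gamma2])}"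
        using s False n_pos by (cases s) (auto dest: beta_word_eqD)
      then show ?thesis using \<open>p \<in> _\<close> \<open>q \<in> _\<close> cc_QP s False by (auto simp: path_coeff_PE)
    qed
    then show ?thesis
      using path_coeff_diff[OF _ path_elem_closed path_elem_closed] path_coeff_closed[OF _ path_elem_closed] path_elem_closed
      by (auto simp: path_coeff_ideal_def K.r_neg a_minus_def intro!: KQ_add_closed GQ.A.a_inv_closed)
  qed
  have zero: "PE (u, es) \<in> path_coeff_ideal"
    if "(u, es) \<notin> path_of n ` bas_set n" "es \<noteq> [Alpha1, Alpha2]" "es \<noteq> [Gamma1, Gamma2]" for u es
  proof -
    have "path_coeff s (PE (u, es)) = \<zero>" if "s \<in> bas_set n" for s
    proof -
      have "path_of n s \<noteq> (u, es)" "cc \<noteq> (u, es)" using that \<open>(u, es) \<notin> _\<close> cc_mem by (metis image_eqI)+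
      then show ?thesis
        using \<open>es \<noteq> [Alpha1, Alpha2]\<close> \<open>es \<noteq> [Gamma1, Gamma2]\<close> cc_QP path_of_QP[OF that]
        by (auto simp: path_coeff_def path_elem_apply)
    qed
    then show ?thesis using path_elem_closed by (simp add: path_coeff_ideal_def)
  qed
  have not_path: "(u, es) \<notin> path_of n ` bas_set n"
    if "\<And>i L. L \<le> 2 * n \<Longrightarrow> es \<noteq> beta_word n i L"
      "es \<notin> {[], [Alpha1], [Alpha2], [Gamma1], [Gamma2], [Alpha2, Gamma1], [Gamma2, Alpha1]}" for u es
  proof
    assume "(u, es) \<in> path_of n ` bas_set n"
    then obtain s where s: "(u, es) = path_of n s" "s \<in> bas_set n" by blast
    then show False using that by (cases s) auto
  qed
  have set_bw: "Alpha1 \<notin> set (beta_word n i L)" "Gamma1 \<notin> set (beta_word n i L)" "Alpha2 \<notin> set (beta_word n i L)"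
      "Gamma2 \<notin> set (beta_word n i L)" for i L by (auto simp: beta_word_def)
  have word: "arrow_word K n es \<in> path_coeff_ideal"
    if "es \<in> {[Beta n, Alpha1], [Beta n, Gamma1], [Alpha2, Beta 1], [Gamma2, Beta 1], [Alpha2, Alpha1], [Gamma2, Gamma1]}" for es
  proof -
    have "es \<noteq> beta_word n i L" for i L
    proof
      assume "es = beta_word n i L"
      then have "Alpha1 \<notin> set es" "Gamma1 \<notin> set es" "Alpha2 \<notin> set es" "Gamma2 \<notin> set es" using set_bw by auto
      then show False using that by auto
    qed
    then have "(arrow_source n (hd es), es) \<notin> path_of n ` bas_set n" by (rule not_path) (use that in auto)
    then show ?thesis unfolding arrow_word_def by (rule zero) (use that in auto)
  qed
  have long: "arrow_word K n (betas j n @ betas 1 n @ betas 1 (j - 1) @ [Beta j]) \<in> path_coeff_ideal" if j: "j \<in> {2..n}" for j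
  proof -
    let ?w = "betas j n @ betas 1 n @ betas 1 (j - 1) @ [Beta j]"
    \<comment> \<open>One arrow longer than any normal form, which is all that matters about this
      word.\<close>
    have l: "length ?w = 2 * n + 1" using j by (auto simp: betas_def)
    have "?w \<noteq> beta_word n i L" if "L \<le> 2 * n" for i L
    proof
      assume "?w = beta_word n i L"
      then have "length ?w = L" by (metis length_beta_word)
      then show False using that l by simp
    qed
    moreover have short: "?w \<noteq> es" if "length es < 2 * n + 1" for es using l that by (metis less_irrefl)
    ultimately have "(arrow_source n (hd ?w), ?w) \<notin> path_of n ` bas_set n"
      using j by (intro not_path) (auto simp: short simp del: append_is_Nil_conv append_eq_Cons_conv)
    then show ?thesis unfolding arrow_word_def
      by (rule zero) (use short j in \<open>auto simp del: append_is_Nil_conv append_eq_Cons_conv\<close>)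
  qed
  have src: "arrow_source n (hd (beta_word n 0 (2 * n))) = 1" by (simp add: hd_cc)
  show "x \<in> path_coeff_ideal"
    using x unfolding relations_I_def Let_def
  proof (elim UnE)
    assume "x \<in> {arrow_word K n [Alpha1, Alpha2] \<ominus>\<^bsub>KQ\<^esub> arrow_word K n (betas 1 n @ betas 1 n),
         arrow_word K n (betas 1 n @ betas 1 n) \<ominus>\<^bsub>KQ\<^esub> arrow_word K n [Gamma1, Gamma2]}"
    then show ?thesis using diff src unfolding cc_word arrow_word_def by auto
  next
    assume "x \<in> {arrow_word K n [Beta n, Alpha1], arrow_word K n [Beta n, Gamma1], arrow_word K n [Alpha2, Beta 1],
      arrow_word K n [Gamma2, Beta 1], arrow_word K n [Alpha2, Alpha1], arrow_word K n [Gamma2, Gamma1]}"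
    then show ?thesis using word by blast
  next
    assume "x \<in> {arrow_word K n (betas j n @ betas 1 n @ betas 1 (j - 1) @ [Beta j]) | j. j \<in> {2..n}}"
    then show ?thesis using long by blast
  qed
qed

lemma rel_ideal_coeff:
  assumes "x \<in> rel_ideal" "s \<in> bas_set n"
  shows "path_coeff s x = \<zero>"
  using ring.genideal_minimal[OF ring_KQ ideal_coeff_ideal relations_coeff_ideal] assms
  by (auto simp: path_coeff_ideal_def)

text \<open>The functional is evaluated at a chosen representative; \<open>gco_cls\<close> shows
  that the choice does not matter. Off the basis it is zero, in accordance with
  \<open>co_b\<close>.\<close>

definition gco :: "bas \<Rightarrow> (nat \<times> arrow list \<Rightarrow> 'k) set \<Rightarrow> 'k" where
  "gco s C = (if s \<in> bas_set n then path_coeff s (SOME x. x \<in> carrier KQ \<and> C = GQ.cls x) else \<zero>)"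

lemma gco_cls:
  assumes s: "s \<in> bas_set n" and x: "x \<in> carrier KQ"
  shows "gco s (GQ.cls x) = path_coeff s x"
proof -
  define y where "y = (SOME y. y \<in> carrier KQ \<and> GQ.cls x = GQ.cls y)"
  have y: "y \<in> carrier KQ" "GQ.cls x = GQ.cls y"
    using someI_ex[of "\<lambda>y. y \<in> carrier KQ \<and> GQ.cls x = GQ.cls y"] x by (auto simp: y_def)
  then have "path_coeff s (x \<ominus>\<^bsub>KQ\<^esub> y) = \<zero>" using rel_ideal_coeff s x by (simp add: GQ.MQ.coset_eq_iff)
  then have "path_coeff s x = path_coeff s y"
    using path_coeff_diff[OF s x y(1)] path_coeff_closed[OF s x] path_coeff_closed[OF s y(1)] by simp
  then show ?thesis using s by (simp add: gco_def y_def)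
qed

lemma pe_arrow:
  assumes "(arrow_source n a, [a]) \<in> QP"
  shows "pe (arrow_source n a, [a]) = gb (bas_of a) \<and> bas_of a \<in> bas_set n"
proof (cases a)
  case (Beta j)
  then have j: "1 \<le> j" "j \<le> n" using assms by (auto simp: QP_Cons)
  then have "beta_word n (j - 1) (Suc 0) = [Beta j]" by (simp add: beta_word_Suc)
  then show ?thesis using j by (auto simp: Beta bas_of_def gb_def)
qed (auto simp: bas_of_def gb_def)

text \<open>\<open>gb_mult\<close> tells what happens when an arrow is appended to a normal form, so
  a path is rewritten from its start arrow by arrow. This is the spanning half of the basis
  property.\<close>

lemma pe_normal_form:
  assumes "(u, es) \<in> QP"
  shows "pe (u, es) = \<zero>\<^bsub>GS\<^esub> \<or> (\<exists>t\<in>bas_set n. pe (u, es) = gb t)"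
  using assms
proof (induction es rule: rev_induct)
  case Nil
  then have "u \<in> {1..n + 2}" by (simp add: QP_nil)
  then consider "u - 1 < n" "u = u - 1 + 1" | "u = n + 1" | "u = n + 2" by force
  then have "\<exists>t\<in>bas_set n. path_of n t = (u, [])"
  proof cases
    case 1
    then show ?thesis by (intro bexI[of _ "BP (u - 1) 0"]) auto
  next
    case 2
    then show ?thesis by (intro bexI[of _ EA]) auto
  next
    case 3
    then show ?thesis by (intro bexI[of _ EG]) auto
  qed
  then obtain t where "t \<in> bas_set n" "path_of n t = (u, [])" by blast
  then have "pe (u, []) = gb t" by (simp add: gb_def)
  then show ?case using \<open>t \<in> bas_set n\<close> by blast
next
  case (snoc a es)
  have p: "(u, es) \<in> QP" "(ending u es, [a]) \<in> QP" using snoc.prems by (simp_all add: QP_append_iff)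
  then have a: "ending u es = arrow_source n a" by (simp add: QP_Cons)
  have e: "pe (u, es @ [a]) = pe (u, es) \<otimes>\<^bsub>GS\<^esub> gb (bas_of a)"
    using pe_mult[OF p] pe_arrow[of a] p(2) a by simp
  show ?case
    using snoc.IH[OF p(1)]
  proof
    assume "pe (u, es) = \<zero>\<^bsub>GS\<^esub>"
    then show ?thesis using e gb_closed GA.A.l_null by simp
  next
    assume "\<exists>t\<in>bas_set n. pe (u, es) = gb t"
    then obtain t where "pe (u, es) = gb t" by blast
    then have "pe (u, es @ [a]) = gbo (bas_mult n t (bas_of a))" using e gb_mult by simp
    then show ?thesis
      using bas_mult_SomeD[OF _ n_pos, of t "bas_of a"] by (cases "bas_mult n t (bas_of a)") auto
  qed
qed

lemma gco_gb: "gco s (gb t) = (if s = t \<and> t \<in> bas_set n then \<one> else \<zero>)"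
proof (cases "s \<in> bas_set n")
  case s: True
  show ?thesis
  proof (cases "t \<in> bas_set n")
    case t: True
    have inj: "path_of n t = path_of n s \<longleftrightarrow> t = s"
      using s t n_pos by (cases s; cases t) (auto dest: beta_word_eqD)
    have "path_of n t \<noteq> (1, [Alpha1, Alpha2])" "path_of n t \<noteq> (1, [Gamma1, Gamma2])"
      by (cases t; simp)+
    then show ?thesis
      using s t inj gco_cls[OF s path_elem_closed] path_coeff_PE[OF s path_of_QP[OF t]]
      by (auto simp: gb_def pe_def)
  next
    case False
    have "path_coeff s \<zero>\<^bsub>KQ\<^esub> = \<zero>"
      using rel_ideal_coeff[OF _ s] additive_subgroup.zero_closed[OF GQ.is_additive_subgroup] by blast
    then show ?thesis using False gco_cls[OF s KQ_zero_closed] by (simp add: gb_def Gamma_star_eq GQ.cls_zero)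
  qed
qed (auto simp: gco_def)

lemma gamma_expand_cls:
  assumes x: "x \<in> carrier KQ"
  shows "GQ.cls x = (\<Oplus>\<^bsub>GS\<^esub>s\<in>bas_set n. path_coeff s x \<odot>\<^bsub>GS\<^esub> gb s)"
proof (rule path_span_induct[where P = "\<lambda>x. GQ.cls x =
    (\<Oplus>\<^bsub>GS\<^esub>s\<in>bas_set n. path_coeff s x \<odot>\<^bsub>GS\<^esub> gb s)", OF _ _ _ x])
  have "path_coeff s \<zero>\<^bsub>KQ\<^esub> = \<zero>" if "s \<in> bas_set n" for s
    using rel_ideal_coeff[OF _ that] additive_subgroup.zero_closed[OF GQ.is_additive_subgroup] by blast
  then have "(\<Oplus>\<^bsub>GS\<^esub>s\<in>bas_set n. path_coeff s \<zero>\<^bsub>KQ\<^esub> \<odot>\<^bsub>GS\<^esub> gb s) =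
      (\<Oplus>\<^bsub>GS\<^esub>s\<in>bas_set n. \<zero>\<^bsub>GS\<^esub>)"
    by (intro GA.A.finsum_cong') (auto simp: gb_closed)
  then show "GQ.cls \<zero>\<^bsub>KQ\<^esub> =
      (\<Oplus>\<^bsub>GS\<^esub>s\<in>bas_set n. path_coeff s \<zero>\<^bsub>KQ\<^esub> \<odot>\<^bsub>GS\<^esub> gb s)"
    by (simp add: GQ.cls_zero[symmetric] Gamma_star_eq[symmetric])
next
  fix x y
  assume 2: "x \<in> carrier KQ" "y \<in> carrier KQ"
    "GQ.cls x = (\<Oplus>\<^bsub>GS\<^esub>s\<in>bas_set n. path_coeff s x \<odot>\<^bsub>GS\<^esub> gb s)"
    "GQ.cls y = (\<Oplus>\<^bsub>GS\<^esub>s\<in>bas_set n. path_coeff s y \<odot>\<^bsub>GS\<^esub> gb s)"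
  have "(\<Oplus>\<^bsub>GS\<^esub>s\<in>bas_set n. path_coeff s (x \<oplus>\<^bsub>KQ\<^esub> y) \<odot>\<^bsub>GS\<^esub> gb s) =
      (\<Oplus>\<^bsub>GS\<^esub>s\<in>bas_set n. path_coeff s x \<odot>\<^bsub>GS\<^esub> gb s \<oplus>\<^bsub>GS\<^esub> path_coeff s y \<odot>\<^bsub>GS\<^esub> gb s)"
    using 2 by (intro GA.A.finsum_cong') (auto simp: gb_closed path_coeff_add path_coeff_closed GA.M.smult_l_distr)
  also have "\<dots> = GQ.cls x \<oplus>\<^bsub>GS\<^esub> GQ.cls y"
    unfolding 2(3,4) using 2(1,2) by (intro GA.A.finsum_addf) (auto simp: gb_closed path_coeff_closed)
  finally show "GQ.cls (x \<oplus>\<^bsub>KQ\<^esub> y) =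
      (\<Oplus>\<^bsub>GS\<^esub>s\<in>bas_set n. path_coeff s (x \<oplus>\<^bsub>KQ\<^esub> y) \<odot>\<^bsub>GS\<^esub> gb s)"
    using GQ.MQ.quotient_add[OF 2(1,2)] by (simp add: Gamma_star_eq)
next
  fix c p
  assume 3: "c \<in> carrier K" "p \<in> QP"
  have cp: "GQ.cls (c \<odot>\<^bsub>KQ\<^esub> PE p) = c \<odot>\<^bsub>GS\<^esub> pe p"
    using 3 by (simp add: pe_def Gamma_star_eq GQ.MQ.quotient_smult path_elem_closed)
  have co: "path_coeff s (c \<odot>\<^bsub>KQ\<^esub> PE p) = c \<otimes> gco s (pe p)" if "s \<in> bas_set n" for s
    using path_coeff_smult[OF that path_elem_closed 3(1)] gco_cls[OF that path_elem_closed] by (simp add: pe_def)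
  have nf: "pe p = \<zero>\<^bsub>GS\<^esub> \<or> (\<exists>t\<in>bas_set n. pe p = gb t)"
    using pe_normal_form[of "fst p" "snd p"] 3(2) by simp
  obtain r where r: "pe p = gb r"
  proof -
    \<comment> \<open>An index off the basis represents zero, so both alternatives of
      \<open>nf\<close> have the form \<open>gb r\<close>.\<close>
    have "gb (BP n 0) = \<zero>\<^bsub>GS\<^esub>" by (simp add: gb_def)
    then show thesis using nf that by metis
  qed
  have "(\<Oplus>\<^bsub>GS\<^esub>s\<in>bas_set n. path_coeff s (c \<odot>\<^bsub>KQ\<^esub> PE p) \<odot>\<^bsub>GS\<^esub> gb s) =
      (\<Oplus>\<^bsub>GS\<^esub>s\<in>bas_set n. if r = s then c \<odot>\<^bsub>GS\<^esub> gb s else \<zero>\<^bsub>GS\<^esub>)"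
    using 3(1) by (intro GA.A.finsum_cong') (auto simp: co r gco_gb gb_closed)
  also have "\<dots> = c \<odot>\<^bsub>GS\<^esub> gb r"
  proof (cases "r \<in> bas_set n")
    case True
    then show ?thesis using 3(1) by (intro GA.A.finsum_singleton) (auto simp: gb_closed)
  next
    case False
    then have "(\<Oplus>\<^bsub>GS\<^esub>s\<in>bas_set n. if r = s then c \<odot>\<^bsub>GS\<^esub> gb s else \<zero>\<^bsub>GS\<^esub>) =
      (\<Oplus>\<^bsub>GS\<^esub>s\<in>bas_set n. \<zero>\<^bsub>GS\<^esub>)"
      by (intro GA.A.finsum_cong') auto
    then show ?thesis using False 3(1) by (simp add: gb_def)
  qed
  finally show "GQ.cls (c \<odot>\<^bsub>KQ\<^esub> PE p) =
      (\<Oplus>\<^bsub>GS\<^esub>s\<in>bas_set n. path_coeff s (c \<odot>\<^bsub>KQ\<^esub> PE p) \<odot>\<^bsub>GS\<^esub> gb s)"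
    using cp r by simp
qed

theorem gamma_star_has_basis: "gamma_star_basis K (GS) n gb gco"
proof -
  have elem: "\<exists>x\<in>carrier KQ. C = GQ.cls x" if "C \<in> carrier (GS)" for C
    using that GQ.MQ.quotient_carrierE unfolding Gamma_star_eq by blast
  have expand: "C = (\<Oplus>\<^bsub>GS\<^esub>s\<in>bas_set n. gco s C \<odot>\<^bsub>GS\<^esub> gb s)"
    if C: "C \<in> carrier (GS)" for C
  proof -
    obtain x where x: "x \<in> carrier KQ" "C = GQ.cls x" using elem[OF C] by blast
    have "(\<Oplus>\<^bsub>GS\<^esub>s\<in>bas_set n. gco s C \<odot>\<^bsub>GS\<^esub> gb s) =
        (\<Oplus>\<^bsub>GS\<^esub>s\<in>bas_set n. path_coeff s x \<odot>\<^bsub>GS\<^esub> gb s)"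
      using x by (intro GA.A.finsum_cong') (auto simp: gco_cls gb_closed path_coeff_closed)
    then show ?thesis using gamma_expand_cls[OF x(1)] x(2) by simp
  qed
  have one: "\<one>\<^bsub>GS\<^esub> = (\<Oplus>\<^bsub>GS\<^esub>v\<in>idem_set n. gb v)"
  proof -
    have "gco s \<one>\<^bsub>GS\<^esub> = (if s \<in> idem_set n then \<one> else \<zero>)" if s: "s \<in> bas_set n" for s
    proof -
      have "gco s \<one>\<^bsub>GS\<^esub> = path_coeff s \<one>\<^bsub>KQ\<^esub>"
        using gco_cls[OF s KQ_one_closed] by (simp add: Gamma_star_eq GQ.cls_one)
      also have "\<dots> = (if s \<in> idem_set n then \<one> else \<zero>)"
        using path_of_QP[OF s] cc_QP s n_pos by (cases s) (auto simp: path_coeff_def KQ_one)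
      finally show ?thesis .
    qed
    then have "(\<Oplus>\<^bsub>GS\<^esub>s\<in>bas_set n. gco s \<one>\<^bsub>GS\<^esub> \<odot>\<^bsub>GS\<^esub> gb s) =
        (\<Oplus>\<^bsub>GS\<^esub>s\<in>bas_set n. if s \<in> idem_set n then gb s else \<zero>\<^bsub>GS\<^esub>)"
      by (intro GA.A.finsum_cong') (auto simp: gb_closed)
    also have "\<dots> = (\<Oplus>\<^bsub>GS\<^esub>v\<in>idem_set n. gb v)"
      by (rule GA.A.add.finprod_mono_neutral_cong_right) (auto simp: idem_bas gb_closed)
    finally show ?thesis using expand[OF GA.A.one_closed] by simp
  qed
  show ?thesis
  proof unfold_locales
    fix C s assume C: "C \<in> carrier (GS)"
    show "gco s C \<in> carrier K" using elem[OF C] gco_cls path_coeff_closed by (cases "s \<in> bas_set n") (auto simp: gco_def)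
  next
    fix C D s assume "C \<in> carrier (GS)" "D \<in> carrier (GS)"
    then obtain x y where x: "x \<in> carrier KQ" "C = GQ.cls x" and y: "y \<in> carrier KQ" "D = GQ.cls y"
      using elem by blast
    have "C \<oplus>\<^bsub>GS\<^esub> D = GQ.cls (x \<oplus>\<^bsub>KQ\<^esub> y)" using x y by (simp add: Gamma_star_eq GQ.MQ.quotient_add)
    then show "gco s (C \<oplus>\<^bsub>GS\<^esub> D) = gco s C \<oplus> gco s D"
      using gco_cls[of s] x y KQ_add_closed[OF x(1) y(1)] path_coeff_add by (cases "s \<in> bas_set n") (simp_all add: gco_def)
  next
    fix c C s assume c: "c \<in> carrier K" and "C \<in> carrier (GS)"
    then obtain x where x: "x \<in> carrier KQ" "C = GQ.cls x" using elem by blast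
    have "c \<odot>\<^bsub>GS\<^esub> C = GQ.cls (c \<odot>\<^bsub>KQ\<^esub> x)" using x c by (simp add: Gamma_star_eq GQ.MQ.quotient_smult)
    then show "gco s (c \<odot>\<^bsub>GS\<^esub> C) = c \<otimes> gco s C"
      using gco_cls[of s] x c KQ_smult_closed[OF x(1) c] path_coeff_smult by (cases "s \<in> bas_set n") (simp_all add: gco_def)
  qed (use n_pos gb_closed gb_mult one gco_gb expand in \<open>auto simp: gb_def\<close>)
qed

end

theorem theorem4p4:
  fixes K :: "('k, 'b) ring_scheme" and n :: nat
  assumes "algebraically_closed K"
    and "n \<ge> 1"
  shows "vectorspace K (HH K (Gamma_star K n) 2)
    \<and> vectorspace.fin_dim K (HH K (Gamma_star K n) 2)
    \<and> vectorspace.dim K (HH K (Gamma_star K n) 2) = 2"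
proof -
  interpret gamma_path K n
    using assms by (intro gamma_pathI algebraically_closed.axioms(1))
  interpret B: gamma_star_basis K "Gamma_star K n" n gb gco
    by (rule gamma_star_has_basis)
  show ?thesis by (rule B.HH2_dim)
qed

end
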